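(* For every $r$-tuple $\ell=(l_1,\ldots,l_r)$ of nonnegative integers, the rational function $$N(\mathbf{x};\ell)=D(\mathbf{x})\,f(\mathbf{x};\ell)\in\mathbb{C}(x_1,\ldots,x_r)$$ is a polynomial in $x_1,\ldots,x_r$.
   Context: Let $\Phi$ be a simply-laced reduced root system of rank $r$ with Weyl group $W$, a fixed decomposition $\Phi=\Phi^+\cup\Phi^-$ into positive and negative roots, simple roots $\alpha_1,\ldots,\alpha_r$ and corresponding simple reflections $\sigma_1,\ldots,\sigma_r\in W$. Indices $i\ne j$ are adjacent if the corresponding nodes of the Dynkin diagram are adjacent. Let $\rho=\frac12\sum_{\alpha\in\Phi^+}\alpha$, let $\Lambda$ be the root lattice, and for $\lambda=\sum_i k_i\alpha_i\in\Lambda$ put $d(\lambda)=\sum_i k_i$ and $\mathbf{x}^\lambda=x_1^{k_1}\cdots x_r^{k_r}$. Fix a prime power $q$, with $\sqrt q>0$, and let $F=\mathbb{C}(x_1,\ldots,x_r)$, $\mathbf{x}=(x_1,\ldots,x_r)$. The tuple $\ell=(l_1,\ldots,l_r)\in(\mathbb{Z}_{\ge0})^r$ is called the twisting parameter. Define $\sigma_i\mathbf{x}=\mathbf{x}'$ by $x_j'=x_ix_j\sqrt q$ if $i$ and $j$ are adjacent, $x_j'=1/(qx_j)$ if $j=i$, and $x_j'=x_j$ otherwise; this extends to an action of $W$ on $\mathbf{x}$, written $w\mathbf{x}$. Define $\epsilon_i\mathbf{x}=\mathbf{x}'$ by $x_j'=-x_j$ if $i$ and $j$ are adjacent and $x_j'=x_j$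 otherwise. For $f\in F$ set $$f^{\pm}_{i,\ell}(\mathbf{x})=\frac{f(\mathbf{x})\pm(-1)^{l_i}f(\epsilon_i\mathbf{x})}{2},$$ $$(f|_\ell\sigma_i)(\mathbf{x})=-\frac{1-qx_i}{qx_i(1-x_i)}(x_i\sqrt q)^{l_i}f^+_{i,\ell}(\sigma_i\mathbf{x})+\frac{1}{x_i\sqrt q}(x_i\sqrt q)^{l_i}f^-_{i,\ell}(\sigma_i\mathbf{x}).$$ This extends to a (right) action $f\mapsto f|_\ell w$ of $W$ on $F$, i.e. $f|_\ell(ww')=(f|_\ell w)|_\ell w'$. Define $$\Delta(\mathbf{x})=\prod_{\alpha\in\Phi^+}(1-q^{d(\alpha)}\mathbf{x}^{2\alpha}),\qquad j(w,\mathbf{x})=\Delta(\mathbf{x})/\Delta(w\mathbf{x})=\operatorname{sgn}(w)\,q^{d(\rho-w^{-1}\rho)}\mathbf{x}^{2(\rho-w^{-1}\rho)},$$ $$f(\mathbf{x};\ell)=\Delta(\mathbf{x})^{-1}\sum_{w\in W}j(w,\mathbf{x})\,(1|_\ell w)(\mathbf{x}),\qquad D(\mathbf{x})=\prod_{\alpha\in\Phi^+}(1-q^{d(\alpha)-1}\mathbf{x}^{2\alpha}).$$ *)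

theory Defs
  imports
    "HOL-Analysis.Analysis"
    "HOL-Library.Poly_Mapping"
    "HOL-Computational_Algebra.Polynomial_Factorial"
    "HOL-Number_Theory.Prime_Powers"
begin

section \<open>Root systems\<close>

definition root_refl :: "'a::euclidean_space \<Rightarrow> 'a \<Rightarrow> 'a" where
  "root_refl \<beta> v = v - (2 * (v \<bullet> \<beta>) / (\<beta> \<bullet> \<beta>)) *\<^sub>R \<beta>"

text \<open>A root system is not required to span the ambient space; it is a root system in its span.\<close>

definition reduced_root_system :: "'a::euclidean_space set \<Rightarrow> bool" where
  "reduced_root_system \<Phi> \<longleftrightarrow>
     finite \<Phi> \<and> 0 \<notin> \<Phi> \<and>
     (\<forall>\<beta>\<in>\<Phi>. \<forall>\<gamma>\<in>\<Phi>. root_refl \<beta> \<gamma> \<in> \<Phi>) \<and>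
     (\<forall>\<beta>\<in>\<Phi>. \<forall>\<gamma>\<in>\<Phi>. 2 * (\<gamma> \<bullet> \<beta>) / (\<beta> \<bullet> \<beta>) \<in> \<int>) \<and>
     (\<forall>\<beta>\<in>\<Phi>. \<forall>c. c *\<^sub>R \<beta> \<in> \<Phi> \<longrightarrow> c = 1 \<or> c = - 1)"

text \<open>Simple roots are indexed by a finite type whose cardinality is the rank.\<close>

definition simple_roots :: "'a::euclidean_space set \<Rightarrow> ('r::finite \<Rightarrow> 'a) \<Rightarrow> bool" where
  "simple_roots \<Phi> \<alpha> \<longleftrightarrow>
     inj \<alpha> \<and> range \<alpha> \<subseteq> \<Phi> \<and> independent (range \<alpha>) \<and>
     (\<forall>\<beta>\<in>\<Phi>. \<exists>k :: 'r \<Rightarrow> nat.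
        \<beta> = (\<Sum>i\<in>UNIV. real (k i) *\<^sub>R \<alpha> i) \<or> \<beta> = - (\<Sum>i\<in>UNIV. real (k i) *\<^sub>R \<alpha> i))"

definition positive_roots :: "'a::euclidean_space set \<Rightarrow> ('r::finite \<Rightarrow> 'a) \<Rightarrow> 'a set" where
  "positive_roots \<Phi> \<alpha> = {\<beta>\<in>\<Phi>. \<exists>k :: 'r \<Rightarrow> nat. \<beta> = (\<Sum>i\<in>UNIV. real (k i) *\<^sub>R \<alpha> i)}"

text \<open>The number of edges joining two distinct nodes of the Dynkin diagram.\<close>

definition dynkin_edges :: "('r \<Rightarrow> 'a::euclidean_space) \<Rightarrow> 'r \<Rightarrow> 'r \<Rightarrow> real" where
  "dynkin_edges \<alpha> i j =
     (2 * (\<alpha> i \<bullet> \<alpha> j) / (\<alpha> j \<bullet> \<alpha> j)) * (2 * (\<alpha> j \<bullet> \<alpha> i) / (\<alpha> i \<bullet> \<alpha> i))"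

definition adjacent :: "('r \<Rightarrow> 'a::euclidean_space) \<Rightarrow> 'r \<Rightarrow> 'r \<Rightarrow> bool" where
  "adjacent \<alpha> i j \<longleftrightarrow> i \<noteq> j \<and> dynkin_edges \<alpha> i j \<noteq> 0"

definition simply_laced :: "('r \<Rightarrow> 'a::euclidean_space) \<Rightarrow> bool" where
  "simply_laced \<alpha> \<longleftrightarrow> (\<forall>i j. adjacent \<alpha> i j \<longrightarrow> dynkin_edges \<alpha> i j = 1)"

inductive_set weyl_group :: "'a::euclidean_space set \<Rightarrow> ('a \<Rightarrow> 'a) set" for \<Phi> where
  id: "id \<in> weyl_group \<Phi>"
| step: "w \<in> weyl_group \<Phi> \<Longrightarrow> \<beta> \<in> \<Phi> \<Longrightarrow> w \<circ> root_refl \<beta> \<in> weyl_group \<Phi>"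

text \<open>An expression of \<open>w\<close> as a product of simple reflections; actions of the Weyl group given
  on the simple reflections are extended to \<open>w\<close> along it. Since the operators
  attached to the simple reflections below satisfy the relations of the Weyl group, the choice of
  the expression is immaterial.\<close>

definition word_of :: "('r \<Rightarrow> 'a::euclidean_space) \<Rightarrow> ('a \<Rightarrow> 'a) \<Rightarrow> 'r list" where
  "word_of \<alpha> w = (SOME is. w = foldr (\<lambda>i g. root_refl (\<alpha> i) \<circ> g) is id)"

text \<open>The integers \<open>k\<^sub>i\<close> with \<open>v = \<Sum>\<^sub>i k\<^sub>i \<alpha>\<^sub>i\<close>, for \<open>v\<close> in the root lattice.\<close>

definition root_coeffs :: "('r::finite \<Rightarrow> 'a::euclidean_space) \<Rightarrow> 'a \<Rightarrow> 'r \<Rightarrow> int" where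
  "root_coeffs \<alpha> v = (THE k. v = (\<Sum>i\<in>UNIV. of_int (k i) *\<^sub>R \<alpha> i))"

definition ht :: "('r::finite \<Rightarrow> 'a::euclidean_space) \<Rightarrow> 'a \<Rightarrow> int" where
  "ht \<alpha> v = (\<Sum>i\<in>UNIV. root_coeffs \<alpha> v i)"


section \<open>Rational functions in finitely many variables\<close>

text \<open>Polynomials are finitely supported maps from exponent vectors to coefficients. The variables
  are indexed by \<open>'r\<close>; a linear order on \<open>'r\<close> is needed only for the library's proof that these
  polynomials form an integral domain.\<close>

type_synonym 'r mpol = "('r \<Rightarrow>\<^sub>0 nat) \<Rightarrow>\<^sub>0 complex"
type_synonym 'r ratfun = "'r mpol fract"

definition rconst :: "complex \<Rightarrow> 'r::{finite,linorder} ratfun" where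
  "rconst c = to_fract (Poly_Mapping.single 0 c)"

definition Xvar :: "'r::{finite,linorder} \<Rightarrow> 'r ratfun" where
  "Xvar i = to_fract (Poly_Mapping.single (Poly_Mapping.single i 1) 1)"

definition poly_subst ::
  "('r \<Rightarrow> 'r ratfun) \<Rightarrow> 'r::{finite,linorder} mpol \<Rightarrow> 'r ratfun" where
  "poly_subst y p = (\<Sum>m\<in>Poly_Mapping.keys p.
     rconst (Poly_Mapping.lookup p m) * (\<Prod>i\<in>UNIV. y i ^ Poly_Mapping.lookup m i))"

text \<open>\<open>rat_subst y f\<close> is \<open>f(y)\<close>, for \<open>f\<close> having a representation as a fraction whose denominator
  does not vanish at \<open>y\<close>.\<close>

definition rat_subst ::
  "('r \<Rightarrow> 'r ratfun) \<Rightarrow> 'r::{finite,linorder} ratfun \<Rightarrow> 'r ratfun" where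
  "rat_subst y f = (THE g. \<exists>a b. b \<noteq> 0 \<and> f = Fract a b \<and> poly_subst y b \<noteq> 0 \<and>
     g = poly_subst y a / poly_subst y b)"

definition is_polynomial :: "'r::{finite,linorder} ratfun \<Rightarrow> bool" where
  "is_polynomial f \<longleftrightarrow> f \<in> range to_fract"


section \<open>The Weyl group actions\<close>

definition sqrtq :: "nat \<Rightarrow> 'r::{finite,linorder} ratfun" where
  "sqrtq q = rconst (complex_of_real (sqrt (real q)))"

definition sigma_tuple ::
  "('r \<Rightarrow> 'a::euclidean_space) \<Rightarrow> nat \<Rightarrow> 'r::{finite,linorder} \<Rightarrow>
   ('r \<Rightarrow> 'r ratfun) \<Rightarrow> ('r \<Rightarrow> 'r ratfun)" where
  "sigma_tuple \<alpha> q i y = (\<lambda>j.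
     if adjacent \<alpha> i j then y i * y j * sqrtq q
     else if j = i then 1 / (of_nat q * y j)
     else y j)"

definition eps_tuple ::
  "('r \<Rightarrow> 'a::euclidean_space) \<Rightarrow> 'r::{finite,linorder} \<Rightarrow>
   ('r \<Rightarrow> 'r ratfun) \<Rightarrow> ('r \<Rightarrow> 'r ratfun)" where
  "eps_tuple \<alpha> i y = (\<lambda>j. if adjacent \<alpha> i j then - y j else y j)"

text \<open>The left action \<open>w \<mapsto> wy\<close>: a product \<open>\<sigma>\<^sub>i \<sigma>\<^sub>j\<close> sends \<open>y\<close> to \<open>\<sigma>\<^sub>i (\<sigma>\<^sub>j y)\<close>.\<close>

definition weyl_tuple ::
  "('r \<Rightarrow> 'a::euclidean_space) \<Rightarrow> nat \<Rightarrow> ('a \<Rightarrow> 'a) \<Rightarrow>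
   ('r::{finite,linorder} \<Rightarrow> 'r ratfun) \<Rightarrow> ('r \<Rightarrow> 'r ratfun)" where
  "weyl_tuple \<alpha> q w y = foldr (sigma_tuple \<alpha> q) (word_of \<alpha> w) y"

definition f_plus ::
  "('r \<Rightarrow> 'a::euclidean_space) \<Rightarrow> ('r \<Rightarrow> nat) \<Rightarrow> 'r \<Rightarrow>
   'r::{finite,linorder} ratfun \<Rightarrow> 'r ratfun" where
  "f_plus \<alpha> l i f = (f + (- 1) ^ l i * rat_subst (eps_tuple \<alpha> i Xvar) f) / 2"

definition f_minus ::
  "('r \<Rightarrow> 'a::euclidean_space) \<Rightarrow> ('r \<Rightarrow> nat) \<Rightarrow> 'r \<Rightarrow>
   'r::{finite,linorder} ratfun \<Rightarrow> 'r ratfun" where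
  "f_minus \<alpha> l i f = (f - (- 1) ^ l i * rat_subst (eps_tuple \<alpha> i Xvar) f) / 2"

definition slash_simple ::
  "('r \<Rightarrow> 'a::euclidean_space) \<Rightarrow> nat \<Rightarrow> ('r \<Rightarrow> nat) \<Rightarrow> 'r \<Rightarrow>
   'r::{finite,linorder} ratfun \<Rightarrow> 'r ratfun" where
  "slash_simple \<alpha> q l i f =
     - ((1 - of_nat q * Xvar i) / (of_nat q * Xvar i * (1 - Xvar i))) * (Xvar i * sqrtq q) ^ l i
         * rat_subst (sigma_tuple \<alpha> q i Xvar) (f_plus \<alpha> l i f)
     + 1 / (Xvar i * sqrtq q) * (Xvar i * sqrtq q) ^ l i
         * rat_subst (sigma_tuple \<alpha> q i Xvar) (f_minus \<alpha> l i f)"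

text \<open>The right action: the leftmost factor of the product is applied first.\<close>

definition slash ::
  "('r \<Rightarrow> 'a::euclidean_space) \<Rightarrow> nat \<Rightarrow> ('r \<Rightarrow> nat) \<Rightarrow> ('a \<Rightarrow> 'a) \<Rightarrow>
   'r::{finite,linorder} ratfun \<Rightarrow> 'r ratfun" where
  "slash \<alpha> q l w f = fold (slash_simple \<alpha> q l) (word_of \<alpha> w) f"


section \<open>The invariant function and its numerator\<close>

definition xpow ::
  "('r \<Rightarrow> 'a::euclidean_space) \<Rightarrow> ('r \<Rightarrow> 'r ratfun) \<Rightarrow> 'a \<Rightarrow>
   'r::{finite,linorder} ratfun" where
  "xpow \<alpha> y v = (\<Prod>i\<in>UNIV. y i powi root_coeffs \<alpha> v i)"

definition Delta ::
  "'a::euclidean_space set \<Rightarrow> ('r \<Rightarrow> 'a) \<Rightarrow> nat \<Rightarrow> ('r \<Rightarrow> 'r ratfun) \<Rightarrow>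
   'r::{finite,linorder} ratfun" where
  "Delta \<Phi> \<alpha> q y =
     (\<Prod>\<beta>\<in>positive_roots \<Phi> \<alpha>. 1 - of_nat q powi ht \<alpha> \<beta> * xpow \<alpha> y (2 *\<^sub>R \<beta>))"

definition cocycle_j ::
  "'a::euclidean_space set \<Rightarrow> ('r \<Rightarrow> 'a) \<Rightarrow> nat \<Rightarrow> ('a \<Rightarrow> 'a) \<Rightarrow>
   'r::{finite,linorder} ratfun" where
  "cocycle_j \<Phi> \<alpha> q w = Delta \<Phi> \<alpha> q Xvar / Delta \<Phi> \<alpha> q (weyl_tuple \<alpha> q w Xvar)"

definition f_inv ::
  "'a::euclidean_space set \<Rightarrow> ('r \<Rightarrow> 'a) \<Rightarrow> nat \<Rightarrow> ('r \<Rightarrow> nat) \<Rightarrow>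
   'r::{finite,linorder} ratfun" where
  "f_inv \<Phi> \<alpha> q l =
     inverse (Delta \<Phi> \<alpha> q Xvar) *
       (\<Sum>w\<in>weyl_group \<Phi>. cocycle_j \<Phi> \<alpha> q w * slash \<alpha> q l w 1)"

definition D_poly ::
  "'a::euclidean_space set \<Rightarrow> ('r \<Rightarrow> 'a) \<Rightarrow> nat \<Rightarrow> 'r::{finite,linorder} ratfun" where
  "D_poly \<Phi> \<alpha> q =
     (\<Prod>\<beta>\<in>positive_roots \<Phi> \<alpha>. 1 - of_nat q powi (ht \<alpha> \<beta> - 1) * xpow \<alpha> Xvar (2 *\<^sub>R \<beta>))"

definition N_fun ::
  "'a::euclidean_space set \<Rightarrow> ('r \<Rightarrow> 'a) \<Rightarrow> nat \<Rightarrow> ('r \<Rightarrow> nat) \<Rightarrow>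
   'r::{finite,linorder} ratfun" where
  "N_fun \<Phi> \<alpha> q l = D_poly \<Phi> \<alpha> q * f_inv \<Phi> \<alpha> q l"

end

theory Submission
  imports Defs
begin

text \<open>With \<open>y\<^sub>i = x\<^sub>i \<surd>q\<close> and \<open>y\<^sup>v = \<Prod>\<^sub>i y\<^sub>i\<^bsup>k\<^sub>i\<^esup>\<close> for \<open>v = \<Sum>\<^sub>i k\<^sub>i \<alpha>\<^sub>i\<close>, the reflection \<open>\<sigma>\<^sub>i\<close> acts by \<open>y\<^sup>v \<mapsto> y\<^bsup>s\<^sub>i v\<^esup>\<close>, and
  \<open>\<Delta> = \<Prod>\<^sub>\<beta> (1 - y\<^bsup>2\<beta>\<^esup>)\<close>, while \<open>D\<close> is a constant multiple of \<open>\<Prod>\<^sub>\<beta> (q - y\<^bsup>2\<beta>\<^esup>)\<close>. Conjugating the slash operator of \<open>\<sigma>\<^sub>i\<close>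
  by \<open>\<Delta>\<close> gives an operator \<open>T\<^sub>i\<close> that absorbs the cocycle \<open>j\<close>, so that \<open>\<Delta> f\<close> is the sum \<open>G\<close> over the Weyl
  group of the functions \<open>T\<^sub>w 1\<close>. The polynomiality of \<open>N = D G / \<Delta>\<close> rests on two facts.

  First, \<open>D G\<close> is a polynomial (\<open>G_Dn_in_Pol\<close>). The operator \<open>T\<^sub>i\<close> introduces the denominator \<open>q - y\<^sub>i\<^sup>2\<close> but no
  negative power of a variable. Along a reduced word the roots made negative stay positive under the
  reflections that are still to come, so only denominators of \<open>D\<close> occur, each once, and the
  numerators are polynomials in monomials \<open>y\<^sup>\<beta>\<close> with \<open>\<beta>\<close> positive (\<open>fold_T_reduced\<close>).

  Second, \<open>D G\<close> is divisible by \<open>\<Delta>\<close>. The sum \<open>G\<close> is invariant under every \<open>T\<^sub>i\<close> (\<open>T_G\<close>). Where \<open>y\<^sub>i = \<plusminus>1\<close>, the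
  reflection \<open>\<sigma>\<^sub>i\<close> degenerates to the identity or to the sign change \<open>\<epsilon>\<^sub>i\<close>, and invariance says that \<open>G\<close>
  equals its own negative (\<open>wall_invariant\<close>); hence \<open>G\<close> is a multiple of \<open>y\<^sub>i\<^sup>2 - 1\<close> in the ring \<open>Loc\<close> of
  fractions with denominators like those of \<open>D\<close>. As \<open>T\<^sub>j\<close> carries multiples
  of \<open>y\<^bsup>2\<beta>\<^esup> - 1\<close> to multiples of \<open>y\<^bsup>2 s\<^sub>j \<beta>\<^esup> - 1\<close>, the same holds for every positive root (\<open>G_divisible\<close>). These
  factors are pairwise coprime, which gives a Laurent polynomial quotient (\<open>G_Dn_factor\<close>), and \<open>\<Delta>\<close> is
  divisible by no variable, so the quotient has no negative powers (\<open>Laurent_polynomial_times_Del\<close>).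

  Invariance of \<open>G\<close> presupposes that \<open>T\<^sub>w\<close> does not depend on the word chosen for \<open>w\<close>. This needs the
  Coxeter relations for the operators \<open>T\<^sub>i\<close>, of which the braid relation (\<open>T_braid\<close>) comes down to identities
  of rational functions in two variables, and Matsumoto's theorem on reduced words (\<open>words_agree\<close>).\<close>

section \<open>Substitution in rational functions\<close>

lemma rconst_0 [simp]: "rconst 0 = 0"
  and rconst_1 [simp]: "rconst 1 = 1"
  and rconst_add: "rconst (a + b) = rconst a + rconst b"
  and rconst_mult: "rconst (a * b) = rconst a * rconst b"
  and rconst_minus: "rconst (- a) = - rconst a"
  by (simp_all add: rconst_def single_add single_uminus mult_single
      flip: to_fract_add to_fract_mult to_fract_uminus)

lemma rconst_eq_iff [simp]: "rconst a = rconst b \<longleftrightarrow> a = b"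
  by (auto simp: rconst_def dest: injD[OF inj_single])

lemma rconst_power: "rconst (a ^ n) = rconst a ^ n"
  by (induction n) (simp_all add: rconst_mult)

lemma rconst_of_nat: "rconst (of_nat n) = of_nat n"
  by (induction n) (simp_all add: rconst_add)

lemma rconst_numeral: "rconst (numeral n) = numeral n"
  using rconst_of_nat[of "numeral n"] by simp

lemma rconst_inverse: "rconst (inverse a) = inverse (rconst a)"
proof (cases "a = 0")
  case False
  hence "rconst a * rconst (inverse a) = 1"
    by (simp flip: rconst_mult)
  thus ?thesis
    by (metis inverse_unique)
qed simp

lemma rconst_powi: "rconst (a powi n) = rconst a powi n"
  by (simp add: power_int_def rconst_power rconst_inverse)

lemma two_ne_0_ratfun [simp]: "(2 :: 'r::{finite,linorder} ratfun) \<noteq> 0"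
proof -
  have "rconst (2 :: complex) \<noteq> (rconst 0 :: 'r ratfun)"
    unfolding rconst_eq_iff by simp
  thus ?thesis by (simp add: rconst_numeral)
qed

lemma mpol_induct [case_names single add]:
  fixes p :: "'r mpol"
  assumes single: "\<And>m c. P (Poly_Mapping.single m c)"
    and add: "\<And>p q. P p \<Longrightarrow> P q \<Longrightarrow> P (p + q)"
  shows "P p"
proof -
  have eq: "(\<Sum>m\<in>Poly_Mapping.keys p. Poly_Mapping.single m (Poly_Mapping.lookup p m)) = p"
    by (rule poly_mapping_eqI)
      (auto simp: lookup_sum lookup_single when_def in_keys_iff sum.delta')
  have "P (\<Sum>m\<in>A. Poly_Mapping.single m (Poly_Mapping.lookup p m))" if "finite A" for A
    using that
  proof (induction A rule: finite_induct)
    case empty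
    show ?case using single[of 0 0] by simp
  qed (auto intro: add single)
  from this[of "Poly_Mapping.keys p"] show ?thesis by (simp add: eq)
qed

lemma poly_subst_superset:
  assumes "finite A" "Poly_Mapping.keys p \<subseteq> A"
  shows "poly_subst y p = (\<Sum>m\<in>A.
     rconst (Poly_Mapping.lookup p m) * (\<Prod>i\<in>UNIV. y i ^ Poly_Mapping.lookup m i))"
  unfolding poly_subst_def using assms
  by (intro sum.mono_neutral_left) (auto simp: in_keys_iff)

lemma poly_subst_single:
  "poly_subst y (Poly_Mapping.single m c) = rconst c * (\<Prod>i\<in>UNIV. y i ^ Poly_Mapping.lookup m i)"
  by (subst poly_subst_superset[of "{m}"]) auto

lemma poly_subst_add: "poly_subst y (p + q) = poly_subst y p + poly_subst y q"
proof -
  let ?A = "Poly_Mapping.keys p \<union> Poly_Mapping.keys q"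
  have "Poly_Mapping.keys (p + q) \<subseteq> ?A" by (rule keys_add)
  thus ?thesis
    by (simp add: poly_subst_superset[of ?A] lookup_add rconst_add distrib_right sum.distrib)
qed

lemma poly_subst_mult: "poly_subst y (p * q) = poly_subst y p * poly_subst y q"
proof (induction p rule: mpol_induct)
  case (single m c)
  show ?case
  proof (induction q rule: mpol_induct)
    case (single m' c')
    show ?case
      by (simp add: mult_single poly_subst_single rconst_mult lookup_add power_add prod.distrib)
  qed (simp add: distrib_left poly_subst_add)
qed (simp add: distrib_right poly_subst_add)

lemma poly_subst_const: "poly_subst y (Poly_Mapping.single 0 c) = rconst c"
  by (simp add: poly_subst_single)

lemma poly_subst_1 [simp]: "poly_subst y 1 = 1"
  using poly_subst_const[of y 1] by simp

lemma poly_subst_Var: "poly_subst y (Poly_Mapping.single (Poly_Mapping.single i 1) 1) = y i"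
proof -
  have "(\<Prod>j\<in>UNIV. y j ^ Poly_Mapping.lookup (Poly_Mapping.single i 1) j)
      = (\<Prod>j\<in>UNIV. if j = i then y j else 1)"
    by (intro prod.cong) (auto simp: lookup_single when_def)
  thus ?thesis by (simp add: poly_subst_single)
qed

text \<open>The induction rule by which a ring homomorphism is determined by its values on constants and
  variables.\<close>

lemma mpol_ring_induct [case_names const var add mult]:
  fixes p :: "'r::{finite,linorder} mpol"
  assumes const: "\<And>c. P (Poly_Mapping.single 0 c)"
    and var: "\<And>i. P (Poly_Mapping.single (Poly_Mapping.single i 1) 1)"
    and add: "\<And>p q. P p \<Longrightarrow> P q \<Longrightarrow> P (p + q)"
    and mult: "\<And>p q. P p \<Longrightarrow> P q \<Longrightarrow> P (p * q)"
  shows "P p"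
proof (induction p rule: mpol_induct)
  case (single m c)
  have pow: "P (Poly_Mapping.single (Poly_Mapping.single i n) 1)" for i n
  proof (induction n)
    case 0
    show ?case using const[of 1] by simp
  next
    case (Suc n)
    have "Poly_Mapping.single (Poly_Mapping.single i (Suc n)) (1::complex) =
      Poly_Mapping.single (Poly_Mapping.single i 1) 1 * Poly_Mapping.single (Poly_Mapping.single i n) 1"
      by (simp add: mult_single flip: single_add)
    thus ?case using mult[OF var Suc] by simp
  qed
  have "P (Poly_Mapping.single (\<Sum>i\<in>A. Poly_Mapping.single i (Poly_Mapping.lookup m i)) c)"
    if "finite A" for A
    using that
  proof (induction A rule: finite_induct)
    case empty
    show ?case using const by simp
  next
    case (insert i A)
    show ?case
      using mult[OF pow[of i "Poly_Mapping.lookup m i"] insert.IH] insert.hyps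
      by (simp add: mult_single)
  qed
  moreover have "(\<Sum>i\<in>UNIV. Poly_Mapping.single i (Poly_Mapping.lookup m i)) = m"
    by (rule poly_mapping_eqI) (auto simp: lookup_sum lookup_single when_def sum.delta')
  ultimately show ?case
    by (metis finite)
qed (rule add)

lemma poly_subst_Xvar: "poly_subst Xvar p = to_fract p"
  by (induction p rule: mpol_ring_induct)
    (simp_all add: poly_subst_const poly_subst_Var poly_subst_add poly_subst_mult rconst_def Xvar_def
      del: One_nat_def)

text \<open>The fractions at which \<^term>\<open>rat_subst z\<close> is given by its defining property: the local ring
  of the point \<open>z\<close>.\<close>

definition regular_at :: "('r \<Rightarrow> 'r ratfun) \<Rightarrow> 'r::{finite,linorder} ratfun \<Rightarrow> bool" where
  "regular_at z f \<longleftrightarrow> (\<exists>a b. f = to_fract a / to_fract b \<and> poly_subst z b \<noteq> 0)"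

lemma poly_subst_0 [simp]: "poly_subst z 0 = 0"
  by (simp add: poly_subst_def)

lemma rat_subst_eq:
  assumes "f = to_fract a / to_fract b" "poly_subst z b \<noteq> 0"
  shows "rat_subst z f = poly_subst z a / poly_subst z b"
  unfolding rat_subst_def
proof (rule the_equality)
  show "\<exists>a' b'. b' \<noteq> 0 \<and> f = Fract a' b' \<and> poly_subst z b' \<noteq> 0 \<and>
     poly_subst z a / poly_subst z b = poly_subst z a' / poly_subst z b'"
    using assms by (intro exI[of _ a] exI[of _ b]) (auto simp: Fract_conv_to_fract)
next
  fix g assume "\<exists>a' b'. b' \<noteq> 0 \<and> f = Fract a' b' \<and> poly_subst z b' \<noteq> 0 \<and>
     g = poly_subst z a' / poly_subst z b'"
  then obtain a' b' where *: "b' \<noteq> 0" "f = to_fract a' / to_fract b'" "poly_subst z b' \<noteq> 0"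
    "g = poly_subst z a' / poly_subst z b'"
    by (auto simp: Fract_conv_to_fract)
  have "b \<noteq> 0" using assms(2) by auto
  hence "to_fract (a * b') = to_fract (a' * b)"
    using assms(1) * by (simp add: field_simps)
  hence "a * b' = a' * b"
    by (simp only: to_fract_eq_iff)
  hence "poly_subst z a * poly_subst z b' = poly_subst z a' * poly_subst z b"
    by (metis poly_subst_mult)
  thus "g = poly_subst z a / poly_subst z b"
    using assms(2) *(3) unfolding *(4) by (simp add: frac_eq_eq)
qed

lemma
  shows regular_at_to_fract: "regular_at z (to_fract p)"
    and rat_subst_to_fract: "rat_subst z (to_fract p) = poly_subst z p"
proof -
  have 1: "to_fract p = to_fract p / to_fract 1" "poly_subst z 1 \<noteq> 0"
    by simp_all
  thus "regular_at z (to_fract p)"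
    unfolding regular_at_def by blast
  show "rat_subst z (to_fract p) = poly_subst z p"
    using rat_subst_eq[OF 1] by simp
qed

lemma
  assumes "regular_at z f" "regular_at z g"
  shows regular_at_add: "regular_at z (f + g)"
    and rat_subst_add: "rat_subst z (f + g) = rat_subst z f + rat_subst z g"
    and regular_at_mult: "regular_at z (f * g)"
    and rat_subst_mult: "rat_subst z (f * g) = rat_subst z f * rat_subst z g"
proof -
  obtain a b where f: "f = to_fract a / to_fract b" "poly_subst z b \<noteq> 0"
    using assms(1) by (auto simp: regular_at_def)
  obtain c d where g: "g = to_fract c / to_fract d" "poly_subst z d \<noteq> 0"
    using assms(2) by (auto simp: regular_at_def)
  have nz: "b \<noteq> 0" "d \<noteq> 0" using f g by auto
  have bd: "poly_subst z (b * d) \<noteq> 0" using f g by (simp add: poly_subst_mult)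
  have s: "f + g = to_fract (a * d + c * b) / to_fract (b * d)"
    and p: "f * g = to_fract (a * c) / to_fract (b * d)"
    using f g nz by (simp_all add: field_simps)
  show "regular_at z (f + g)" "regular_at z (f * g)"
    using s p bd unfolding regular_at_def by blast+
  show "rat_subst z (f + g) = rat_subst z f + rat_subst z g"
    unfolding rat_subst_eq[OF s bd] rat_subst_eq[OF f] rat_subst_eq[OF g]
    using f g by (simp add: poly_subst_add poly_subst_mult field_simps)
  show "rat_subst z (f * g) = rat_subst z f * rat_subst z g"
    unfolding rat_subst_eq[OF p bd] rat_subst_eq[OF f] rat_subst_eq[OF g]
    using f g by (simp add: poly_subst_mult field_simps)
qed

lemma
  assumes "regular_at z f" "rat_subst z f \<noteq> 0"
  shows regular_at_inverse: "regular_at z (inverse f)"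
    and rat_subst_inverse: "rat_subst z (inverse f) = inverse (rat_subst z f)"
proof -
  obtain a b where f: "f = to_fract a / to_fract b" "poly_subst z b \<noteq> 0"
    using assms(1) by (auto simp: regular_at_def)
  have a: "poly_subst z a \<noteq> 0" using assms(2) rat_subst_eq[OF f] by auto
  have i: "inverse f = to_fract b / to_fract a" using f by simp
  show "regular_at z (inverse f)" using i a by (auto simp: regular_at_def)
  show "rat_subst z (inverse f) = inverse (rat_subst z f)"
    unfolding rat_subst_eq[OF i a] rat_subst_eq[OF f] by simp
qed

lemma
  shows regular_at_rconst [simp]: "regular_at z (rconst c)"
    and rat_subst_rconst [simp]: "rat_subst z (rconst c) = rconst c"
    and regular_at_Xvar [simp]: "regular_at z (Xvar i)"
    and rat_subst_Xvar [simp]: "rat_subst z (Xvar i) = z i"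
  unfolding rconst_def Xvar_def
  by (simp_all only: regular_at_to_fract rat_subst_to_fract poly_subst_const poly_subst_Var)
    (simp add: rconst_def)

lemma
  assumes "regular_at z f"
  shows regular_at_power: "regular_at z (f ^ n)"
    and rat_subst_power: "rat_subst z (f ^ n) = rat_subst z f ^ n"
proof -
  have "regular_at z (f ^ n) \<and> rat_subst z (f ^ n) = rat_subst z f ^ n"
  proof (induction n)
    case 0
    show ?case using regular_at_rconst[of z 1] rat_subst_rconst[of z 1] by simp
  qed (auto simp: regular_at_mult rat_subst_mult assms)
  thus "regular_at z (f ^ n)" "rat_subst z (f ^ n) = rat_subst z f ^ n" by auto
qed

lemma
  assumes "regular_at z f" "rat_subst z f \<noteq> 0"
  shows regular_at_powi: "regular_at z (f powi n)"
    and rat_subst_powi: "rat_subst z (f powi n) = rat_subst z f powi n"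
  using assms
  by (simp_all add: power_int_def regular_at_power rat_subst_power regular_at_inverse rat_subst_inverse)

lemma
  assumes "\<And>a. a \<in> B \<Longrightarrow> regular_at z (u a)"
  shows regular_at_prod: "regular_at z (prod u B)"
    and rat_subst_prod: "rat_subst z (prod u B) = (\<Prod>a\<in>B. rat_subst z (u a))"
proof -
  have 1: "regular_at z 1 \<and> rat_subst z 1 = 1"
    using regular_at_rconst[of z 1] rat_subst_rconst[of z 1] by simp
  have "regular_at z (prod u B) \<and> rat_subst z (prod u B) = (\<Prod>a\<in>B. rat_subst z (u a))"
    using assms
    by (induction B rule: infinite_finite_induct) (auto simp: 1 regular_at_mult rat_subst_mult)
  thus "regular_at z (prod u B)" "rat_subst z (prod u B) = (\<Prod>a\<in>B. rat_subst z (u a))" by auto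
qed

lemma
  assumes "regular_at z f" "regular_at z g"
  shows regular_at_diff: "regular_at z (f - g)"
    and rat_subst_diff: "rat_subst z (f - g) = rat_subst z f - rat_subst z g"
proof -
  have g: "regular_at z (rconst (- 1) * g)" using assms(2) by (intro regular_at_mult) simp_all
  have m: "rat_subst z (rconst (- 1) * g) = - rat_subst z g"
  proof -
    have "rat_subst z (rconst (- 1) * g) = rconst (- 1) * rat_subst z g"
      using assms(2) by (subst rat_subst_mult) simp_all
    thus ?thesis by (simp add: rconst_minus)
  qed
  have eq: "f - g = f + rconst (- 1) * g" by (simp add: rconst_minus)
  show "regular_at z (f - g)" "rat_subst z (f - g) = rat_subst z f - rat_subst z g"
    unfolding eq using regular_at_add[OF assms(1) g] rat_subst_add[OF assms(1) g] m
    by (simp_all only: diff_conv_add_uminus)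
qed

definition field_endo :: "('r::{finite,linorder} ratfun \<Rightarrow> 'r ratfun) \<Rightarrow> bool" where
  "field_endo h \<longleftrightarrow> (\<forall>f g. h (f + g) = h f + h g) \<and> (\<forall>f g. h (f * g) = h f * h g) \<and>
     (\<forall>c. h (rconst c) = rconst c)"

context
  fixes h :: "'r::{finite,linorder} ratfun \<Rightarrow> 'r ratfun"
  assumes h: "field_endo h"
begin

lemma endo_add: "h (f + g) = h f + h g"
  and endo_mult: "h (f * g) = h f * h g"
  and endo_rconst: "h (rconst c) = rconst c"
  using h by (auto simp: field_endo_def)

lemma endo_0: "h 0 = 0" and endo_1: "h 1 = 1"
  using endo_rconst[of 0] endo_rconst[of 1] by simp_all

lemma endo_minus: "h (- f) = - h f"
  using endo_add[of f "- f"] by (simp add: endo_0 eq_neg_iff_add_eq_0 add.commute)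

lemma endo_diff: "h (f - g) = h f - h g"
  using endo_add[of f "- g"] by (simp add: endo_minus)

lemma endo_inverse: "h (inverse f) = inverse (h f)"
proof (cases "f = 0")
  case False
  hence "h f * h (inverse f) = 1" by (simp add: endo_1 flip: endo_mult)
  thus ?thesis by (metis inverse_unique)
qed (simp add: endo_0)

lemma endo_divide: "h (f / g) = h f / h g"
  by (simp add: divide_inverse endo_mult endo_inverse)

lemma endo_eq_0_iff: "h f = 0 \<longleftrightarrow> f = 0"
proof
  assume "h f = 0"
  show "f = 0"
  proof (rule ccontr)
    assume "f \<noteq> 0"
    hence "h f * h (inverse f) = 1" by (simp add: endo_1 flip: endo_mult)
    with \<open>h f = 0\<close> show False by simp
  qed
qed (simp add: endo_0)

lemma endo_power: "h (f ^ n) = h f ^ n"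
  by (induction n) (simp_all add: endo_1 endo_mult)

lemma endo_powi: "h (f powi n) = h f powi n"
  by (simp add: power_int_def endo_power endo_inverse)

lemma endo_of_nat: "h (of_nat n) = of_nat n"
  by (induction n) (simp_all add: endo_0 endo_1 endo_add)

lemma endo_numeral: "h (numeral n) = numeral n"
  using endo_of_nat[of "numeral n"] by simp

lemma endo_sum: "h (sum u A) = (\<Sum>a\<in>A. h (u a))"
  by (induction A rule: infinite_finite_induct) (simp_all add: endo_0 endo_add)

lemma endo_prod: "h (prod u A) = (\<Prod>a\<in>A. h (u a))"
  by (induction A rule: infinite_finite_induct) (simp_all add: endo_1 endo_mult)

lemma endo_to_fract: "h (to_fract p) = poly_subst (\<lambda>i. h (Xvar i)) p"
  by (induction p rule: mpol_ring_induct)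
    (simp_all add: endo_add endo_mult poly_subst_add poly_subst_mult poly_subst_const poly_subst_Var
      endo_rconst flip: rconst_def Xvar_def del: One_nat_def)

end

lemmas endo_simps = endo_add endo_mult endo_rconst endo_0 endo_1 endo_minus endo_diff endo_inverse
  endo_divide endo_power endo_powi endo_of_nat endo_numeral endo_sum endo_prod

lemma field_endo_comp: "field_endo g \<Longrightarrow> field_endo h \<Longrightarrow> field_endo (\<lambda>f. g (h f))"
  by (simp add: field_endo_def)

lemma field_endo_id: "field_endo (\<lambda>f. f)"
  by (simp add: field_endo_def)

lemma ratfun_cases:
  fixes f :: "'r::{finite,linorder} ratfun"
  obtains a b where "f = to_fract a / to_fract b" "b \<noteq> 0"
  by (cases f) (auto simp: Fract_conv_to_fract)

lemma field_endo_eqI: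
  assumes "field_endo g" "field_endo h" "\<And>i. g (Xvar i) = h (Xvar i)"
  shows "g f = h f"
  by (cases f rule: ratfun_cases) (simp add: endo_divide assms endo_to_fract)

text \<open>Substitution of a tuple is an endomorphism as soon as no polynomial vanishes on the tuple.
  For an invertible substitution this is automatic: substituting back recovers the polynomial,
  and for that it is enough that the entries of the tuple stay regular.\<close>

lemma field_endo_rat_substI:
  assumes "\<And>p. p \<noteq> 0 \<Longrightarrow> poly_subst z p \<noteq> 0"
  shows "field_endo (rat_subst z)"
proof -
  have "regular_at z f" for f
    by (cases f rule: ratfun_cases) (use assms in \<open>auto simp: regular_at_def\<close>)
  thus ?thesis by (simp add: field_endo_def rat_subst_add rat_subst_mult)
qed

lemma regular_at_poly_subst:
  assumes "\<And>i. regular_at z (y i)"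
  shows "regular_at z (poly_subst y p) \<and>
    rat_subst z (poly_subst y p) = poly_subst (\<lambda>i. rat_subst z (y i)) p"
  by (induction p rule: mpol_ring_induct)
    (auto simp: assms poly_subst_const poly_subst_Var poly_subst_add poly_subst_mult
      regular_at_add regular_at_mult rat_subst_add rat_subst_mult simp del: One_nat_def)

lemma field_endo_rat_subst_invertible:
  assumes "\<And>i. regular_at z' (z i)" "\<And>i. rat_subst z' (z i) = Xvar i"
  shows "field_endo (rat_subst z)"
proof (rule field_endo_rat_substI)
  fix p :: "'a mpol" assume "p \<noteq> 0"
  have "rat_subst z' (poly_subst z p) = to_fract p"
    using regular_at_poly_subst[of z' z p] assms by (simp add: poly_subst_Xvar)
  thus "poly_subst z p \<noteq> 0"
    using \<open>p \<noteq> 0\<close> rat_subst_rconst[of z' 0] by auto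
qed

section \<open>Polynomials among the rational functions\<close>

definition Pol :: "'r::{finite,linorder} ratfun set" where
  "Pol = range to_fract"

lemma Pol_to_fract [simp]: "to_fract p \<in> Pol"
  by (simp add: Pol_def)

lemma Pol_induct [consumes 1, case_names const var add mult]:
  assumes "f \<in> Pol"
    and "\<And>c. P (rconst c)" "\<And>i. P (Xvar i)"
    and "\<And>f g. f \<in> Pol \<Longrightarrow> P f \<Longrightarrow> g \<in> Pol \<Longrightarrow> P g \<Longrightarrow> P (f + g)"
    and "\<And>f g. f \<in> Pol \<Longrightarrow> P f \<Longrightarrow> g \<in> Pol \<Longrightarrow> P g \<Longrightarrow> P (f * g)"
  shows "P f"
proof -
  have "P (to_fract p)" for p
    by (induction p rule: mpol_ring_induct)
      (use assms(2-) in \<open>auto simp: rconst_def Xvar_def\<close>)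
  thus ?thesis using assms(1) by (auto simp: Pol_def)
qed

lemma Pol_add: "f \<in> Pol \<Longrightarrow> g \<in> Pol \<Longrightarrow> f + g \<in> Pol"
  and Pol_mult: "f \<in> Pol \<Longrightarrow> g \<in> Pol \<Longrightarrow> f * g \<in> Pol"
  by (auto simp: Pol_def simp flip: to_fract_add to_fract_mult)

lemma Pol_rconst [simp]: "rconst c \<in> Pol" and Pol_Xvar [simp]: "Xvar i \<in> Pol"
  by (auto simp: Pol_def rconst_def Xvar_def)

lemma Pol_power: "f \<in> Pol \<Longrightarrow> f ^ n \<in> Pol"
  by (induction n) (use Pol_rconst[of 1] in \<open>auto intro: Pol_mult\<close>)

lemma Pol_prod: "(\<And>a. a \<in> A \<Longrightarrow> u a \<in> Pol) \<Longrightarrow> prod u A \<in> Pol"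
  by (induction A rule: infinite_finite_induct) (use Pol_rconst[of 1] in \<open>auto intro: Pol_mult\<close>)

lemma Pol_diff: "f \<in> Pol \<Longrightarrow> g \<in> Pol \<Longrightarrow> f - g \<in> Pol"
  by (auto simp: Pol_def simp flip: to_fract_diff)

lemma Pol_sum: "(\<And>a. a \<in> A \<Longrightarrow> u a \<in> Pol) \<Longrightarrow> sum u A \<in> Pol"
  by (induction A rule: infinite_finite_induct) (use Pol_rconst[of 0] in \<open>auto intro: Pol_add\<close>)

lemma regular_at_Pol: "f \<in> Pol \<Longrightarrow> regular_at z f"
  by (auto simp: Pol_def regular_at_to_fract)

text \<open>The subalgebra over the constants generated by \<open>A\<close>. Polynomials, Laurent polynomials and their
  localisations are all of this form, which reduces closure properties to generators.\<close>

inductive_set alg :: "'r::{finite,linorder} ratfun set \<Rightarrow> 'r ratfun set" for A where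
  const: "rconst c \<in> alg A"
| gen: "f \<in> A \<Longrightarrow> f \<in> alg A"
| add: "f \<in> alg A \<Longrightarrow> g \<in> alg A \<Longrightarrow> f + g \<in> alg A"
| mult: "f \<in> alg A \<Longrightarrow> g \<in> alg A \<Longrightarrow> f * g \<in> alg A"

lemma alg_0 [simp]: "0 \<in> alg A" and alg_1 [simp]: "1 \<in> alg A"
  using alg.const[of 0] alg.const[of 1] by simp_all

lemma alg_minus: "f \<in> alg A \<Longrightarrow> - f \<in> alg A"
  using alg.mult[OF alg.const[of "- 1" A], of f] by (simp add: rconst_minus)

lemma alg_diff: "f \<in> alg A \<Longrightarrow> g \<in> alg A \<Longrightarrow> f - g \<in> alg A"
  using alg.add[of f A "- g"] alg_minus[of g A] by simp

lemma alg_power: "f \<in> alg A \<Longrightarrow> f ^ n \<in> alg A"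
  by (induction n) (auto intro: alg.mult)

lemma alg_prod: "(\<And>a. a \<in> B \<Longrightarrow> u a \<in> alg A) \<Longrightarrow> prod u B \<in> alg A"
  by (induction B rule: infinite_finite_induct) (auto intro: alg.mult)

lemma alg_half: "f \<in> alg A \<Longrightarrow> f / 2 \<in> alg A"
proof -
  assume "f \<in> alg A"
  hence "f * rconst (inverse 2) \<in> alg A" by (intro alg.mult alg.const)
  thus ?thesis by (simp only: rconst_inverse rconst_numeral divide_inverse)
qed

lemma alg_powi:
  assumes "f \<in> alg A" "inverse f \<in> alg A"
  shows "f powi n \<in> alg A"
  using assms by (auto simp: power_int_def alg_power)

lemma alg_mono: "f \<in> alg A \<Longrightarrow> A \<subseteq> alg B \<Longrightarrow> f \<in> alg B"
  by (induction rule: alg.induct) (auto intro: alg.intros)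

lemma alg_image: "f \<in> alg A \<Longrightarrow> field_endo h \<Longrightarrow> (\<And>g. g \<in> A \<Longrightarrow> h g \<in> alg B) \<Longrightarrow> h f \<in> alg B"
  by (induction rule: alg.induct) (auto intro: alg.intros simp: endo_simps)

lemma alg_subset_Pol: "f \<in> alg A \<Longrightarrow> A \<subseteq> Pol \<Longrightarrow> f \<in> Pol"
  by (induction rule: alg.induct) (auto intro: Pol_add Pol_mult)

lemma Pol_subset_alg: "f \<in> Pol \<Longrightarrow> range Xvar \<subseteq> alg A \<Longrightarrow> f \<in> alg A"
  by (induction rule: Pol_induct) (auto intro: alg.intros)

definition spec :: "'r \<Rightarrow> complex \<Rightarrow> 'r \<Rightarrow> 'r::{finite,linorder} ratfun" where
  "spec i a = Xvar(i := rconst a)"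

lemma spec_simps [simp]: "spec i a i = rconst a" "j \<noteq> i \<Longrightarrow> spec i a j = Xvar j"
  by (simp_all add: spec_def)

text \<open>The factor theorem, in the form that \<open>f\<close> and its specialisation are congruent modulo
  \<open>x\<^sub>i - a\<close>; congruences are compatible with sums and products.\<close>

lemma spec_congruence:
  assumes "f \<in> Pol"
  shows "rat_subst (spec i a) f \<in> Pol \<and>
    (\<exists>g\<in>Pol. f - rat_subst (spec i a) f = (Xvar i - rconst a) * g)"
  using assms
proof (induction f rule: Pol_induct)
  case (const c)
  show ?case using Pol_rconst[of 0] by (auto intro!: bexI[of _ 0])
next
  case (var j)
  show ?case
  proof (cases "j = i")
    case True
    thus ?thesis using Pol_rconst[of 1] by (auto intro!: bexI[of _ 1])
  next
    case False
    thus ?thesis using Pol_rconst[of 0] by (auto intro!: bexI[of _ 0])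
  qed
next
  case (add f g)
  then obtain u v where uv: "u \<in> Pol" "v \<in> Pol" "f - rat_subst (spec i a) f = (Xvar i - rconst a) * u"
    "g - rat_subst (spec i a) g = (Xvar i - rconst a) * v"
    by blast
  have sum: "rat_subst (spec i a) (f + g) = rat_subst (spec i a) f + rat_subst (spec i a) g"
    using add by (intro rat_subst_add regular_at_Pol)
  have "f + g - rat_subst (spec i a) (f + g) =
      (f - rat_subst (spec i a) f) + (g - rat_subst (spec i a) g)"
    by (simp add: sum algebra_simps)
  also have "\<dots> = (Xvar i - rconst a) * (u + v)"
    unfolding uv by (simp add: algebra_simps)
  finally show ?case
    unfolding sum using add.IH uv by (intro conjI bexI[of _ "u + v"] Pol_add) simp_all
next
  case (mult f g)
  then obtain u v where uv: "u \<in> Pol" "v \<in> Pol"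
    "f - rat_subst (spec i a) f = (Xvar i - rconst a) * u"
    "g - rat_subst (spec i a) g = (Xvar i - rconst a) * v"
    by blast
  have prod: "rat_subst (spec i a) (f * g) = rat_subst (spec i a) f * rat_subst (spec i a) g"
    using mult by (intro rat_subst_mult regular_at_Pol)
  have "f * g - rat_subst (spec i a) f * rat_subst (spec i a) g =
      f * (g - rat_subst (spec i a) g) + (f - rat_subst (spec i a) f) * rat_subst (spec i a) g"
    by (simp add: algebra_simps)
  also have "\<dots> = (Xvar i - rconst a) * (f * v + u * rat_subst (spec i a) g)"
    unfolding uv by (simp add: algebra_simps)
  finally show ?case
    unfolding prod using mult uv
    by (intro conjI bexI[of _ "f * v + u * rat_subst (spec i a) g"] Pol_add Pol_mult) simp_all
qed

lemma factor_theorem: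
  assumes "f \<in> Pol" "rat_subst (spec i a) f = 0"
  obtains g where "g \<in> Pol" "f = (Xvar i - rconst a) * g"
  using spec_congruence[OF assms(1), of i a] assms(2) by auto

section \<open>Reduced words in a simply laced Weyl group\<close>

lemma linear_root_refl: "linear (root_refl \<beta>)"
  unfolding root_refl_def
  by (rule linearI) (simp_all add: inner_add_left algebra_simps add_divide_distrib)

lemma root_refl_add: "root_refl \<beta> (u + v) = root_refl \<beta> u + root_refl \<beta> v"
  and root_refl_minus: "root_refl \<beta> (- v) = - root_refl \<beta> v"
  and root_refl_scale: "root_refl \<beta> (c *\<^sub>R v) = c *\<^sub>R root_refl \<beta> v"
  using linear_add[OF linear_root_refl] linear_neg[OF linear_root_refl]
    linear_scale[OF linear_root_refl] by blast+

lemma root_refl_self: "\<beta> \<noteq> 0 \<Longrightarrow> root_refl \<beta> \<beta> = - \<beta>"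
  by (simp add: root_refl_def scaleR_2)

lemma root_refl_involution: "root_refl \<beta> (root_refl \<beta> v) = v"
  by (cases "\<beta> = 0") (simp_all add: root_refl_def inner_diff_left)

lemma inner_root_refl: "root_refl \<beta> u \<bullet> root_refl \<beta> v = u \<bullet> v"
  by (cases "\<beta> = 0")
    (simp_all add: root_refl_def inner_diff_left inner_diff_right inner_commute algebra_simps)

lemma root_refl_uminus: "root_refl (- \<beta>) = root_refl \<beta>"
  by (simp add: root_refl_def fun_eq_iff)

locale simply_laced_roots =
  fixes \<Phi> :: "'a::euclidean_space set" and \<alpha> :: "'r::{finite,linorder} \<Rightarrow> 'a"
  assumes roots: "reduced_root_system \<Phi>"
    and simple: "simple_roots \<Phi> \<alpha>"
    and laced: "simply_laced \<alpha>"
begin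

abbreviation pos :: "'a set" where "pos \<equiv> positive_roots \<Phi> \<alpha>"
abbreviation s :: "'r \<Rightarrow> 'a \<Rightarrow> 'a" where "s i \<equiv> root_refl (\<alpha> i)"

lemma finite_roots: "finite \<Phi>" and root_nonzero: "\<beta> \<in> \<Phi> \<Longrightarrow> \<beta> \<noteq> 0"
  and root_refl_root: "\<beta> \<in> \<Phi> \<Longrightarrow> \<gamma> \<in> \<Phi> \<Longrightarrow> root_refl \<beta> \<gamma> \<in> \<Phi>"
  and root_integral: "\<beta> \<in> \<Phi> \<Longrightarrow> \<gamma> \<in> \<Phi> \<Longrightarrow> 2 * (\<gamma> \<bullet> \<beta>) / (\<beta> \<bullet> \<beta>) \<in> \<int>"
  and root_multiple: "\<beta> \<in> \<Phi> \<Longrightarrow> c *\<^sub>R \<beta> \<in> \<Phi> \<Longrightarrow> c = 1 \<or> c = - 1"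
  using roots unfolding reduced_root_system_def by blast+

lemma inj_simple: "inj \<alpha>" and simple_root [simp]: "\<alpha> i \<in> \<Phi>"
  and independent_simple: "independent (range \<alpha>)"
  and root_sign: "\<beta> \<in> \<Phi> \<Longrightarrow> \<exists>k :: 'r \<Rightarrow> nat.
        \<beta> = (\<Sum>i\<in>UNIV. real (k i) *\<^sub>R \<alpha> i) \<or> \<beta> = - (\<Sum>i\<in>UNIV. real (k i) *\<^sub>R \<alpha> i)"
  using simple unfolding simple_roots_def by blast+

lemma simple_nonzero [simp]: "\<alpha> i \<noteq> 0"
  by (rule root_nonzero) simp

lemma uminus_root: "\<beta> \<in> \<Phi> \<Longrightarrow> - \<beta> \<in> \<Phi>"
  using root_refl_root[of \<beta> \<beta>] root_refl_self[of \<beta>] root_nonzero by auto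

text \<open>Linear functionals dual to the simple roots. They are defined on the whole ambient space, which
  the roots need not span.\<close>

definition co :: "'r \<Rightarrow> 'a \<Rightarrow> real" where
  "co = (SOME c. \<forall>i. linear (c i) \<and> (\<forall>j. c i (\<alpha> j) = (if i = j then 1 else 0)))"

lemma co_props: "linear (co i) \<and> (\<forall>j. co i (\<alpha> j) = (if i = j then 1 else 0))"
proof -
  have "\<exists>f::'a \<Rightarrow> real. linear f \<and> (\<forall>j. f (\<alpha> j) = (if i = j then 1 else 0))" for i
  proof -
    obtain f :: "'a \<Rightarrow> real" where f: "linear f"
      "\<forall>x\<in>range \<alpha>. f x = (if x = \<alpha> i then 1 else 0)"
      using linear_independent_extend[OF independent_simple, of "\<lambda>x. if x = \<alpha> i then 1 else 0"]
      by blast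
    thus ?thesis using inj_simple by (intro exI[of _ f]) (auto dest: injD)
  qed
  hence "\<exists>c. \<forall>i. linear (c i :: 'a \<Rightarrow> real) \<and> (\<forall>j. c i (\<alpha> j) = (if i = j then 1 else 0))"
    by metis
  hence "\<forall>i. linear (co i) \<and> (\<forall>j. co i (\<alpha> j) = (if i = j then 1 else 0))"
    unfolding co_def by (rule someI_ex)
  thus ?thesis by blast
qed

lemma linear_co: "linear (co i)" and co_simple: "co i (\<alpha> j) = (if i = j then 1 else 0)"
  using co_props by auto

lemmas co_add = linear_add[OF linear_co] and co_minus = linear_neg[OF linear_co]
  and co_diff = linear_diff[OF linear_co] and co_scale = linear_scale[OF linear_co]

lemma co_0 [simp]: "co i 0 = 0"
  using linear_0[OF linear_co] .

lemma co_comb: "co i (\<Sum>j\<in>UNIV. k j *\<^sub>R \<alpha> j) = k i"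
proof -
  have "co i (\<Sum>j\<in>UNIV. k j *\<^sub>R \<alpha> j) = (\<Sum>j\<in>UNIV. k j * (if i = j then 1 else 0))"
    by (simp add: linear_sum[OF linear_co] co_scale co_simple)
  also have "\<dots> = (\<Sum>j\<in>UNIV. if i = j then k j else 0)"
    by (intro sum.cong) auto
  finally show ?thesis by simp
qed

lemma root_expansion: "\<beta> \<in> \<Phi> \<Longrightarrow> \<beta> = (\<Sum>i\<in>UNIV. co i \<beta> *\<^sub>R \<alpha> i)"
proof -
  assume "\<beta> \<in> \<Phi>"
  then obtain k :: "'r \<Rightarrow> real" where "\<beta> = (\<Sum>i\<in>UNIV. k i *\<^sub>R \<alpha> i)"
  proof -
    obtain k :: "'r \<Rightarrow> nat" where
      k: "\<beta> = (\<Sum>i\<in>UNIV. real (k i) *\<^sub>R \<alpha> i) \<or> \<beta> = - (\<Sum>i\<in>UNIV. real (k i) *\<^sub>R \<alpha> i)"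
      using root_sign[OF \<open>\<beta> \<in> \<Phi>\<close>] by blast
    thus ?thesis
      using that[of "\<lambda>i. real (k i)"] that[of "\<lambda>i. - real (k i)"] by (auto simp: sum_negf)
  qed
  thus ?thesis by (simp add: co_comb)
qed

lemma co_root_Ints: "\<beta> \<in> \<Phi> \<Longrightarrow> co i \<beta> \<in> \<int>"
  using root_sign[of \<beta>] by (auto simp: co_comb co_minus)

lemma pos_root: "\<beta> \<in> pos \<Longrightarrow> \<beta> \<in> \<Phi>"
  by (auto simp: positive_roots_def)

lemma finite_pos: "finite pos"
  using finite_roots by (auto intro: finite_subset pos_root)

lemma co_pos: "\<beta> \<in> pos \<Longrightarrow> 0 \<le> co i \<beta>"
  by (auto simp: positive_roots_def co_comb)

lemma not_pos: "\<beta> \<in> \<Phi> \<Longrightarrow> \<beta> \<notin> pos \<Longrightarrow> - \<beta> \<in> pos"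
  using root_sign[of \<beta>] uminus_root[of \<beta>] by (auto simp: positive_roots_def)

definition height :: "'a \<Rightarrow> real" where "height v = (\<Sum>i\<in>UNIV. co i v)"

lemma height_add: "height (u + v) = height u + height v"
  and height_minus: "height (- v) = - height v"
  and height_diff: "height (u - v) = height u - height v"
  and height_scale: "height (c *\<^sub>R v) = c * height v"
  and height_simple: "height (\<alpha> i) = 1"
  by (simp_all add: height_def co_add co_minus co_diff co_scale co_simple sum.distrib sum_negf
      sum_subtractf sum_distrib_left)

lemma height_pos: "\<beta> \<in> pos \<Longrightarrow> 0 < height \<beta>"
proof -
  assume b: "\<beta> \<in> pos"
  have "\<exists>i. co i \<beta> \<noteq> 0"
    using root_expansion[OF pos_root[OF b]] root_nonzero[OF pos_root[OF b]]
    by (metis (no_types, lifting) scaleR_zero_left sum.neutral)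
  then obtain i where "0 < co i \<beta>" using co_pos[OF b] by (metis less_eq_real_def)
  thus ?thesis
    unfolding height_def using co_pos[OF b] by (intro sum_pos2[of _ i]) auto
qed

lemma pos_iff_height: "\<beta> \<in> \<Phi> \<Longrightarrow> \<beta> \<in> pos \<longleftrightarrow> 0 < height \<beta>"
  using height_pos[of \<beta>] height_pos[of "- \<beta>"] not_pos[of \<beta>] by (force simp: height_minus)

lemma pos_iff_uminus: "\<beta> \<in> \<Phi> \<Longrightarrow> - \<beta> \<in> pos \<longleftrightarrow> \<beta> \<notin> pos"
  using height_pos[of \<beta>] height_pos[of "- \<beta>"] not_pos[of \<beta>] by (auto simp: height_minus)

lemma pos_if_co: "\<beta> \<in> \<Phi> \<Longrightarrow> 0 < co i \<beta> \<Longrightarrow> \<beta> \<in> pos"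
  using co_pos[of "- \<beta>" i] not_pos[of \<beta>] by (fastforce simp: co_minus)

lemma simple_pos [simp]: "\<alpha> i \<in> pos"
  by (rule pos_if_co[of _ i]) (simp_all add: co_simple)

lemma co_refl_other: "j \<noteq> i \<Longrightarrow> co j (s i v) = co j v"
  by (simp add: root_refl_def co_diff co_scale co_simple)

lemma multiple_of_simple:
  assumes "\<beta> \<in> \<Phi>" "\<And>j. j \<noteq> i \<Longrightarrow> co j \<beta> = 0"
  shows "\<beta> = \<alpha> i \<or> \<beta> = - \<alpha> i"
proof -
  have "(\<Sum>j\<in>UNIV. co j \<beta> *\<^sub>R \<alpha> j) = (\<Sum>j\<in>UNIV. if j = i then co i \<beta> *\<^sub>R \<alpha> i else 0)"
    using assms(2) by (intro sum.cong) auto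
  hence "\<beta> = co i \<beta> *\<^sub>R \<alpha> i"
    using root_expansion[OF assms(1)] by simp
  moreover have "co i \<beta> = 1 \<or> co i \<beta> = - 1"
    using root_multiple[of "\<alpha> i" "co i \<beta>"] assms(1) calculation by simp
  ultimately show ?thesis by (metis scaleR_minus_left scaleR_one)
qed

text \<open>Reflecting in \<open>\<alpha>\<^sub>i\<close> changes the coefficient of \<open>\<alpha>\<^sub>i\<close> only, and a positive root other than \<open>\<alpha>\<^sub>i\<close> has
  some other coefficient that fixes its sign.\<close>

lemma simple_refl_pos:
  assumes "\<beta> \<in> pos" "\<beta> \<noteq> \<alpha> i"
  shows "s i \<beta> \<in> pos"
proof -
  have "\<beta> \<noteq> - \<alpha> i"
    using assms(1) pos_iff_uminus[of "\<alpha> i"] by auto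
  then obtain j where j: "j \<noteq> i" "co j \<beta> \<noteq> 0"
    using multiple_of_simple[OF pos_root[OF assms(1)], of i] assms(2) by blast
  hence "0 < co j (s i \<beta>)"
    using co_pos[OF assms(1), of j] by (simp add: co_refl_other)
  thus ?thesis
    using pos_if_co root_refl_root[OF simple_root pos_root[OF assms(1)]] by blast
qed

lemma simple_refl_pos_iff:
  assumes "\<beta> \<in> pos"
  shows "s i \<beta> \<in> pos \<longleftrightarrow> \<beta> \<noteq> \<alpha> i"
  using simple_refl_pos[OF assms, of i] pos_iff_uminus[of "\<alpha> i"] root_refl_self[of "\<alpha> i"]
  by auto

definition cartan :: "'r \<Rightarrow> 'r \<Rightarrow> int" where
  "cartan i j = (if i = j then 2 else if adjacent \<alpha> i j then - 1 else 0)"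

lemma adjacent_sym: "adjacent \<alpha> i j \<longleftrightarrow> adjacent \<alpha> j i"
  by (auto simp: adjacent_def dynkin_edges_def mult.commute)

text \<open>For adjacent nodes: two integers with product \<open>1\<close> are both \<open>1\<close> or both \<open>- 1\<close>. The positive sign is excluded since
  \<open>s\<^sub>i \<alpha>\<^sub>j\<close> would have coefficients of both signs.\<close>

lemma cartan_simple: "2 * (\<alpha> j \<bullet> \<alpha> i) / (\<alpha> i \<bullet> \<alpha> i) = of_int (cartan i j)"
proof -
  define c where "c i j = 2 * (\<alpha> j \<bullet> \<alpha> i) / (\<alpha> i \<bullet> \<alpha> i)" for i j
  have nonpos: "c i j \<le> 0" if "i \<noteq> j" for i j
  proof (rule ccontr)
    assume "\<not> c i j \<le> 0"
    have r: "s i (\<alpha> j) \<in> \<Phi>" by (rule root_refl_root) simp_all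
    have "co j (s i (\<alpha> j)) = 1" "co i (s i (\<alpha> j)) = - c i j"
      using that by (simp_all add: root_refl_def co_diff co_scale co_simple c_def)
    with pos_if_co[OF r, of j] co_pos[of "s i (\<alpha> j)" i] \<open>\<not> c i j \<le> 0\<close> show False by simp
  qed
  have Ints: "c i j \<in> \<int>" for i j
    unfolding c_def by (rule root_integral) simp_all
  consider "i = j" | "i \<noteq> j" "adjacent \<alpha> i j" | "i \<noteq> j" "\<not> adjacent \<alpha> i j" by blast
  thus ?thesis
  proof cases
    case 1
    thus ?thesis by (simp add: cartan_def)
  next
    case 2
    have "dynkin_edges \<alpha> i j = 1"
      using laced 2 unfolding simply_laced_def by blast
    hence "c j i * c i j = 1"
      by (simp add: dynkin_edges_def c_def del: divide_divide_eq_left times_divide_eq_left times_divide_eq_right)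
    moreover obtain m n where "c i j = of_int m" "c j i = of_int n"
      using Ints by (metis Ints_cases)
    ultimately have "m * n = 1" "m \<le> 0"
      using nonpos[of i j] 2 by (simp_all add: mult.commute flip: of_int_mult)
    hence "m = - 1"
      using zmult_eq_1_iff by auto
    thus ?thesis using \<open>c i j = of_int m\<close> 2 by (simp add: c_def cartan_def)
  next
    case 3
    hence "\<alpha> i \<bullet> \<alpha> j = 0"
      by (auto simp: adjacent_def dynkin_edges_def inner_commute)
    thus ?thesis using 3 by (simp add: cartan_def inner_commute)
  qed
qed

lemma refl_simple: "s i (\<alpha> j) = \<alpha> j - of_int (cartan i j) *\<^sub>R \<alpha> i"
  by (simp add: root_refl_def cartan_simple)

fun wprod :: "'r list \<Rightarrow> 'a \<Rightarrow> 'a" where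
  "wprod [] = id"
| "wprod (i # is) = s i \<circ> wprod is"

lemma wprod_eq_foldr: "wprod is = foldr (\<lambda>i g. s i \<circ> g) is id"
  by (induction "is") simp_all

lemma wprod_append: "wprod (is @ js) = wprod is \<circ> wprod js"
  by (induction "is") (simp_all add: comp_assoc)

lemma wprod_rev: "wprod (rev is) (wprod is v) = v"
  by (induction "is" arbitrary: v) (simp_all add: wprod_append root_refl_involution)

lemma wprod_rev': "wprod is (wprod (rev is) v) = v"
  using wprod_rev[of "rev is"] by simp

lemma wprod_root: "\<beta> \<in> \<Phi> \<Longrightarrow> wprod is \<beta> \<in> \<Phi>"
  by (induction "is") (auto intro: root_refl_root)

lemma wprod_add: "wprod is (u + v) = wprod is u + wprod is v"
  and wprod_minus: "wprod is (- v) = - wprod is v"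
  by (induction "is") (simp_all add: root_refl_add root_refl_minus)

lemma wprod_diff_scale: "wprod is (u - c *\<^sub>R v) = wprod is u - c *\<^sub>R wprod is v"
proof -
  have "wprod is (c *\<^sub>R v) = c *\<^sub>R wprod is v" for v
    by (induction "is") (simp_all add: root_refl_scale)
  thus ?thesis using wprod_add[of "is" u "- (c *\<^sub>R v)"] by (simp add: wprod_minus)
qed

lemma inner_wprod: "wprod is u \<bullet> wprod is v = u \<bullet> v"
  by (induction "is") (simp_all add: inner_root_refl)

lemma refl_conj: "root_refl (wprod is \<beta>) (wprod is v) = wprod is (root_refl \<beta> v)"
  by (simp add: root_refl_def inner_wprod wprod_diff_scale)

lemma wprod_snoc_pos_iff: "wprod (is @ [i]) (\<alpha> i) \<in> pos \<longleftrightarrow> wprod is (\<alpha> i) \<notin> pos"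
  by (simp add: wprod_append root_refl_self wprod_minus pos_iff_uminus wprod_root)

lemma wprod_snoc_snoc: "wprod (is @ [i, i]) = wprod is"
  by (simp add: wprod_append fun_eq_iff root_refl_involution)

text \<open>Every positive root can be lowered to a simple one by simple reflections: some simple root
  has positive inner product with it, and reflecting in that one decreases the height.\<close>

lemma pos_conj_simple:
  assumes "\<beta> \<in> pos"
  shows "\<exists>is i. \<beta> = wprod is (\<alpha> i)"
  using assms
proof (induction "nat \<lfloor>height \<beta>\<rfloor>" arbitrary: \<beta> rule: less_induct)
  case less
  show ?case
  proof (cases "\<exists>i. \<beta> = \<alpha> i")
    case True
    thus ?thesis by (metis id_apply wprod.simps(1))
  next
    case False
    have r: "\<beta> \<in> \<Phi>" using less.prems pos_root by blast
    have "\<beta> \<bullet> \<beta> = (\<Sum>i\<in>UNIV. co i \<beta> *\<^sub>R \<alpha> i) \<bullet> \<beta>"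
      using root_expansion[OF r] by simp
    also have "\<dots> = (\<Sum>i\<in>UNIV. co i \<beta> * (\<alpha> i \<bullet> \<beta>))"
      by (simp add: inner_sum_left)
    finally have "0 < (\<Sum>i\<in>UNIV. co i \<beta> * (\<alpha> i \<bullet> \<beta>))"
      using root_nonzero[OF r] by (metis inner_gt_zero_iff)
    then obtain i where "0 < co i \<beta> * (\<alpha> i \<bullet> \<beta>)"
      by (meson not_le sum_nonpos)
    hence ip: "0 < \<alpha> i \<bullet> \<beta>"
      using co_pos[OF less.prems, of i] by (simp add: zero_less_mult_iff)
    define n where "n = 2 * (\<beta> \<bullet> \<alpha> i) / (\<alpha> i \<bullet> \<alpha> i)"
    have "n \<in> \<int>" unfolding n_def by (intro root_integral) (simp_all add: r)
    moreover have "0 < n" using ip by (simp add: n_def inner_commute)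
    ultimately have "1 \<le> n" by (auto elim!: Ints_cases)
    have h: "height (s i \<beta>) = height \<beta> - n"
      by (simp add: root_refl_def height_diff height_scale height_simple flip: n_def)
    have p: "s i \<beta> \<in> pos" using simple_refl_pos[OF less.prems, of i] False by blast
    have "nat \<lfloor>height (s i \<beta>)\<rfloor> < nat \<lfloor>height \<beta>\<rfloor>"
      using h \<open>1 \<le> n\<close> height_pos[OF p] by linarith
    from less.hyps[OF this p] obtain "is" j where "s i \<beta> = wprod is (\<alpha> j)" by blast
    hence "\<beta> = wprod (i # is) (\<alpha> j)"
      by (metis comp_apply root_refl_involution wprod.simps(2))
    thus ?thesis by blast
  qed
qed

lemma root_conj_simple:
  assumes "\<beta> \<in> \<Phi>"
  shows "\<exists>is i. \<beta> = wprod is (\<alpha> i) \<or> \<beta> = - wprod is (\<alpha> i)"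
  using pos_conj_simple[of \<beta>] pos_conj_simple[of "- \<beta>"] not_pos[OF assms]
  by (metis add.inverse_inverse)

lemma root_refl_is_wprod: "\<beta> \<in> \<Phi> \<Longrightarrow> \<exists>is. root_refl \<beta> = wprod is"
proof -
  assume "\<beta> \<in> \<Phi>"
  then obtain "is" i where "root_refl \<beta> = root_refl (wprod is (\<alpha> i))"
    using root_conj_simple[of \<beta>] by (metis root_refl_uminus)
  also have "\<dots> = wprod (is @ i # rev is)"
  proof
    fix v show "root_refl (wprod is (\<alpha> i)) v = wprod (is @ i # rev is) v"
      using refl_conj[of "is" "\<alpha> i" "wprod (rev is) v"] by (simp add: wprod_append wprod_rev')
  qed
  finally show ?thesis by blast
qed

lemma weyl_group_eq: "weyl_group \<Phi> = range wprod"
proof (intro equalityI subsetI)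
  fix w assume "w \<in> weyl_group \<Phi>"
  thus "w \<in> range wprod"
  proof induction
    case id
    show ?case by (rule range_eqI[of _ _ "[]"]) simp
  next
    case (step w \<beta>)
    then obtain "is" js where "w = wprod is" "root_refl \<beta> = wprod js"
      using root_refl_is_wprod[of \<beta>] by blast
    hence "w \<circ> root_refl \<beta> = wprod (is @ js)" by (simp add: wprod_append)
    thus ?case by blast
  qed
next
  fix w assume "w \<in> range wprod"
  then obtain "is" where "w = wprod is" by blast
  moreover have "wprod is \<in> weyl_group \<Phi>"
  proof (induction "is" rule: rev_induct)
    case (snoc i "is")
    thus ?case using weyl_group.step[of "wprod is" \<Phi> "\<alpha> i"] by (simp add: wprod_append o_def)
  qed (simp add: weyl_group.id[unfolded id_def])
  ultimately show "w \<in> weyl_group \<Phi>" by simp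
qed

lemma word_of: "w \<in> weyl_group \<Phi> \<Longrightarrow> wprod (word_of \<alpha> w) = w"
  unfolding word_of_def weyl_group_eq wprod_eq_foldr
  by (auto intro: sym[OF someI])

text \<open>Appending \<open>i\<close> lengthens \<open>w\<close> exactly if \<open>w\<close> keeps the simple root \<open>\<alpha>\<^sub>i\<close> positive.\<close>

inductive reduced :: "'r list \<Rightarrow> bool" where
  Nil: "reduced []"
| snoc: "reduced is \<Longrightarrow> wprod is (\<alpha> i) \<in> pos \<Longrightarrow> reduced (is @ [i])"

lemma reduced_snocD:
  assumes "reduced (is @ [i])"
  shows "reduced is" "wprod is (\<alpha> i) \<in> pos"
  using assms by (auto elim: reduced.cases)

text \<open>The exchange condition. The letter to delete is the one at which the root \<open>\<alpha>\<^sub>i\<close>, on its way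
  through the word, first turns negative: just before, it equals the simple root of that letter.\<close>

lemma deletion:
  assumes "wprod is (\<alpha> i) \<notin> pos"
  shows "\<exists>ks. length ks < length is \<and> wprod ks = wprod (is @ [i])"
  using assms
proof (induction "is")
  case Nil
  thus ?case by simp
next
  case (Cons j "is")
  show ?case
  proof (cases "wprod is (\<alpha> i) \<in> pos")
    case True
    with Cons.prems have j: "wprod is (\<alpha> i) = \<alpha> j"
      using simple_refl_pos_iff[OF True, of j] by auto
    have "s j (wprod (is @ [i]) v) = wprod is v" for v
      using refl_conj[of "is" "\<alpha> i" v] by (simp add: j wprod_append root_refl_involution flip: refl_conj)
    thus ?thesis by (intro exI[of _ "is"]) (simp add: fun_eq_iff)
  next
    case False
    then obtain ks where "length ks < length is" "wprod ks = wprod (is @ [i])"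
      using Cons.IH by blast
    thus ?thesis by (intro exI[of _ "j # ks"]) simp
  qed
qed

text \<open>If some \<open>\<alpha>\<^sub>j\<close> becomes negative, the exchange condition shortens the word to one for \<open>w s\<^sub>j\<close>; if none
  does, then the word without its last letter \<open>i\<close> makes \<open>\<alpha>\<^sub>i\<close> negative, and the exchange condition applied
  there yields a shorter word for \<open>w\<close> itself.\<close>

lemma ex_reduced: "\<exists>js. reduced js \<and> wprod js = wprod is"
proof (induction "length is" arbitrary: "is" rule: less_induct)
  case less
  show ?case
  proof (cases "\<exists>j. wprod is (\<alpha> j) \<notin> pos")
    case True
    then obtain j where j: "wprod is (\<alpha> j) \<notin> pos" by blast
    then obtain ks where ks: "length ks < length is" "wprod ks = wprod (is @ [j])"
      using deletion by blast
    with less obtain js where js: "reduced js" "wprod js = wprod (is @ [j])" by metis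
    hence "reduced (js @ [j])"
      using j wprod_snoc_pos_iff[of "is" j] by (auto intro: reduced.snoc)
    moreover have "wprod (js @ [j]) = wprod is"
      using js(2) wprod_snoc_snoc[of "is" j] by (simp add: wprod_append comp_assoc)
    ultimately show ?thesis by blast
  next
    case all_pos: False
    show ?thesis
    proof (cases "is" rule: rev_exhaust)
      case Nil
      thus ?thesis using reduced.Nil by blast
    next
      case (snoc is' i)
      with all_pos have "wprod is' (\<alpha> i) \<notin> pos" using wprod_snoc_pos_iff by metis
      then obtain ks where "length ks < length is'" "wprod ks = wprod is"
        using deletion snoc by blast
      thus ?thesis using less[of ks] snoc by auto
    qed
  qed
qed

text \<open>Both sides are the reflection in \<open>\<alpha>\<^sub>i + \<alpha>\<^sub>j = s\<^sub>i \<alpha>\<^sub>j = s\<^sub>j \<alpha>\<^sub>i\<close>.\<close>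

lemma simple_braid: "adjacent \<alpha> i j \<Longrightarrow> s i (s j (s i v)) = s j (s i (s j v))"
proof -
  assume a: "adjacent \<alpha> i j"
  have "s i (\<alpha> j) = s j (\<alpha> i)"
    using a adjacent_sym[of i j] by (auto simp: refl_simple cartan_def adjacent_def)
  hence "root_refl (s i (\<alpha> j)) v = root_refl (s j (\<alpha> i)) v" by simp
  moreover have "root_refl (s i (\<alpha> j)) v = s i (s j (s i v))"
    "root_refl (s j (\<alpha> i)) v = s j (s i (s j v))"
    using refl_conj[of "[i]" "\<alpha> j" "s i v"] refl_conj[of "[j]" "\<alpha> i" "s j v"]
    by (simp_all add: root_refl_involution)
  ultimately show ?thesis by simp
qed

lemma simple_commute:
  assumes "\<not> adjacent \<alpha> i j"
  shows "s i (s j v) = s j (s i v)"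
proof (cases "i = j")
  case False
  hence "s i (\<alpha> j) = \<alpha> j"
    using assms by (simp add: refl_simple cartan_def)
  thus ?thesis
    using refl_conj[of "[i]" "\<alpha> j" v] by simp
qed simp

context
  fixes T :: "'r \<Rightarrow> 'b \<Rightarrow> 'b"
  assumes involution: "\<And>i f. T i (T i f) = f"
    and commute: "\<And>i j f. i \<noteq> j \<Longrightarrow> \<not> adjacent \<alpha> i j \<Longrightarrow> T i (T j f) = T j (T i f)"
    and braid: "\<And>i j f. adjacent \<alpha> i j \<Longrightarrow> T i (T j (T i f)) = T j (T i (T j f))"
begin

text \<open>Matsumoto's theorem. Two reduced words of \<open>w\<close> with different last letters \<open>i\<close>, \<open>j\<close> can be compared
  with words of \<open>w\<close> that end in the longest word on \<open>i\<close> and \<open>j\<close>, since \<open>w\<close> makes both \<open>\<alpha>\<^sub>i\<close> and \<open>\<alpha>\<^sub>j\<close> negative.\<close>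

lemma reduced_words_agree:
  assumes "reduced is" "reduced js" "wprod is = wprod js"
  shows "length is = length js \<and> fold T is f = fold T js f"
  using assms
proof (induction "length is" arbitrary: "is" js)
  case 0
  hence "is = []" by simp
  show ?case
  proof (cases js rule: rev_exhaust)
    case (snoc js' j)
    hence "wprod js' (\<alpha> j) \<in> pos" using 0 reduced_snocD by blast
    moreover have "wprod (js' @ [j]) (\<alpha> j) = \<alpha> j"
      using fun_cong[OF "0.prems"(3), of "\<alpha> j"] snoc \<open>is = []\<close> by simp
    ultimately show ?thesis using wprod_snoc_pos_iff[of js' j] by simp
  qed (use \<open>is = []\<close> in simp)
next
  case (Suc n)
  obtain is' i where is': "is = is' @ [i]" "length is' = n"
    using Suc(2) by (metis length_Suc_conv_rev)
  have red_i: "reduced is'" "wprod is' (\<alpha> i) \<in> pos" using Suc.prems(1) is' reduced_snocD by auto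
  have neg_i: "wprod is (\<alpha> i) \<notin> pos"
    using red_i wprod_snoc_pos_iff is' by blast
  obtain js' j where js': "js = js' @ [j]"
  proof (cases js rule: rev_exhaust)
    case Nil
    thus ?thesis using neg_i Suc.prems(3) by simp
  qed blast
  have red_j: "reduced js'" "wprod js' (\<alpha> j) \<in> pos" using Suc.prems(2) js' reduced_snocD by auto
  have neg_j: "wprod is (\<alpha> j) \<notin> pos"
    using red_j wprod_snoc_pos_iff js' Suc.prems(3) by metis
  have w_i: "wprod (is @ [i]) = wprod is'"
    using wprod_snoc_snoc[of is' i] is' by simp
  have w_j: "wprod (is @ [j]) = wprod js'"
    using wprod_snoc_snoc[of js' j] js' Suc.prems(3) by (simp add: wprod_append comp_assoc)
  \<comment> \<open>a common reduced left part \<open>ks\<close>, continued to reduced words of \<open>w s\<^sub>i\<close> and \<open>w s\<^sub>j\<close>\<close>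
  have compare: ?case
    if ks: "reduced (ks @ us)" "wprod (ks @ us) = wprod (is @ [i])"
      "reduced (ks @ vs)" "wprod (ks @ vs) = wprod (is @ [j])" "length us = length vs"
      and T: "\<And>g. T i (fold T us g) = T j (fold T vs g)" for ks us vs
  proof -
    have 1: "length is' = length (ks @ us) \<and> fold T is' f = fold T (ks @ us) f"
      using Suc.hyps(1)[of is' "ks @ us"] is' red_i ks w_i by simp
    have 2: "length (ks @ vs) = length js' \<and> fold T (ks @ vs) f = fold T js' f"
      using Suc.hyps(1)[of "ks @ vs" js'] 1 is' red_j ks w_j by simp
    show ?thesis using 1 2 T ks(5) is' js' by simp
  qed
  show ?case
  proof (cases "i = j")
    case True
    thus ?thesis using compare[of is' "[]" "[]"] red_i w_i by simp
  next
    case ij: False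
    show ?thesis
    proof (cases "adjacent \<alpha> i j")
      case False
      obtain ks where ks: "reduced ks" "wprod ks = wprod (is @ [i, j])"
        using ex_reduced by blast
      have ks': "wprod ks = wprod (is @ [j, i])"
        using simple_commute[OF False] ks(2) by (simp add: wprod_append fun_eq_iff)
      have fix_ij: "s i (\<alpha> j) = \<alpha> j" "s j (\<alpha> i) = \<alpha> i"
        using False ij adjacent_sym[of i j] by (simp_all add: refl_simple cartan_def)
      have "wprod ks (\<alpha> j) = - wprod is (\<alpha> j)" "wprod ks (\<alpha> i) = - wprod is (\<alpha> i)"
        by (simp add: ks wprod_append root_refl_self root_refl_minus wprod_minus fix_ij)
          (simp add: ks' wprod_append root_refl_self root_refl_minus wprod_minus fix_ij)
      moreover have w: "wprod (ks @ [j]) = wprod (is @ [i])" "wprod (ks @ [i]) = wprod (is @ [j])"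
        by (simp add: wprod_append ks fun_eq_iff root_refl_involution)
          (simp add: wprod_append ks' fun_eq_iff root_refl_involution)
      ultimately have "reduced (ks @ [j])" "reduced (ks @ [i])"
        using neg_i neg_j ks(1) by (auto intro!: reduced.snoc simp: pos_iff_uminus wprod_root)
      thus ?thesis
        using compare[OF _ w(1) _ w(2)] commute[OF ij False] by simp
    next
      case True
      obtain ks where ks: "reduced ks" "wprod ks = wprod (is @ [i, j, i])"
        using ex_reduced by blast
      have ks': "wprod ks = wprod (is @ [j, i, j])"
        using simple_braid[OF True] ks(2) by (simp add: wprod_append fun_eq_iff)
      have sum_ij: "s i (\<alpha> j) = \<alpha> i + \<alpha> j" "s j (\<alpha> i) = \<alpha> i + \<alpha> j"
        using True ij adjacent_sym[of i j] by (simp_all add: refl_simple cartan_def add.commute)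
      have sum_neg: "- wprod is (\<alpha> i + \<alpha> j) \<in> pos"
      proof -
        have r: "wprod is (\<alpha> i + \<alpha> j) \<in> \<Phi>"
          using wprod_root[of "\<alpha> j" "is @ [i]"] by (simp add: wprod_append sum_ij)
        have "height (wprod is (\<alpha> i)) < 0" "height (wprod is (\<alpha> j)) < 0"
          using neg_i neg_j height_pos[of "- wprod is (\<alpha> i)"] height_pos[of "- wprod is (\<alpha> j)"]
          by (auto simp: pos_iff_uminus wprod_root height_minus)
        thus ?thesis
          using pos_iff_height[OF uminus_root[OF r]] by (simp add: height_minus height_diff wprod_add height_add)
      qed
      have swap: "s i (s j (\<alpha> i)) = \<alpha> j" "s j (s i (\<alpha> j)) = \<alpha> i"
        using sum_ij by (metis root_refl_involution)+
      have v: "wprod ks (\<alpha> i) = - wprod is (\<alpha> j)" "wprod ks (\<alpha> j) = - wprod is (\<alpha> i)"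
        by (simp add: ks wprod_append root_refl_self root_refl_minus wprod_minus swap)
          (simp add: ks' wprod_append root_refl_self root_refl_minus wprod_minus swap)
      hence r1: "reduced (ks @ [i])" "reduced (ks @ [j])"
        using neg_i neg_j ks(1) by (auto intro!: reduced.snoc simp: pos_iff_uminus wprod_root)
      have u: "wprod (ks @ [i]) = wprod (is @ [i, j])" "wprod (ks @ [j]) = wprod (is @ [j, i])"
        by (simp add: wprod_append ks fun_eq_iff root_refl_involution)
          (simp add: wprod_append ks' fun_eq_iff root_refl_involution)
      have "wprod (ks @ [i]) (\<alpha> j) = - wprod is (\<alpha> i + \<alpha> j)"
        "wprod (ks @ [j]) (\<alpha> i) = - wprod is (\<alpha> i + \<alpha> j)"
        unfolding u
        by (simp_all add: wprod_append root_refl_self root_refl_minus sum_ij flip: wprod_minus)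
      hence "reduced ((ks @ [i]) @ [j])" "reduced ((ks @ [j]) @ [i])"
        using sum_neg r1 reduced.snoc by metis+
      moreover have "wprod ((ks @ [i]) @ [j]) = wprod (is @ [i])"
        "wprod ((ks @ [j]) @ [i]) = wprod (is @ [j])"
        unfolding wprod_append[of "ks @ [i]"] wprod_append[of "ks @ [j]"] u
        by (simp_all add: wprod_append fun_eq_iff root_refl_involution)
      ultimately show ?thesis
        using compare[of ks "[i, j]" "[j, i]"] braid[OF True] by simp
    qed
  qed
qed

text \<open>An arbitrary word is compared with a reduced one letter by letter; a letter that shortens is
  absorbed because the operators are involutions.\<close>

theorem words_agree:
  assumes "wprod is = wprod js"
  shows "fold T is f = fold T js f"
proof -
  have red: "fold T is f = fold T ks f" if "reduced ks" "wprod ks = wprod is" for "is" ks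
    using that
  proof (induction "is" arbitrary: ks rule: rev_induct)
    case Nil
    thus ?case using reduced_words_agree[OF reduced.Nil, of ks] by (simp add: id_def)
  next
    case (snoc i "is")
    obtain ls where ls: "reduced ls" "wprod ls = wprod is" using ex_reduced by blast
    show ?case
    proof (cases "wprod is (\<alpha> i) \<in> pos")
      case True
      hence "reduced (ls @ [i])" using ls by (auto intro: reduced.snoc)
      thus ?thesis
        using reduced_words_agree[of "ls @ [i]" ks] snoc.IH[OF ls] snoc.prems ls(2)
        by (simp add: wprod_append o_def)
    next
      case False
      have "reduced (ks @ [i])"
        using False snoc.prems wprod_snoc_pos_iff[of "is" i] by (auto intro: reduced.snoc)
      moreover have "wprod (ks @ [i]) = wprod is"
        using snoc.prems by (simp add: wprod_append fun_eq_iff root_refl_involution)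
      ultimately show ?thesis using snoc.IH[of "ks @ [i]"] involution by simp
    qed
  qed
  obtain ks where "reduced ks" "wprod ks = wprod js" using ex_reduced by blast
  thus ?thesis using red[of ks "is"] red[of ks js] assms by simp
qed

end

end

section \<open>Monomials attached to the root lattice\<close>

locale root_series = simply_laced_roots \<Phi> \<alpha>
  for \<Phi> :: "'a::euclidean_space set" and \<alpha> :: "'r::{finite,linorder} \<Rightarrow> 'a" +
  fixes q :: nat and l :: "'r \<Rightarrow> nat"
  assumes q: "1 < q"
begin

abbreviation rq :: complex where "rq \<equiv> complex_of_real (sqrt (real q))"
abbreviation sq :: "'r ratfun" where "sq \<equiv> sqrtq q"

text \<open>In terms of \<open>y\<^sub>i = x\<^sub>i \<surd>q\<close> the action on the variables is purely monomial: \<open>y\<^sup>v\<close> goes to \<open>y\<^bsup>s\<^sub>i v\<^esup>\<close>.\<close>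

definition y :: "'r \<Rightarrow> 'r ratfun" where "y i = sq * Xvar i"

lemma rq_square: "rq * rq = of_nat q"
proof -
  have "rq * rq = complex_of_real (sqrt (real q) * sqrt (real q))"
    by (simp only: of_real_mult)
  thus ?thesis by simp
qed

lemma sq_square: "sq * sq = of_nat q"
  by (simp add: sqrtq_def rconst_of_nat rq_square flip: rconst_mult)

lemma sq_nonzero [simp]: "sq \<noteq> 0"
proof -
  have "rconst rq \<noteq> (rconst 0 :: 'r ratfun)"
    unfolding rconst_eq_iff using q by simp
  thus ?thesis by (simp add: sqrtq_def)
qed

lemma q_nonzero [simp]: "(of_nat q :: 'r ratfun) \<noteq> 0"
  using sq_square sq_nonzero by (metis mult_eq_0_iff)

lemma Xvar_nonzero [simp]: "Xvar i \<noteq> 0"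
proof
  assume "Xvar i = 0"
  hence "rat_subst (\<lambda>_. 1) (Xvar i) = rat_subst (\<lambda>_. 1) (rconst 0)" by simp
  thus False unfolding rat_subst_rconst rat_subst_Xvar by simp
qed

lemma y_nonzero [simp]: "y i \<noteq> 0"
  by (simp add: y_def)

lemma endo_sq: "field_endo h \<Longrightarrow> h sq = sq"
  by (simp add: sqrtq_def endo_rconst)

lemma field_endo_eqI_y:
  assumes "field_endo g" "field_endo h" "\<And>i. g (y i) = h (y i)"
  shows "g f = h f"
proof (rule field_endo_eqI[OF assms(1,2)])
  fix i
  have "sq * g (Xvar i) = sq * h (Xvar i)"
    using assms(3)[of i] by (simp add: y_def endo_mult assms endo_sq)
  thus "g (Xvar i) = h (Xvar i)" by simp
qed

definition S :: "'r \<Rightarrow> 'r ratfun \<Rightarrow> 'r ratfun" where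
  "S i = rat_subst (sigma_tuple \<alpha> q i Xvar)"

definition E :: "'r \<Rightarrow> 'r ratfun \<Rightarrow> 'r ratfun" where
  "E i = rat_subst (eps_tuple \<alpha> i Xvar)"

lemma not_adjacent_self [simp]: "\<not> adjacent \<alpha> i i"
  by (simp add: adjacent_def)

lemma endo_S: "field_endo (S i)"
  unfolding S_def
proof (rule field_endo_rat_subst_invertible)
  fix j
  let ?z = "sigma_tuple \<alpha> q i Xvar"
  have zi: "?z i = inverse (rconst (of_nat q) * Xvar i)"
    by (simp add: sigma_tuple_def rconst_of_nat divide_inverse)
  have inv: "regular_at ?z (?z i) \<and> rat_subst ?z (?z i) = Xvar i"
  proof -
    have r: "regular_at ?z (rconst (of_nat q) * Xvar i)"
      by (intro regular_at_mult) simp_all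
    have v: "rat_subst ?z (rconst (of_nat q) * Xvar i) = inverse (Xvar i)"
    proof -
      have "rat_subst ?z (rconst (of_nat q) * Xvar i) = rconst (of_nat q) * ?z i"
        by (simp add: rat_subst_mult)
      thus ?thesis by (simp add: zi rconst_of_nat)
    qed
    have nz: "rat_subst ?z (rconst (of_nat q) * Xvar i) \<noteq> 0" by (simp add: v)
    show ?thesis
      unfolding zi using regular_at_inverse[OF r nz] rat_subst_inverse[OF r nz]
      by (simp only: v inverse_inverse_eq simp_thms)
  qed
  consider "adjacent \<alpha> i j" | "j = i" | "\<not> adjacent \<alpha> i j" "j \<noteq> i" by blast
  hence "regular_at ?z (?z j) \<and> rat_subst ?z (?z j) = Xvar j"
  proof cases
    case 1
    have zj: "?z j = Xvar i * Xvar j * sq" using 1 by (simp add: sigma_tuple_def)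
    have "rat_subst ?z (?z j) = ?z i * ?z j * sq" "regular_at ?z (?z j)"
      unfolding zj
      by (simp_all add: rat_subst_mult regular_at_mult sqrtq_def zj)
    moreover have "?z i * ?z j * sq = Xvar j"
      using sq_square by (simp add: zi zj rconst_of_nat field_simps)
    ultimately show ?thesis by simp
  next
    case 2
    thus ?thesis using inv by simp
  next
    case 3
    hence "?z j = Xvar j" by (simp add: sigma_tuple_def)
    thus ?thesis by (metis rat_subst_Xvar regular_at_Xvar)
  qed
  thus "regular_at ?z (?z j)" "rat_subst ?z (?z j) = Xvar j" by auto
qed

lemma endo_E: "field_endo (E i)"
  unfolding E_def
proof (rule field_endo_rat_subst_invertible)
  fix j
  let ?z = "eps_tuple \<alpha> i Xvar"
  have "?z j = rconst (if adjacent \<alpha> i j then - 1 else 1) * Xvar j"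
    by (simp add: eps_tuple_def rconst_minus)
  thus "regular_at ?z (?z j)" "rat_subst ?z (?z j) = Xvar j"
    by (simp_all add: regular_at_mult rat_subst_mult)
      (simp_all add: rconst_minus)
qed

lemmas S_simps = endo_simps[OF endo_S] endo_sq[OF endo_S]
lemmas E_simps = endo_simps[OF endo_E] endo_sq[OF endo_E]

lemma S_Xvar: "S i (Xvar j) = sigma_tuple \<alpha> q i Xvar j"
  by (simp add: S_def)

lemma S_y: "S i (y j) = y j * y i powi (- cartan i j)"
proof -
  have "S i (y j) = sq * sigma_tuple \<alpha> q i Xvar j"
    by (simp add: y_def S_simps S_Xvar)
  also have "\<dots> = y j * y i powi (- cartan i j)"
    using sq_square
    by (auto simp: y_def cartan_def sigma_tuple_def power_int_minus field_simps power2_eq_square)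
  finally show ?thesis .
qed

lemma S_y_self: "S i (y i) = inverse (y i)"
  by (simp add: S_y cartan_def power_int_minus power2_eq_square)

lemma S_y_adjacent: "adjacent \<alpha> i j \<Longrightarrow> S i (y j) = y i * y j"
  by (auto simp: S_y cartan_def)

lemma E_y: "E i (y j) = (if adjacent \<alpha> i j then - y j else y j)"
  by (simp add: y_def E_simps) (simp add: E_def eps_tuple_def)

text \<open>The root lattice. Integrality of the coefficients alone would not do, since the functionals \<open>co i\<close>
  are defined outside the span of the roots as well.\<close>

definition lattice :: "'a set" where
  "lattice = {v. v = (\<Sum>i\<in>UNIV. co i v *\<^sub>R \<alpha> i) \<and> (\<forall>i. co i v \<in> \<int>)}"

lemma lattice_Ints: "v \<in> lattice \<Longrightarrow> co i v \<in> \<int>"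
  by (simp add: lattice_def)

lemma lattice_floor: "v \<in> lattice \<Longrightarrow> of_int \<lfloor>co i v\<rfloor> = co i v"
  using lattice_Ints[of v i] by (auto elim!: Ints_cases)

lemma root_lattice: "\<beta> \<in> \<Phi> \<Longrightarrow> \<beta> \<in> lattice"
  using root_expansion co_root_Ints unfolding lattice_def by blast

lemma lattice_add: "u \<in> lattice \<Longrightarrow> v \<in> lattice \<Longrightarrow> u + v \<in> lattice"
  by (auto simp: lattice_def co_add scaleR_add_left sum.distrib)

lemma lattice_minus: "v \<in> lattice \<Longrightarrow> - v \<in> lattice"
  by (auto simp: lattice_def co_minus sum_negf)

lemma lattice_scale: "v \<in> lattice \<Longrightarrow> of_int n *\<^sub>R v \<in> lattice"
  by (auto simp: lattice_def co_scale simp flip: scaleR_scaleR scaleR_sum_right)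

definition Y :: "'a \<Rightarrow> 'r ratfun" where
  "Y v = (\<Prod>i\<in>UNIV. y i powi \<lfloor>co i v\<rfloor>)"

lemma Y_0 [simp]: "Y 0 = 1"
  by (simp add: Y_def)

lemma Y_nonzero [simp]: "Y v \<noteq> 0"
  by (simp add: Y_def)

lemma Y_add: "u \<in> lattice \<Longrightarrow> v \<in> lattice \<Longrightarrow> Y (u + v) = Y u * Y v"
proof -
  assume "u \<in> lattice" "v \<in> lattice"
  hence "\<lfloor>co i (u + v)\<rfloor> = \<lfloor>co i u\<rfloor> + \<lfloor>co i v\<rfloor>" for i
    using lattice_Ints[of u i] by (auto simp: co_add elim!: Ints_cases)
  thus ?thesis by (simp add: Y_def power_int_add prod.distrib)
qed

lemma Y_minus: "v \<in> lattice \<Longrightarrow> Y (- v) = inverse (Y v)"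
  using Y_add[of v "- v"] lattice_minus[of v] by (simp add: field_simps)

lemma Y_simple: "Y (\<alpha> i) = y i"
proof -
  have "Y (\<alpha> i) = (\<Prod>j\<in>UNIV. if j = i then y j else 1)"
    unfolding Y_def by (intro prod.cong) (auto simp: co_simple)
  thus ?thesis by simp
qed

lemma refl_lattice:
  assumes "v \<in> lattice"
  shows "s i v = v - of_int (\<Sum>j\<in>UNIV. cartan i j * \<lfloor>co j v\<rfloor>) *\<^sub>R \<alpha> i"
proof -
  have "2 * (v \<bullet> \<alpha> i) / (\<alpha> i \<bullet> \<alpha> i)
      = 2 * ((\<Sum>j\<in>UNIV. co j v *\<^sub>R \<alpha> j) \<bullet> \<alpha> i) / (\<alpha> i \<bullet> \<alpha> i)"
    using assms by (simp add: lattice_def)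
  also have "\<dots> = (\<Sum>j\<in>UNIV. co j v * (2 * (\<alpha> j \<bullet> \<alpha> i) / (\<alpha> i \<bullet> \<alpha> i)))"
    by (simp add: inner_sum_left sum_distrib_left sum_divide_distrib mult.left_commute)
  also have "\<dots> = of_int (\<Sum>j\<in>UNIV. cartan i j * \<lfloor>co j v\<rfloor>)"
    unfolding cartan_simple
    by (simp only: of_int_sum of_int_mult lattice_floor[OF assms] mult.commute)
  finally show ?thesis by (simp add: root_refl_def)
qed

lemma lattice_refl:
  assumes "v \<in> lattice"
  shows "s i v \<in> lattice"
  unfolding refl_lattice[OF assms] diff_conv_add_uminus
  by (intro lattice_add[OF assms] lattice_minus lattice_scale root_lattice simple_root)

lemma S_Y:
  assumes "v \<in> lattice"
  shows "S i (Y v) = Y (s i v)"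
proof -
  define n where "n = (\<Sum>j\<in>UNIV. cartan i j * \<lfloor>co j v\<rfloor>)"
  have "S i (Y v) = (\<Prod>j\<in>UNIV. y j powi \<lfloor>co j v\<rfloor> * y i powi (- (cartan i j * \<lfloor>co j v\<rfloor>)))"
    by (simp add: Y_def S_simps S_y power_int_mult_distrib flip: power_int_mult)
  also have "\<dots> = Y v * (\<Prod>j\<in>UNIV. y i powi (- (cartan i j * \<lfloor>co j v\<rfloor>)))"
    by (simp add: Y_def prod.distrib)
  also have "(\<Prod>j\<in>A. y i powi (- (cartan i j * \<lfloor>co j v\<rfloor>)))
      = y i powi (- (\<Sum>j\<in>A. cartan i j * \<lfloor>co j v\<rfloor>))" for A
    by (induction A rule: infinite_finite_induct) 
      (simp_all add: power_int_diff power_int_minus divide_inverse)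
  finally have SY: "S i (Y v) = Y v * y i powi (- n)"
    by (simp add: n_def)
  have "co j (s i v) = co j v - (if j = i then of_int n else 0)" for j
    by (simp add: refl_lattice[OF assms] co_diff co_scale co_simple flip: n_def)
  hence fl: "\<lfloor>co j (s i v)\<rfloor> = \<lfloor>co j v\<rfloor> + (if j = i then - n else 0)" for j
    by simp
  have "Y (s i v) = Y v * (\<Prod>j\<in>UNIV. y j powi (if j = i then - n else 0))"
    by (simp only: Y_def fl power_int_add y_nonzero prod.distrib simp_thms)
  also have "(\<Prod>j\<in>UNIV. y j powi (if j = i then - n else 0))
      = (\<Prod>j\<in>UNIV. if j = i then y i powi (- n) else 1)"
    by (intro prod.cong) auto
  finally show ?thesis using SY by simp
qed

lemma E_Y: "E i (Y v) = Y v \<or> E i (Y v) = - Y v"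
proof -
  have "E i (\<Prod>j\<in>A. y j powi \<lfloor>co j v\<rfloor>) = (\<Prod>j\<in>A. y j powi \<lfloor>co j v\<rfloor>) \<or>
    E i (\<Prod>j\<in>A. y j powi \<lfloor>co j v\<rfloor>) = - (\<Prod>j\<in>A. y j powi \<lfloor>co j v\<rfloor>)" for A
    by (induction A rule: infinite_finite_induct)
      (auto simp: E_simps E_y power_int_minus_left)
  thus ?thesis by (simp add: Y_def)
qed

lemma E_Y_square: "E i ((Y v)\<^sup>2) = (Y v)\<^sup>2"
  using E_Y[of i v] by (auto simp: E_simps)

text \<open>Rescaling one variable multiplies a monomial by a power of the scaling factor, so a monomial
  that is constant has all exponents zero.\<close>

lemma monomial_not_constant:
  fixes k :: "'r \<Rightarrow> int"
  assumes "(\<Prod>i\<in>UNIV. Xvar i powi k i) = rconst c"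
  shows "k j = 0"
proof -
  define z :: "'r \<Rightarrow> 'r ratfun" where "z = (\<lambda>i. rconst (if i = j then 2 else 1) * Xvar i)"
  define z' :: "'r \<Rightarrow> 'r ratfun" where "z' = (\<lambda>i. rconst (if i = j then inverse 2 else 1) * Xvar i)"
  have z: "field_endo (rat_subst z)"
  proof (rule field_endo_rat_subst_invertible[of z'])
    fix i
    show "regular_at z' (z i)"
      unfolding z_def by (intro regular_at_mult) simp_all
    show "rat_subst z' (z i) = Xvar i"
      unfolding z_def by (subst rat_subst_mult) (simp_all add: z'_def flip: rconst_mult mult.assoc)
  qed
  have zX: "rat_subst z (Xvar i) = rconst (if i = j then 2 else 1) * Xvar i" for i
    by (simp add: z_def)
  have "(\<Prod>i\<in>UNIV. rconst (if i = j then 2 else 1) powi k i) =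
      (\<Prod>i\<in>UNIV. if i = j then rconst (2 powi k j) else (1 :: 'r ratfun))"
    by (intro prod.cong) (auto simp: rconst_powi)
  also have "\<dots> = rconst (2 powi k j)" by simp
  finally have two: "(\<Prod>i\<in>UNIV. rconst (if i = j then 2 else 1) powi k i)
    = (rconst (2 powi k j) :: 'r ratfun)" .
  have "rat_subst z (\<Prod>i\<in>UNIV. Xvar i powi k i) =
      (\<Prod>i\<in>UNIV. rconst (if i = j then 2 else 1) powi k i) * (\<Prod>i\<in>UNIV. Xvar i powi k i)"
    by (simp add: endo_prod[OF z] endo_powi[OF z] zX power_int_mult_distrib prod.distrib
        del: rat_subst_Xvar)
  hence "rconst c = rconst (2 powi k j) * (rconst c :: 'r ratfun)"
    using two by (simp add: assms)
  moreover have "rconst c \<noteq> (0 :: 'r ratfun)"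
    unfolding assms[symmetric] by simp
  ultimately have "(rconst (2 powi k j) :: 'r ratfun) = rconst 1" by simp
  hence "(2 :: complex) powi k j = 1" unfolding rconst_eq_iff .
  hence "(2 :: real) powi k j = 1"
    by (metis norm_numeral norm_one norm_power_int)
  thus ?thesis
    using power_int_strict_increasing[of 0 "k j" "2::real"]
      power_int_strict_increasing[of "k j" 0 "2::real"] by (cases "k j" "0 :: int" rule: linorder_cases) auto
qed

lemma Y_Xvar: "Y v = rconst (\<Prod>i\<in>UNIV. rq powi \<lfloor>co i v\<rfloor>) * (\<Prod>i\<in>UNIV. Xvar i powi \<lfloor>co i v\<rfloor>)"
proof -
  have "(rconst (\<Prod>i\<in>A. f i) :: 'r ratfun) = (\<Prod>i\<in>A. rconst (f i))"
    for f :: "'r \<Rightarrow> complex" and A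
    by (induction A rule: infinite_finite_induct) (simp_all add: rconst_mult)
  thus ?thesis
    by (simp add: Y_def y_def sqrtq_def power_int_mult_distrib prod.distrib rconst_powi)
qed

lemma Y_not_constant:
  assumes "v \<in> lattice" "Y v = rconst c"
  shows "v = 0"
proof -
  define d where "d = (\<Prod>i\<in>UNIV. rq powi \<lfloor>co i v\<rfloor>)"
  have d: "d \<noteq> 0" using q by (simp add: d_def)
  have "(\<Prod>i\<in>UNIV. Xvar i powi \<lfloor>co i v\<rfloor>) = rconst (inverse d) * Y v"
    unfolding Y_Xvar d_def[symmetric] mult.assoc[symmetric] rconst_mult[symmetric]
    using d by simp
  also have "\<dots> = rconst (inverse d * c)" by (simp add: assms rconst_mult)
  finally have "\<lfloor>co j v\<rfloor> = 0" for j by (rule monomial_not_constant)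
  hence "co j v = 0" for j using lattice_floor[OF assms(1), of j] by simp
  thus ?thesis using assms(1) by (simp add: lattice_def)
qed

section \<open>The normalised Weyl group action\<close>

lemma S_involution: "S i (S i f) = f"
proof (rule field_endo_eqI_y[OF field_endo_comp[OF endo_S endo_S] field_endo_id])
  fix j show "S i (S i (y j)) = y j"
    using S_Y[of "\<alpha> j" i] S_Y[of "s i (\<alpha> j)" i]
    by (simp add: Y_simple root_lattice lattice_refl root_refl_involution)
qed

lemma S_commute: "\<not> adjacent \<alpha> i j \<Longrightarrow> S i (S j f) = S j (S i f)"
proof (rule field_endo_eqI_y[OF field_endo_comp[OF endo_S endo_S] field_endo_comp[OF endo_S endo_S]])
  fix k assume "\<not> adjacent \<alpha> i j"
  thus "S i (S j (y k)) = S j (S i (y k))"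
    by (simp add: Y_simple[symmetric] S_Y root_lattice lattice_refl simple_commute[of i j "\<alpha> k"])
qed

lemma S_braid: "adjacent \<alpha> i j \<Longrightarrow> S i (S j (S i f)) = S j (S i (S j f))"
proof (rule field_endo_eqI_y[OF field_endo_comp[OF endo_S field_endo_comp[OF endo_S endo_S]]
      field_endo_comp[OF endo_S field_endo_comp[OF endo_S endo_S]]])
  fix k assume "adjacent \<alpha> i j"
  thus "S i (S j (S i (y k))) = S j (S i (S j (y k)))"
    by (simp add: Y_simple[symmetric] S_Y root_lattice lattice_refl simple_braid[of i j "\<alpha> k"])
qed

lemma E_involution: "E i (E i f) = f"
  by (rule field_endo_eqI_y[OF field_endo_comp[OF endo_E endo_E] field_endo_id])
    (simp add: E_y E_simps)

lemma E_commute: "E i (E j f) = E j (E i f)"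
  by (rule field_endo_eqI_y[OF field_endo_comp[OF endo_E endo_E] field_endo_comp[OF endo_E endo_E]])
    (simp add: E_y E_simps)

text \<open>How reflections and sign changes commute: conjugating the sign change \<open>E\<^sub>j\<close>, which belongs to the
  class of \<open>\<alpha>\<^sub>j\<close> modulo twice the root lattice, by \<open>S\<^sub>i\<close> gives the one of \<open>s\<^sub>i \<alpha>\<^sub>j\<close>.\<close>

lemma E_S_orthogonal: "\<not> adjacent \<alpha> i j \<Longrightarrow> E j (S i f) = S i (E j f)"
  by (rule field_endo_eqI_y[OF field_endo_comp[OF endo_E endo_S] field_endo_comp[OF endo_S endo_E]])
    (use adjacent_sym[of i j] in \<open>auto simp: S_y E_y E_simps S_simps\<close>)

lemma E_S_adjacent: "adjacent \<alpha> i j \<Longrightarrow> E j (S i f) = S i (E i (E j f))"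
  by (rule field_endo_eqI_y[OF field_endo_comp[OF endo_E endo_S]
        field_endo_comp[OF endo_S field_endo_comp[OF endo_E endo_E]]])
    (use adjacent_sym[of i j] in
      \<open>auto simp: S_y E_y E_simps S_simps cartan_def power_int_minus_left\<close>)

lemma E_S_same: "E i (S i f) = S i (E i f)"
  by (rule E_S_orthogonal) simp

definition par :: "'r \<Rightarrow> 'r ratfun" where "par i = (- 1) ^ l i"

lemma par_square: "par i * par i = 1" "par i * (par i * f) = f"
proof -
  show 1: "par i * par i = 1" by (simp add: par_def flip: power_mult_distrib)
  show "par i * (par i * f) = f" by (simp add: 1 flip: mult.assoc)
qed

lemma h_par: "field_endo h \<Longrightarrow> h (par i) = par i"
  by (simp add: par_def endo_simps)

text \<open>The coefficient that goes with \<open>f\<^sup>+\<close>. It is \<open>- 1\<close> at \<open>x = 1\<close> and \<open>1\<close> at \<open>x = - 1\<close>, and its value at \<open>1 / x\<close>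
  is the inverse of its value at \<open>x\<close>.\<close>

definition weight :: "'r ratfun \<Rightarrow> 'r ratfun" where
  "weight x = (1 - sq * x) / (sq - x)"

lemma h_weight: "field_endo h \<Longrightarrow> h (weight x) = weight (h x)"
  by (simp add: weight_def endo_simps endo_sq)

text \<open>The slash operator, conjugated by \<open>\<Delta>\<close>. This absorbs the factor \<open>j(w,x)\<close> and removes the pole at
  \<open>y\<^sub>i = 0\<close> from the coefficients.\<close>

definition T :: "'r \<Rightarrow> 'r ratfun \<Rightarrow> 'r ratfun" where
  "T i f = y i ^ (1 + l i) * (weight (y i) * S i (f_plus \<alpha> l i f) - S i (f_minus \<alpha> l i f))"

lemma f_plus_E: "f_plus \<alpha> l i f = (f + par i * E i f) / 2"
  and f_minus_E: "f_minus \<alpha> l i f = (f - par i * E i f) / 2"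
  by (simp_all add: f_plus_def f_minus_def par_def E_def)

lemma slash_T: "slash_simple \<alpha> q l i f = - inverse (y i ^ 2) * T i f"
proof -
  have y: "Xvar i = y i / sq" by (simp add: y_def)
  have "sq - y i \<noteq> 0"
    using Y_not_constant[of "\<alpha> i" "rq"] by (auto simp: Y_simple root_lattice sqrtq_def)
  hence w: "(1 - of_nat q * Xvar i) / (of_nat q * Xvar i * (1 - Xvar i)) = weight (y i) / y i"
    by (simp add: y weight_def flip: sq_square) (simp add: field_simps)
  have "Xvar i * sqrtq q = y i" by (simp add: y_def)
  thus ?thesis
    unfolding slash_simple_def T_def w S_def[symmetric]
    by (simp add: field_simps power2_eq_square)
qed

text \<open>\<open>(weight x - 1) / 2\<close> and \<open>(weight x + 1) / 2\<close> in factored form: the coefficients of \<open>f(\<sigma>\<^sub>i x)\<close> and, up to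
  the sign \<open>(- 1)\<^bsup>l\<^sub>i\<^esup>\<close>, of \<open>f(\<epsilon>\<^sub>i \<sigma>\<^sub>i x)\<close>. At \<open>x = 1\<close> they are \<open>- 1\<close> and \<open>0\<close>, at \<open>x = - 1\<close> they are \<open>0\<close> and \<open>1\<close>.\<close>

definition P :: "'r ratfun \<Rightarrow> 'r ratfun" where "P x = (1 - sq) * (1 + x) / (2 * (sq - x))"
definition M :: "'r ratfun \<Rightarrow> 'r ratfun" where "M x = (1 + sq) * (1 - x) / (2 * (sq - x))"

lemma h_P: "field_endo h \<Longrightarrow> h (P x) = P (h x)"
  and h_M: "field_endo h \<Longrightarrow> h (M x) = M (h x)"
  by (simp_all add: P_def M_def endo_simps endo_sq)

lemma sq_not_monomial:
  assumes "\<beta> \<in> \<Phi>"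
  shows "sq - Y \<beta> \<noteq> 0" "sq + Y \<beta> \<noteq> 0"
proof -
  have "Y \<beta> \<noteq> rconst c" for c
    using Y_not_constant[OF root_lattice[OF assms], of c] root_nonzero[OF assms] by blast
  from this[of rq] this[of "- rq"] show "sq - Y \<beta> \<noteq> 0" "sq + Y \<beta> \<noteq> 0"
    by (auto simp: sqrtq_def rconst_minus eq_neg_iff_add_eq_0 add.commute)
qed

lemma sq_minus_y: "sq - y i \<noteq> 0" "sq + y i \<noteq> 0"
  using sq_not_monomial[of "\<alpha> i"] by (simp_all add: Y_simple)

lemma T_expand:
  "T i f = y i ^ (1 + l i) * (P (y i) * S i f + par i * M (y i) * S i (E i f))"
proof -
  have PM: "P (y i) = (weight (y i) - 1) / 2" "M (y i) = (weight (y i) + 1) / 2"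
    using sq_minus_y(1)[of i] unfolding P_def M_def weight_def
    by (simp_all add: field_simps)
  have eq: "weight (y i) * S i (f_plus \<alpha> l i f) - S i (f_minus \<alpha> l i f) =
    (weight (y i) - 1) / 2 * S i f + par i * ((weight (y i) + 1) / 2) * S i (E i f)"
    by (simp add: f_plus_E f_minus_E S_simps h_par[OF endo_S] diff_divide_distrib add_divide_distrib
        algebra_simps)
  show ?thesis unfolding T_def eq PM ..
qed

text \<open>On the eigenspaces of \<open>E\<^sub>i\<close> the square of \<open>T\<^sub>i\<close> is multiplication by \<open>weight y\<^sub>i \<cdot> weight (1 / y\<^sub>i) = 1\<close> and by \<open>1\<close>.\<close>

lemma T_involution: "T i (T i f) = f"
proof -
  define F where "F = f_plus \<alpha> l i f"
  define G where "G = f_minus \<alpha> l i f"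
  have eigen: "E i F = par i * F" "E i G = - par i * G"
    by (simp_all add: F_def G_def f_plus_E f_minus_E E_simps E_involution h_par[OF endo_E]
        par_square diff_divide_distrib add_divide_distrib algebra_simps)
  have FG: "f = F + G" by (simp add: F_def G_def f_plus_E f_minus_E flip: add_divide_distrib)
  have w: "weight (y i) * weight (inverse (y i)) = 1"
  proof -
    have "sq * y i - 1 \<noteq> 0"
    proof
      assume "sq * y i - 1 = 0"
      hence "sq * y i = 1" by simp
      hence "y i = inverse sq" by (metis inverse_unique)
      hence "Y (\<alpha> i) = rconst (inverse rq)"
        by (simp only: Y_simple rconst_inverse sqrtq_def)
      thus False using Y_not_constant[of "\<alpha> i"] by (simp add: root_lattice)
    qed
    moreover have "weight (inverse (y i)) = (y i - sq) / (sq * y i - 1)"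
    proof -
      have "weight (inverse (y i)) = (1 - sq * inverse (y i)) * y i / ((sq - inverse (y i)) * y i)"
        unfolding weight_def by simp
      also have "\<dots> = (y i - sq) / (sq * y i - 1)"
        by (simp add: left_diff_distrib)
      finally show ?thesis .
    qed
    moreover have "weight (y i) = (sq * y i - 1) / (y i - sq)"
      unfolding weight_def by (metis minus_diff_eq minus_divide_divide)
    ultimately show ?thesis
      using sq_minus_y(1)[of i] by simp
  qed
  define g where "g = T i f"
  have g: "g = y i ^ (1 + l i) * (weight (y i) * S i F - S i G)"
    by (simp add: g_def T_def F_def G_def)
  have Eg: "E i g = par i * (y i ^ (1 + l i) * (weight (y i) * S i F + S i G))"
    by (simp add: g E_simps E_y h_weight[OF endo_E] E_S_same eigen S_simps h_par[OF endo_S]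
        algebra_simps)
  have "f_plus \<alpha> l i g = y i ^ (1 + l i) * (weight (y i) * S i F)"
    "f_minus \<alpha> l i g = - (y i ^ (1 + l i) * S i G)"
    unfolding f_plus_E f_minus_E Eg par_square
    by (simp_all add: g algebra_simps)
  hence "T i g = y i ^ (1 + l i) * inverse (y i) ^ (1 + l i) *
      (weight (y i) * weight (inverse (y i)) * F + G)"
    by (simp add: T_def S_simps S_y_self h_weight[OF endo_S] S_involution algebra_simps)
  also have "y i ^ (1 + l i) * inverse (y i) ^ (1 + l i) = 1"
    by (simp only: power_inverse right_inverse power_not_zero y_nonzero not_False_eq_True)
  also have "1 * (weight (y i) * weight (inverse (y i)) * F + G) = f"
    by (simp add: w FG)
  finally show ?thesis by (simp add: g_def)
qed

lemma T_commute:
  assumes "i \<noteq> j" "\<not> adjacent \<alpha> i j"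
  shows "T i (T j f) = T j (T i f)"
proof -
  have ji: "\<not> adjacent \<alpha> j i" using assms(2) adjacent_sym by blast
  have y: "S i (y j) = y j" "S j (y i) = y i" "E i (y j) = y j" "E j (y i) = y i"
    using assms ji by (simp_all add: S_y cartan_def E_y)
  show ?thesis
    by (simp add: T_expand S_simps E_simps h_P[OF endo_S] h_M[OF endo_S] h_P[OF endo_E]
        h_M[OF endo_E] h_par[OF endo_S] h_par[OF endo_E] y S_commute[OF assms(2)]
        E_S_orthogonal[OF assms(2)] E_S_orthogonal[OF ji] E_commute[of i j] algebra_simps)
qed

text \<open>Both sides of the braid relation expand into the four functions \<open>f(\<epsilon> s\<^sub>i s\<^sub>j s\<^sub>i x)\<close> with \<open>\<epsilon>\<close> in the
  group generated by \<open>E\<^sub>i\<close> and \<open>E\<^sub>j\<close>.\<close>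

lemma T_triple:
  assumes ij: "adjacent \<alpha> i j"
  defines "a \<equiv> y i" and "b \<equiv> y j" and "Z \<equiv> \<lambda>g. S i (S j (S i g))"
  shows "T i (T j (T i f)) = (a * b) ^ (2 + l i + l j) *
    ((P a * P (a * b) * P b - M a * M (- (a * b)) * M b) * Z f +
     par i * (P a * P (a * b) * M b - M a * M (- (a * b)) * P b) * Z (E i f) +
     par j * (M a * P (- (a * b)) * P (- b) - P a * M (a * b) * M (- b)) * Z (E j f) +
     par i * par j * (M a * P (- (a * b)) * M (- b) - P a * M (a * b) * P (- b)) * Z (E i (E j f)))"
proof -
  have ji: "adjacent \<alpha> j i" using ij adjacent_sym by blast
  note h = S_simps E_simps h_P[OF endo_S] h_M[OF endo_S] h_P[OF endo_E] h_M[OF endo_E]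
    h_par[OF endo_S] h_par[OF endo_E]
  have sgn: "(- x) ^ (1 + l k) = - par k * x ^ (1 + l k)" for x k
    by (simp add: par_def power_minus[of x])
  have yv: "S i a = inverse a" "S i b = a * b" "S j a = a * b" "S j b = inverse b"
    "E i a = a" "E i b = - b" "E j a = - a" "E j b = b"
    using ij ji by (simp_all add: a_def b_def S_y_self S_y_adjacent E_y mult.commute)
  have T1: "T i f = a ^ (1 + l i) * (P a * S i f + par i * M a * S i (E i f))"
    unfolding T_expand a_def ..
  have ES1: "E j (S i g) = S i (E i (E j g))" "E i (S j g) = S j (E i (E j g))" for g
    using E_S_adjacent[OF ij, of g] E_S_adjacent[OF ji, of g] E_commute[of i j g] by simp_all
  have Sj: "S j (T i f) = (a * b) ^ (1 + l i) *
      (P (a * b) * S j (S i f) + par i * M (a * b) * S j (S i (E i f)))"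
    unfolding T1 by (simp only: h yv)
  have SEj: "S j (E j (T i f)) = - par i * (a * b) ^ (1 + l i) *
      (P (- (a * b)) * S j (S i (E i (E j f))) + par i * M (- (a * b)) * S j (S i (E j f)))"
    unfolding T1 by (simp only: h yv ES1 sgn E_commute[of j i] E_involution)
  have collect: "c * (p * X + m * X') = c * u * (p * G + m * (r * H))"
    if "X = u * G" "X' = r * u * H" for c p X m X' u G r H :: "'r ratfun"
    using that by (simp add: algebra_simps)
  define g where "g = T j (T i f)"
  have g: "g = a ^ (1 + l i) * b ^ (2 + l i + l j) *
    (P b * P (a * b) * S j (S i f) + par i * P b * M (a * b) * S j (S i (E i f))
     - par i * par j * M b * P (- (a * b)) * S j (S i (E i (E j f)))
     - par j * M b * M (- (a * b)) * S j (S i (E j f)))"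
    unfolding g_def T_expand[of j] b_def[symmetric] Sj SEj
    by (simp add: power_mult_distrib power_add algebra_simps par_square)
  have ESS: "E i (S j (S i g)) = S j (S i (E j g))" for g
    by (simp add: ES1 E_S_same E_involution)
  have sgn2: "(- x) ^ (l i + l j) = par i * par j * x ^ (l i + l j)" for x
    by (simp add: par_def power_minus[of x] power_add)
  have Eg: "E i g = par i * par j * a ^ (1 + l i) * b ^ (2 + l i + l j) *
    (P (- b) * P (- (a * b)) * S j (S i (E j f))
     + par i * P (- b) * M (- (a * b)) * S j (S i (E i (E j f)))
     - par i * par j * M (- b) * P (a * b) * S j (S i (E i f))
     - par j * M (- b) * M (a * b) * S j (S i f))"
    unfolding g by (simp add: h yv ESS sgn2 E_commute[of j i] E_involution algebra_simps)
  have "a \<noteq> 0" by (simp add: a_def)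
  hence ab: "inverse a * (a * b) = b" "inverse a * - (a * b) = - b" by simp_all
  have cancel: "a ^ (1 + l i) * (inverse a ^ (1 + l i) * (a * b) ^ (2 + l i + l j)) =
      (a * b) ^ (2 + l i + l j)"
  proof -
    have "a ^ k * (inverse a ^ k * x) = x" for k x
      using \<open>a \<noteq> 0\<close> by (simp add: power_inverse)
    thus ?thesis .
  qed
  have "T i g = (a * b) ^ (2 + l i + l j) * (P a *
      (P (a*b) * P b * Z f + par i * P (a * b) * M b * Z (E i f)
     - par i * par j * M (a * b) * P (- b) * Z (E i (E j f))
     - par j * M (a * b) * M (- b) * Z (E j f)) +
      par i * M a * (par i * par j * (P (- (a * b)) * P (- b) * Z (E j f)
     + par i * P (- (a * b)) * M (- b) * Z (E i (E j f))
     - par i * par j * M (- (a * b)) * P b * Z (E i f)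
     - par j * M (- (a * b)) * M b * Z f)))"
  proof -
    have "S i g = inverse a ^ (1 + l i) * (a * b) ^ (2 + l i + l j) *
      (P (a * b) * P b * Z f + par i * P (a * b) * M b * Z (E i f)
       - par i * par j * M (a * b) * P (- b) * Z (E i (E j f))
       - par j * M (a * b) * M (- b) * Z (E j f))"
      unfolding g by (simp only: h yv ab Z_def)
    moreover have "S i (E i g) =
      par i * par j * (inverse a ^ (1 + l i) * (a * b) ^ (2 + l i + l j)) *
      (P (- (a * b)) * P (- b) * Z (E j f)
       + par i * P (- (a * b)) * M (- b) * Z (E i (E j f))
       - par i * par j * M (- (a * b)) * P b * Z (E i f)
       - par j * M (- (a * b)) * M b * Z f)"
      unfolding Eg by (simp only: h yv ab Z_def mult.assoc)
    ultimately have "a ^ (1 + l i) * (P a * S i g + par i * M a * S i (E i g)) =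
      a ^ (1 + l i) * (inverse a ^ (1 + l i) * (a * b) ^ (2 + l i + l j)) *
      (P a * (P (a * b) * P b * Z f + par i * P (a * b) * M b * Z (E i f)
       - par i * par j * M (a * b) * P (- b) * Z (E i (E j f))
       - par j * M (a * b) * M (- b) * Z (E j f)) +
      par i * M a * (par i * par j * (P (- (a * b)) * P (- b) * Z (E j f)
       + par i * P (- (a * b)) * M (- b) * Z (E i (E j f))
       - par i * par j * M (- (a * b)) * P b * Z (E i f)
       - par j * M (- (a * b)) * M b * Z f)))"
      by (rule collect)
    thus ?thesis unfolding T_expand[of i g] a_def[symmetric] cancel .
  qed
  thus ?thesis
    unfolding g_def by (simp add: algebra_simps par_square)
qed

text \<open>The coefficients in the braid relation depend on the parameters only through the two identities
  below; the exponents \<open>l\<close> contribute a common monomial and signs.\<close>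

lemma braid_identities:
  assumes "sq - a \<noteq> 0" "sq + a \<noteq> 0" "sq - b \<noteq> 0" "sq + b \<noteq> 0" "sq - a * b \<noteq> 0" "sq + a * b \<noteq> 0"
  shows "P a * P (a * b) * M b - M a * M (- (a * b)) * P b =
      M b * P (- (a * b)) * P (- a) - P b * M (a * b) * M (- a)" (is ?I)
    and "M a * P (- (a * b)) * M (- b) - P a * M (a * b) * P (- b) =
      M b * P (- (a * b)) * M (- a) - P b * M (a * b) * P (- a)" (is ?J)
proof -
  define A A' B B' C C' where "A = 2 * (sq - a)" and "A' = 2 * (sq + a)"
    and "B = 2 * (sq - b)" and "B' = 2 * (sq + b)"
    and "C = 2 * (sq - a * b)" and "C' = 2 * (sq + a * b)"
  note defs = this
  have PM: "P a = (1 - sq) * (1 + a) / A" "P (- a) = (1 - sq) * (1 - a) / A'"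
    "P b = (1 - sq) * (1 + b) / B" "P (- b) = (1 - sq) * (1 - b) / B'"
    "P (a * b) = (1 - sq) * (1 + a * b) / C" "P (- (a * b)) = (1 - sq) * (1 - a * b) / C'"
    "M a = (1 + sq) * (1 - a) / A" "M (- a) = (1 + sq) * (1 + a) / A'"
    "M b = (1 + sq) * (1 - b) / B" "M (- b) = (1 + sq) * (1 + b) / B'"
    "M (a * b) = (1 + sq) * (1 - a * b) / C" "M (- (a * b)) = (1 + sq) * (1 + a * b) / C'"
    unfolding P_def M_def defs by simp_all
  have nz: "A \<noteq> 0" "A' \<noteq> 0" "B \<noteq> 0" "B' \<noteq> 0" "C \<noteq> 0" "C' \<noteq> 0"
    unfolding defs
    by (simp_all only: mult_eq_0_iff two_ne_0_ratfun assms simp_thms)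
  \<comment> \<open>cross-multiplication, carried out once so that only polynomial identities remain\<close>
  have clear_I: "x / (A * C * B) - y / (A * C' * B) = z / (B * C' * A') - k / (B * C * A')"
    if "x * (C' * A') - y * (C * A') = z * (A * C) - k * (A * C')" for x y z k
  proof -
    define N where "N = A * A' * B * C * C'"
    have "x / (A * C * B) = x * (C' * A') / N" "y / (A * C' * B) = y * (C * A') / N"
      "z / (B * C' * A') = z * (A * C) / N" "k / (B * C * A') = k * (A * C') / N"
      using nz by (auto simp only: N_def frac_eq_eq mult_eq_0_iff mult_ac simp_thms)
    thus ?thesis by (simp only: that flip: diff_divide_distrib)
  qed
  have clear_J: "x / (A * C' * B') - y / (A * C * B') = z / (B * C' * A') - k / (B * C * A')"
    if "x * (C * B * A') - y * (C' * B * A') = z * (A * C * B') - k * (A * C' * B')" for x y z k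
  proof -
    define N where "N = A * A' * B * B' * C * C'"
    have "x / (A * C' * B') = x * (C * B * A') / N" "y / (A * C * B') = y * (C' * B * A') / N"
      "z / (B * C' * A') = z * (A * C * B') / N" "k / (B * C * A') = k * (A * C' * B') / N"
      using nz by (auto simp only: N_def frac_eq_eq mult_eq_0_iff mult_ac simp_thms)
    thus ?thesis by (simp only: that flip: diff_divide_distrib)
  qed
  show ?I
    unfolding PM times_divide_times_eq
    by (rule clear_I) (unfold defs, algebra)
  show ?J
    unfolding PM times_divide_times_eq
    by (rule clear_J) (unfold defs, algebra)
qed

lemma T_braid:
  assumes ij: "adjacent \<alpha> i j"
  shows "T i (T j (T i f)) = T j (T i (T j f))"
proof -
  have ji: "adjacent \<alpha> j i" using ij adjacent_sym by blast
  have "s i (\<alpha> j) = \<alpha> i + \<alpha> j"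
    using ij by (auto simp: refl_simple cartan_def)
  hence "\<alpha> i + \<alpha> j \<in> \<Phi>"
    using root_refl_root[of "\<alpha> i" "\<alpha> j"] by simp
  hence "sq - y i * y j \<noteq> 0" "sq + y i * y j \<noteq> 0"
    using sq_not_monomial[of "\<alpha> i + \<alpha> j"]
    by (simp_all add: Y_add root_lattice Y_simple)
  note nz = sq_minus_y[of i] sq_minus_y[of j] this
  note I = braid_identities[of "y i" "y j", OF nz]
  have I': "M (y i) * P (- (y i * y j)) * P (- y j) - P (y i) * M (y i * y j) * M (- y j) =
      P (y j) * P (y i * y j) * M (y i) - M (y j) * M (- (y i * y j)) * P (y i)"
    using braid_identities(1)[of "y j" "y i"] nz by (simp add: mult.commute)
  show ?thesis
    unfolding T_triple[OF ij] T_triple[OF ji] S_braid[OF ji] E_commute[of j i]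
      mult.commute[of "y j" "y i"] add.assoc add.commute[of "l j" "l i"] I I'
    by (simp add: algebra_simps)
qed

section \<open>The series as a sum over the orbit of the constant function\<close>

lemma endo_fold_S: "field_endo (fold S is)"
proof (induction "is" rule: rev_induct)
  case Nil
  show ?case using field_endo_id by (simp add: id_def)
next
  case (snoc i "is")
  thus ?case using field_endo_comp[OF endo_S snoc, of i] by (simp add: o_def)
qed

lemma foldr_sigma_tuple:
  "foldr (sigma_tuple \<alpha> q) is Xvar = (\<lambda>j. fold S is (Xvar j))"
proof (induction "is" rule: rev_induct)
  case (snoc i "is")
  have step: "sigma_tuple \<alpha> q k (\<lambda>j. S i (z j)) = (\<lambda>j. S i (sigma_tuple \<alpha> q k z j))" for k z
    by (auto simp: sigma_tuple_def fun_eq_iff S_simps)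
  have "foldr (sigma_tuple \<alpha> q) js (\<lambda>j. S i (z j)) = (\<lambda>j. S i (foldr (sigma_tuple \<alpha> q) js z j))" for js z
    by (induction js) (simp_all add: step)
  from this[of "is" Xvar] show ?case
    by (simp add: snoc S_Xvar fun_eq_iff)
qed simp

lemma root_coeffs_eq:
  assumes "v \<in> lattice"
  shows "root_coeffs \<alpha> v = (\<lambda>i. \<lfloor>co i v\<rfloor>)"
  unfolding root_coeffs_def
proof (rule the_equality)
  show "v = (\<Sum>i\<in>UNIV. of_int \<lfloor>co i v\<rfloor> *\<^sub>R \<alpha> i)"
    using assms unfolding lattice_floor[OF assms] lattice_def by blast
next
  fix k :: "'r \<Rightarrow> int" assume "v = (\<Sum>i\<in>UNIV. of_int (k i) *\<^sub>R \<alpha> i)"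
  hence "co i v = of_int (k i)" for i by (simp add: co_comb)
  thus "k = (\<lambda>i. \<lfloor>co i v\<rfloor>)" by simp
qed

lemma sq_powi_even: "sq powi (2 * n) = of_nat q powi n"
  by (simp add: power_int_mult sq_square[unfolded power2_eq_square[symmetric]])

text \<open>The factors of \<open>\<Delta>\<close> and \<open>D\<close> in the coordinates \<open>y\<close>: the power of \<open>q\<close> with the height as exponent is exactly
  what turns \<open>x\<close> into \<open>y\<close>.\<close>

lemma Y_square_Xvar:
  assumes "\<beta> \<in> \<Phi>"
  shows "(Y \<beta>)\<^sup>2 = of_nat q powi ht \<alpha> \<beta> * xpow \<alpha> Xvar (2 *\<^sub>R \<beta>)"
proof -
  note L = root_lattice[OF assms]
  have L2: "2 *\<^sub>R \<beta> \<in> lattice" using lattice_scale[OF L, of 2] by simp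
  have "\<lfloor>co i (2 *\<^sub>R \<beta>)\<rfloor> = 2 * \<lfloor>co i \<beta>\<rfloor>" for i
  proof -
    obtain n where n: "co i \<beta> = of_int n" using lattice_Ints[OF L, of i] by (auto elim!: Ints_cases)
    have "co i (2 *\<^sub>R \<beta>) = of_int (2 * n)" by (simp add: co_scale n)
    thus ?thesis unfolding n floor_of_int by (simp only: floor_of_int)
  qed
  hence xp: "xpow \<alpha> Xvar (2 *\<^sub>R \<beta>) = (\<Prod>i\<in>UNIV. Xvar i powi (2 * \<lfloor>co i \<beta>\<rfloor>))"
    by (simp add: xpow_def root_coeffs_eq[OF L2])
  have "(\<Prod>i\<in>A. of_nat q powi k i) = (of_nat q :: 'r ratfun) powi (\<Sum>i\<in>A. k i)"
    for A and k :: "'r \<Rightarrow> int"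
    by (induction A rule: infinite_finite_induct) (simp_all add: power_int_add)
  hence qp: "of_nat q powi ht \<alpha> \<beta> = (\<Prod>i\<in>UNIV. sq powi (2 * \<lfloor>co i \<beta>\<rfloor>))"
    by (simp add: ht_def root_coeffs_eq[OF L] sq_powi_even)
  have "(Y \<beta>)\<^sup>2 = (\<Prod>i\<in>UNIV. y i powi (2 * \<lfloor>co i \<beta>\<rfloor>))"
  proof -
    have "x powi (2 * k) = (x powi k)\<^sup>2" for x :: "'r ratfun" and k
      by (simp add: mult.commute[of 2] power_int_mult)
    thus ?thesis by (simp add: Y_def prod_power_distrib)
  qed
  also have "\<dots> = (\<Prod>i\<in>UNIV. sq powi (2 * \<lfloor>co i \<beta>\<rfloor>)) * (\<Prod>i\<in>UNIV. Xvar i powi (2 * \<lfloor>co i \<beta>\<rfloor>))"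
    by (simp only: y_def power_int_mult_distrib prod.distrib)
  finally show ?thesis by (simp only: qp xp)
qed

definition Del :: "'r ratfun" where "Del = (\<Prod>\<beta>\<in>pos. 1 - (Y \<beta>)\<^sup>2)"

lemma Delta_endo:
  assumes "field_endo h"
  shows "Delta \<Phi> \<alpha> q (\<lambda>j. h (Xvar j)) = h Del"
proof -
  have "xpow \<alpha> (\<lambda>j. h (Xvar j)) v = h (xpow \<alpha> Xvar v)" for v
    by (simp add: xpow_def endo_simps[OF assms])
  thus ?thesis
    by (simp add: Delta_def Del_def Y_square_Xvar pos_root endo_simps[OF assms])
qed

lemma Delta_Xvar: "Delta \<Phi> \<alpha> q Xvar = Del"
  using Delta_endo[OF field_endo_id] by simp

lemma Y_square_not_constant:
  assumes "v \<in> lattice" "(Y v)\<^sup>2 = rconst c"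
  shows "v = 0"
proof -
  have "Y (v + v) = rconst c" using assms by (simp add: Y_add power2_eq_square)
  hence "v + v = 0" using Y_not_constant[OF lattice_add] assms(1) by blast
  thus ?thesis by (simp flip: scaleR_2)
qed

lemma Y_square_neq_1: "\<beta> \<in> \<Phi> \<Longrightarrow> (Y \<beta>)\<^sup>2 \<noteq> 1"
  using Y_square_not_constant[of \<beta> 1] root_lattice root_nonzero by auto

lemma Del_nonzero: "Del \<noteq> 0"
  using Y_square_neq_1 by (auto simp: Del_def finite_pos dest: pos_root)

lemma simple_refl_permutes: "bij_betw (s i) (pos - {\<alpha> i}) (pos - {\<alpha> i})"
proof (rule bij_betw_byWitness[where f' = "s i"])
  show "s i ` (pos - {\<alpha> i}) \<subseteq> pos - {\<alpha> i}"
  proof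
    fix \<gamma> assume "\<gamma> \<in> s i ` (pos - {\<alpha> i})"
    then obtain \<beta> where b: "\<beta> \<in> pos" "\<beta> \<noteq> \<alpha> i" "\<gamma> = s i \<beta>" by blast
    moreover have "\<gamma> \<noteq> \<alpha> i"
    proof
      assume "\<gamma> = \<alpha> i"
      hence "\<beta> = - \<alpha> i" using b(3) by (metis root_refl_involution root_refl_self simple_nonzero)
      thus False using b(1) pos_iff_uminus[of "\<alpha> i"] by simp
    qed
    ultimately show "\<gamma> \<in> pos - {\<alpha> i}" using simple_refl_pos by blast
  qed
  thus "s i ` (pos - {\<alpha> i}) \<subseteq> pos - {\<alpha> i}" .
qed (simp_all add: root_refl_involution)

lemma S_Del: "S i Del = - inverse ((y i)\<^sup>2) * Del"
proof -
  let ?F = "\<lambda>\<beta>. 1 - (Y \<beta>)\<^sup>2"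
  have SF: "S i (?F \<beta>) = ?F (s i \<beta>)" if "\<beta> \<in> \<Phi>" for \<beta>
    using that by (simp add: S_simps S_Y root_lattice)
  have split: "Del = ?F (\<alpha> i) * prod ?F (pos - {\<alpha> i})"
    unfolding Del_def by (rule prod.remove) (simp_all add: finite_pos)
  have "S i (prod ?F (pos - {\<alpha> i})) = (\<Prod>\<beta>\<in>pos - {\<alpha> i}. ?F (s i \<beta>))"
    by (simp add: S_simps(15) SF pos_root)
  also have "\<dots> = prod ?F (pos - {\<alpha> i})"
    by (rule prod.reindex_bij_betw[OF simple_refl_permutes])
  finally have "S i Del = ?F (s i (\<alpha> i)) * prod ?F (pos - {\<alpha> i})"
    unfolding split by (simp only: S_simps(2) SF[OF simple_root])
  also have "?F (s i (\<alpha> i)) = - inverse ((y i)\<^sup>2) * ?F (\<alpha> i)"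
    by (simp add: root_refl_self Y_minus root_lattice Y_simple field_simps)
  finally show ?thesis by (simp only: split mult.assoc)
qed

definition even_fun :: "'r ratfun \<Rightarrow> bool" where "even_fun f \<longleftrightarrow> (\<forall>j. E j f = f)"

lemma even_Del: "even_fun Del"
  unfolding even_fun_def Del_def E_simps(15) by (simp only: E_simps(5,7) E_Y_square simp_thms)

text \<open>Conjugation by \<open>S\<^sub>i\<close> turns a sign change into a product of sign changes.\<close>

lemma even_S: "even_fun f \<Longrightarrow> even_fun (S i f)"
  unfolding even_fun_def by (metis E_S_adjacent E_S_orthogonal)

lemma even_fold_S: "even_fun f \<Longrightarrow> even_fun (fold S is f)"
  by (induction "is" rule: rev_induct) (simp_all add: even_S)

lemma T_mult_even: "E i u = u \<Longrightarrow> T i (u * f) = S i u * T i f"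
  by (simp add: T_expand E_simps S_simps algebra_simps)

lemma T_add: "T i (f + g) = T i f + T i g"
  by (simp add: T_expand E_simps S_simps algebra_simps)

lemma T_0: "T i 0 = 0"
  by (simp add: T_expand E_simps S_simps)

lemma T_sum: "T i (sum u A) = (\<Sum>a\<in>A. T i (u a))"
  by (induction A rule: infinite_finite_induct) (simp_all add: T_add T_0)

text \<open>\<open>\<Delta>\<close> and all its images are even, so they pass through the decomposition into \<open>f\<^sup>+\<close> and \<open>f\<^sup>-\<close>, and the
  factor \<open>- y\<^sub>i\<^sup>2\<close> between slash operator and \<open>T\<^sub>i\<close> is \<open>\<Delta> / S\<^sub>i \<Delta>\<close>.\<close>

lemma fold_T_slash: "fold T is 1 = Del / fold S is Del * fold (slash_simple \<alpha> q l) is 1"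
proof (induction "is" rule: rev_induct)
  case Nil
  show ?case using Del_nonzero by simp
next
  case (snoc i "is")
  define z where "z = fold S is Del"
  define F where "F = fold (slash_simple \<alpha> q l) is 1"
  have "E i (Del / z) = Del / z"
    using even_Del even_fold_S[OF even_Del, of "is"] by (simp add: even_fun_def E_simps z_def)
  hence "T i (Del / z * F) = S i (Del / z) * T i F" by (rule T_mult_even)
  also have "\<dots> = Del / S i z * slash_simple \<alpha> q l i F"
    by (simp add: S_simps(9) S_Del slash_T field_simps)
  finally show ?case by (simp add: snoc z_def F_def)
qed

lemma fold_T_cong: "wprod is = wprod js \<Longrightarrow> fold T is f = fold T js f"
  using words_agree[where T = T] T_involution T_commute T_braid by blast

text \<open>The function \<open>\<Delta> f\<close>.\<close>

definition G :: "'r ratfun" where "G = (\<Sum>w\<in>weyl_group \<Phi>. fold T (word_of \<alpha> w) 1)"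

lemma N_fun_G: "N_fun \<Phi> \<alpha> q l = D_poly \<Phi> \<alpha> q * inverse Del * G"
proof -
  have "cocycle_j \<Phi> \<alpha> q w * slash \<alpha> q l w 1 = fold T (word_of \<alpha> w) 1" for w
    unfolding cocycle_j_def slash_def weyl_tuple_def foldr_sigma_tuple Delta_endo[OF endo_fold_S]
      Delta_Xvar fold_T_slash ..
  thus ?thesis
    by (simp add: N_fun_def f_inv_def Delta_Xvar G_def)
qed

text \<open>\<open>T\<^sub>i\<close> takes the summand of \<open>w\<close> to that of \<open>w s\<^sub>i\<close>, by independence of the word, and right translation by
  \<open>s\<^sub>i\<close> permutes the Weyl group.\<close>

lemma T_G: "T i G = G"
proof -
  have "T i (fold T (word_of \<alpha> w) 1) = fold T (word_of \<alpha> (w \<circ> s i)) 1"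
    if w: "w \<in> weyl_group \<Phi>" for w
  proof -
    have ws: "w \<circ> s i \<in> weyl_group \<Phi>"
      using weyl_group.step[OF w simple_root] .
    have "wprod (word_of \<alpha> w @ [i]) = wprod (word_of \<alpha> (w \<circ> s i))"
      unfolding word_of[OF ws] by (simp add: wprod_append word_of[OF w])
    hence "fold T (word_of \<alpha> w @ [i]) 1 = fold T (word_of \<alpha> (w \<circ> s i)) 1"
      by (rule fold_T_cong)
    thus ?thesis by simp
  qed
  hence "T i G = (\<Sum>w\<in>weyl_group \<Phi>. fold T (word_of \<alpha> (w \<circ> s i)) 1)"
    by (simp add: G_def T_sum)
  also have "\<dots> = G"
    unfolding G_def
  proof (rule sum.reindex_bij_betw)
    have "w \<circ> s i \<circ> s i = w" for w :: "'a \<Rightarrow> 'a"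
      by (simp add: fun_eq_iff root_refl_involution)
    thus "bij_betw (\<lambda>w. w \<circ> s i) (weyl_group \<Phi>) (weyl_group \<Phi>)"
      by (intro bij_betw_byWitness[where f' = "\<lambda>w. w \<circ> s i"])
        (auto intro: weyl_group.step)
  qed
  finally show ?thesis .
qed

section \<open>Denominators\<close>

text \<open>For the set of all positive roots this is \<open>D\<close> up to a constant.\<close>

definition Dn :: "'a set \<Rightarrow> 'r ratfun" where "Dn I = (\<Prod>\<beta>\<in>I. of_nat q - (Y \<beta>)\<^sup>2)"

lemma q_minus_Y_nonzero: "\<beta> \<in> \<Phi> \<Longrightarrow> of_nat q - (Y \<beta>)\<^sup>2 \<noteq> 0"
  using Y_square_not_constant[of \<beta> "of_nat q"] root_lattice root_nonzero
  by (auto simp: rconst_of_nat)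

lemma Dn_nonzero: "finite I \<Longrightarrow> I \<subseteq> \<Phi> \<Longrightarrow> Dn I \<noteq> 0"
  using q_minus_Y_nonzero by (auto simp: Dn_def)

lemma E_q_minus_Y: "E i (of_nat q - (Y \<beta>)\<^sup>2) = of_nat q - (Y \<beta>)\<^sup>2"
  unfolding E_simps(7) E_Y_square by (simp add: E_simps)

lemma E_Dn: "E i (Dn I) = Dn I"
  unfolding Dn_def by (simp only: E_simps(15) E_q_minus_Y)

lemma S_Dn: "I \<subseteq> \<Phi> \<Longrightarrow> S i (Dn I) = Dn (s i ` I)"
proof -
  assume I: "I \<subseteq> \<Phi>"
  have "inj_on (s i) I" by (metis inj_onI root_refl_involution)
  hence "Dn (s i ` I) = (\<Prod>\<beta>\<in>I. of_nat q - (Y (s i \<beta>))\<^sup>2)"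
    by (simp add: Dn_def prod.reindex)
  also have "\<dots> = (\<Prod>\<beta>\<in>I. S i (of_nat q - (Y \<beta>)\<^sup>2))"
    using I by (intro prod.cong) (auto simp: S_simps S_Y root_lattice)
  finally show ?thesis by (simp only: Dn_def S_simps(15))
qed

lemma y_in_Pol: "y i \<in> Pol"
  unfolding y_def sqrtq_def by (intro Pol_mult) simp_all

lemma Y_pos_nat: "\<beta> \<in> pos \<Longrightarrow> Y \<beta> = (\<Prod>i\<in>UNIV. y i ^ nat \<lfloor>co i \<beta>\<rfloor>)"
  unfolding Y_def by (intro prod.cong) (auto simp: power_int_def co_pos not_le[symmetric])

lemma Y_pos_in_Pol: "\<beta> \<in> pos \<Longrightarrow> Y \<beta> \<in> Pol"
  unfolding Y_pos_nat by (intro Pol_prod Pol_power y_in_Pol)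

definition inversions :: "'r list \<Rightarrow> 'a set" where
  "inversions is = {\<beta> \<in> pos. wprod is \<beta> \<notin> pos}"

lemma inversions_snoc:
  assumes "wprod is (\<alpha> i) \<in> pos"
  shows "inversions (is @ [i]) = insert (\<alpha> i) (s i ` inversions is)" "\<alpha> i \<notin> s i ` inversions is"
proof -
  have mem: "\<beta> \<in> s i ` A \<longleftrightarrow> s i \<beta> \<in> A" for \<beta> A
    by (metis image_iff root_refl_involution)
  have neg: "- \<alpha> i \<notin> pos" using pos_iff_uminus[of "\<alpha> i"] by simp
  show "inversions (is @ [i]) = insert (\<alpha> i) (s i ` inversions is)"
  proof (intro set_eqI)
    fix \<beta>
    show "\<beta> \<in> inversions (is @ [i]) \<longleftrightarrow> \<beta> \<in> insert (\<alpha> i) (s i ` inversions is)"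
    proof (cases "\<beta> = \<alpha> i")
      case True
      thus ?thesis
        using assms wprod_snoc_pos_iff[of "is" i] by (simp add: inversions_def)
    next
      case False
      have "s i \<beta> \<noteq> \<alpha> i \<or> \<beta> = - \<alpha> i"
        by (metis root_refl_involution root_refl_self simple_nonzero)
      hence "\<beta> \<in> pos \<longleftrightarrow> s i \<beta> \<in> pos" if "s i \<beta> \<noteq> \<alpha> i"
        using False that simple_refl_pos[of \<beta> i] simple_refl_pos[of "s i \<beta>" i]
        by (auto simp: root_refl_involution)
      moreover have "\<beta> \<notin> pos" "s i \<beta> \<notin> inversions is" if "s i \<beta> = \<alpha> i"
        using that assms neg \<open>s i \<beta> \<noteq> \<alpha> i \<or> \<beta> = - \<alpha> i\<close> by (auto simp: inversions_def)
      ultimately show ?thesis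
        using False by (cases "s i \<beta> = \<alpha> i") (auto simp: inversions_def mem wprod_append)
    qed
  qed
  show "\<alpha> i \<notin> s i ` inversions is"
    using neg by (simp add: mem root_refl_self inversions_def)
qed

text \<open>For a reduced word only the monomials of the inversions occur, and all of these are positive, so
  no negative powers of the variables can arise: each further letter \<open>i\<close> adds \<open>\<alpha>\<^sub>i\<close> to the inversions and
  reflects the others into positive roots.\<close>

lemma fold_T_reduced:
  assumes "reduced is"
  shows "fold T is 1 * Dn (inversions is) \<in> alg (Y ` inversions is)"
  using assms
proof (induction rule: reduced.induct)
  case Nil
  show ?case by (simp add: Dn_def inversions_def)
next
  case (snoc "is" i)
  define I where "I = inversions is"
  define I' where "I' = insert (\<alpha> i) (s i ` I)"
  have I': "inversions (is @ [i]) = I'" "\<alpha> i \<notin> s i ` I"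
    using inversions_snoc[OF snoc.hyps(2)] by (simp_all add: I_def I'_def)
  have I: "I \<subseteq> \<Phi>" "finite I"
    using finite_pos by (auto simp: I_def inversions_def dest: pos_root)
  define f where "f = fold T is 1"
  define u where "u = f * Dn I"
  have u: "u \<in> alg (Y ` I)" using snoc.IH by (simp add: u_def f_def I_def)
  have f: "f = inverse (Dn I) * u" using Dn_nonzero[OF I(2,1)] by (simp add: u_def)
  have Eu: "E i u \<in> alg (Y ` I)"
  proof (rule alg_image[OF u endo_E])
    fix g assume "g \<in> Y ` I"
    then obtain v where "g = Y v" "g \<in> alg (Y ` I)" by (auto intro: alg.gen)
    thus "E i g \<in> alg (Y ` I)" using E_Y[of i v] alg_minus by auto
  qed
  have S_alg: "S i g \<in> alg (Y ` I')" if "g \<in> alg (Y ` I)" for g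
  proof (rule alg_image[OF that endo_S])
    fix g assume "g \<in> Y ` I"
    thus "S i g \<in> alg (Y ` I')"
      using I by (auto simp: S_Y root_lattice I'_def intro!: alg.gen)
  qed
  have par: "par i \<in> alg A" for A
    using alg_power[OF alg.const[of "- 1" A], of "l i"] by (simp add: par_def rconst_minus)
  have plus: "f_plus \<alpha> l i u \<in> alg (Y ` I)" and minus: "f_minus \<alpha> l i u \<in> alg (Y ` I)"
    unfolding f_plus_E f_minus_E using u Eu par
    by (auto intro!: alg_half alg.add alg_diff alg.mult)
  have yi: "y i \<in> alg (Y ` I')"
    by (rule alg.gen) (auto simp: I'_def Y_simple[symmetric])
  have sqc: "sq \<in> alg A" "of_nat q \<in> alg A" for A
    using alg.const[of "of_nat q" A] by (simp_all add: sqrtq_def alg.const rconst_of_nat)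
  have w: "weight (y i) * (of_nat q - (y i)\<^sup>2) = (1 - sq * y i) * (sq + y i)"
  proof -
    have "of_nat q - (y i)\<^sup>2 = (sq - y i) * (sq + y i)"
      by (simp add: power2_eq_square algebra_simps flip: sq_square)
    thus ?thesis using sq_minus_y(1)[of i] by (simp add: weight_def)
  qed
  have D': "Dn I' = (of_nat q - (y i)\<^sup>2) * S i (Dn I)"
    using I I'(2) by (simp add: I'_def Dn_def[of "insert _ _"] Y_simple S_Dn[OF I(1)])
      (simp add: Dn_def)
  have "T i f * Dn I' = T i u * (of_nat q - (y i)\<^sup>2)"
  proof -
    have "E i (inverse (Dn I)) = inverse (Dn I)" by (simp add: E_simps E_Dn)
    hence "T i f = S i (inverse (Dn I)) * T i u" unfolding f by (rule T_mult_even)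
    moreover have "S i (Dn I) \<noteq> 0"
      using Dn_nonzero[OF I(2,1)] endo_eq_0_iff[OF endo_S] by blast
    ultimately show ?thesis by (simp add: D' S_simps)
  qed
  also have "\<dots> = y i ^ (1 + l i) * ((1 - sq * y i) * (sq + y i) * S i (f_plus \<alpha> l i u)
      - (of_nat q - (y i)\<^sup>2) * S i (f_minus \<alpha> l i u))"
    unfolding T_def w[symmetric] by (simp only: algebra_simps)
  also have "\<dots> \<in> alg (Y ` I')"
    using yi sqc by (intro alg.mult alg_power alg_diff alg.add S_alg plus minus) simp_all
  finally show ?case by (simp add: I' f_def)
qed

lemma Y_square_in_Pol: "\<beta> \<in> pos \<Longrightarrow> (Y \<beta>)\<^sup>2 \<in> Pol"
  by (intro Pol_power Y_pos_in_Pol)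

lemma Dn_in_Pol: "I \<subseteq> pos \<Longrightarrow> Dn I \<in> Pol"
  unfolding Dn_def rconst_of_nat[symmetric]
  by (intro Pol_prod Pol_diff Y_square_in_Pol) auto

lemma G_Dn_in_Pol: "G * Dn pos \<in> Pol"
proof -
  have "fold T (word_of \<alpha> w) 1 * Dn pos \<in> Pol" for w
  proof -
    obtain "is" where r: "reduced is" "wprod is = wprod (word_of \<alpha> w)" using ex_reduced by blast
    have eq: "fold T (word_of \<alpha> w) 1 = fold T is 1"
      by (rule fold_T_cong) (simp add: r(2))
    let ?I = "inversions is"
    have sub: "?I \<subseteq> pos" by (auto simp: inversions_def)
    have split: "Dn pos = Dn ?I * Dn (pos - ?I)"
      unfolding Dn_def by (rule prod.subset_diff[OF sub finite_pos, folded mult.commute])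
    have "fold T is 1 * Dn ?I \<in> Pol"
      by (rule alg_subset_Pol[OF fold_T_reduced[OF r(1)]]) (use sub Y_pos_in_Pol in auto)
    thus ?thesis
      unfolding eq split mult.assoc[symmetric] by (rule Pol_mult) (rule Dn_in_Pol, blast)
  qed
  thus ?thesis by (simp add: G_def sum_distrib_right Pol_sum)
qed

section \<open>Divisibility by the Weyl denominator\<close>

definition Laurent :: "'r ratfun set" where
  "Laurent = alg (range y \<union> range (\<lambda>i. inverse (y i)))"

text \<open>A localisation of the Laurent polynomials that is stable under the operators \<open>T\<^sub>i\<close>. Its denominators
  vanish identically on none of the hypersurfaces \<open>y\<^bsup>2\<gamma>\<^esup> = 1\<close>.\<close>

definition Loc :: "'r ratfun set" where
  "Loc = alg (range y \<union> range (\<lambda>i. inverse (y i)) \<union> (\<lambda>\<beta>. inverse (of_nat q - (Y \<beta>)\<^sup>2)) ` \<Phi>)"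

lemma Laurent_Loc: "f \<in> Laurent \<Longrightarrow> f \<in> Loc"
  unfolding Laurent_def Loc_def by (erule alg_mono) (auto intro: alg.gen)

lemma y_Laurent: "y i \<in> Laurent" "inverse (y i) \<in> Laurent"
  unfolding Laurent_def by (auto intro: alg.gen)

lemma Y_Laurent: "Y v \<in> Laurent"
  unfolding Y_def Laurent_def
  by (intro alg_prod alg_powi) (auto intro: alg.gen)

lemma Xvar_y: "Xvar i = rconst (inverse rq) * y i"
proof -
  have "rconst (inverse rq) = inverse sq" by (simp only: sqrtq_def rconst_inverse)
  thus ?thesis by (simp add: y_def)
qed

lemma Pol_Laurent: "f \<in> Pol \<Longrightarrow> f \<in> Laurent"
  unfolding Laurent_def
  by (erule Pol_subset_alg) (auto simp: Xvar_y intro!: alg.mult alg.const intro: alg.gen)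

lemma S_Laurent: "f \<in> Laurent \<Longrightarrow> S i f \<in> Laurent"
  unfolding Laurent_def
proof (erule alg_image[OF _ endo_S])
  fix g assume "g \<in> range y \<union> range (\<lambda>i. inverse (y i))"
  then obtain j where "g = Y (\<alpha> j) \<or> g = Y (- \<alpha> j)"
    by (auto simp: Y_simple Y_minus root_lattice)
  hence "\<exists>v. S i g = Y v"
    using S_Y root_lattice uminus_root simple_root by metis
  thus "S i g \<in> alg (range y \<union> range (\<lambda>i. inverse (y i)))"
    using Y_Laurent by (auto simp: Laurent_def)
qed

lemma S_Loc: "f \<in> Loc \<Longrightarrow> S i f \<in> Loc"
  unfolding Loc_def
proof (erule alg_image[OF _ endo_S])
  fix g assume "g \<in> range y \<union> range (\<lambda>i. inverse (y i)) \<union> (\<lambda>\<beta>. inverse (of_nat q - (Y \<beta>)\<^sup>2)) ` \<Phi>"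
  then consider "g \<in> Laurent" | \<beta> where "\<beta> \<in> \<Phi>" "g = inverse (of_nat q - (Y \<beta>)\<^sup>2)"
    using y_Laurent by blast
  thus "S i g \<in> alg (range y \<union> range (\<lambda>i. inverse (y i)) \<union> (\<lambda>\<beta>. inverse (of_nat q - (Y \<beta>)\<^sup>2)) ` \<Phi>)"
  proof cases
    case 1
    thus ?thesis using Laurent_Loc[OF S_Laurent] unfolding Loc_def by blast
  next
    case 2
    hence "S i g = inverse (of_nat q - (Y (s i \<beta>))\<^sup>2)"
      by (simp add: S_simps S_Y root_lattice)
    thus ?thesis using root_refl_root[OF simple_root 2(1), of i] by (auto intro: alg.gen)
  qed
qed

lemma E_Loc: "f \<in> Loc \<Longrightarrow> E i f \<in> Loc"
  unfolding Loc_def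
proof (erule alg_image[OF _ endo_E])
  let ?A = "range y \<union> range (\<lambda>i. inverse (y i)) \<union> (\<lambda>\<beta>. inverse (of_nat q - (Y \<beta>)\<^sup>2)) ` \<Phi>"
  fix g assume g: "g \<in> ?A"
  have "E i g = g \<or> E i g = - g"
    using g by (auto simp: E_simps(8) E_y E_q_minus_Y)
  thus "E i g \<in> alg ?A"
    using alg.gen[OF g] alg_minus[OF alg.gen[OF g]] by (elim disjE) (simp_all only:)
qed

lemma Loc_closed:
  shows "f \<in> Loc \<Longrightarrow> g \<in> Loc \<Longrightarrow> f + g \<in> Loc" "f \<in> Loc \<Longrightarrow> g \<in> Loc \<Longrightarrow> f * g \<in> Loc"
    "f \<in> Loc \<Longrightarrow> g \<in> Loc \<Longrightarrow> f - g \<in> Loc" "f \<in> Loc \<Longrightarrow> f ^ n \<in> Loc" "rconst c \<in> Loc"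
    "1 \<in> Loc" "f \<in> Loc \<Longrightarrow> f / 2 \<in> Loc" "sq \<in> Loc" "par i \<in> Loc"
    "\<beta> \<in> \<Phi> \<Longrightarrow> inverse (of_nat q - (Y \<beta>)\<^sup>2) \<in> Loc"
  unfolding Loc_def sqrtq_def par_def
  using alg_power[OF alg_minus[OF alg_1]]
  by (auto intro: alg.intros alg_diff alg_power alg_half)

lemma y_square_diff: "of_nat q - (y i)\<^sup>2 = (sq - y i) * (sq + y i)"
  by (simp add: power2_eq_square algebra_simps flip: sq_square)

lemma weight_P_M_Loc: "P (y i) \<in> Loc" "M (y i) \<in> Loc"
proof -
  have inv: "inverse (sq - y i) = (sq + y i) * inverse (of_nat q - (Y (\<alpha> i))\<^sup>2)"
    using sq_minus_y[of i] by (simp add: Y_simple y_square_diff)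
  have yL: "y i \<in> Loc" using y_Laurent Laurent_Loc by blast
  have iL: "inverse (sq - y i) \<in> Loc" unfolding inv using yL by (intro Loc_closed) simp_all
  have "P (y i) = (1 - sq) * (1 + y i) * inverse (sq - y i) / 2"
    "M (y i) = (1 + sq) * (1 - y i) * inverse (sq - y i) / 2"
    by (simp_all only: P_def M_def divide_inverse inverse_mult_distrib mult_ac)
  thus "P (y i) \<in> Loc" "M (y i) \<in> Loc"
    by (simp_all only:) (intro Loc_closed iL yL)+
qed

lemma T_Loc: "f \<in> Loc \<Longrightarrow> T i f \<in> Loc"
  unfolding T_expand
  using y_Laurent Laurent_Loc weight_P_M_Loc
  by (auto intro!: Loc_closed S_Loc E_Loc)

text \<open>The hypersurfaces \<open>y\<^sub>i = 1\<close> and \<open>y\<^sub>i = - 1\<close> play the part of the reflecting hyperplane of \<open>\<sigma>\<^sub>i\<close>. Restricting a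
  monomial to them leaves a sign and the part of the exponent away from \<open>\<alpha>\<^sub>i\<close>.\<close>

definition wall :: "'r \<Rightarrow> complex \<Rightarrow> 'r \<Rightarrow> 'r ratfun" where "wall i c = spec i (c / rq)"

lemma wall_y: "rat_subst (wall i c) (y j) = (if j = i then rconst c else y j)"
  and wall_y_regular: "regular_at (wall i c) (y j)"
proof -
  have "rat_subst (wall i c) (rconst rq * Xvar j) = (if j = i then rconst c else y j)"
    by (subst rat_subst_mult)
      (use q in \<open>simp_all add: wall_def y_def sqrtq_def flip: rconst_mult\<close>)
  thus "rat_subst (wall i c) (y j) = (if j = i then rconst c else y j)"
    by (simp add: y_def sqrtq_def)
  show "regular_at (wall i c) (y j)"
    unfolding y_def sqrtq_def by (intro regular_at_mult) simp_all
qed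

context
  fixes i :: 'r and c :: complex
  assumes c: "c = 1 \<or> c = - 1"
begin

lemma rconst_c_nonzero: "rconst c \<noteq> (0 :: 'r ratfun)"
  using c rconst_eq_iff[of c 0] by auto

lemma wall_Y:
  shows wall_Y_regular: "regular_at (wall i c) (Y v)"
    and "v \<in> lattice \<Longrightarrow>
      rat_subst (wall i c) (Y v) = rconst (c powi \<lfloor>co i v\<rfloor>) * Y (v - co i v *\<^sub>R \<alpha> i)"
proof -
  have nz: "rat_subst (wall i c) (y j) \<noteq> 0" for j
    using rconst_c_nonzero by (simp add: wall_y)
  have r: "regular_at (wall i c) (y j powi n)" for j n
    by (intro regular_at_powi wall_y_regular nz)
  show "regular_at (wall i c) (Y v)"
    unfolding Y_def by (intro regular_at_prod r)
  assume v: "v \<in> lattice"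
  have fl: "\<lfloor>co j (v - co i v *\<^sub>R \<alpha> i)\<rfloor> = (if j = i then 0 else \<lfloor>co j v\<rfloor>)" for j
    by (simp add: co_diff co_scale co_simple)
  have "rat_subst (wall i c) (Y v) = (\<Prod>j\<in>UNIV. rat_subst (wall i c) (y j) powi \<lfloor>co j v\<rfloor>)"
    unfolding Y_def by (simp add: rat_subst_prod r rat_subst_powi wall_y_regular nz)
  also have "\<dots> = (\<Prod>j\<in>UNIV. (if j = i then rconst (c powi \<lfloor>co i v\<rfloor>) else 1) *
      y j powi \<lfloor>co j (v - co i v *\<^sub>R \<alpha> i)\<rfloor>)"
    by (intro prod.cong) (auto simp: wall_y fl rconst_powi)
  also have "\<dots> = rconst (c powi \<lfloor>co i v\<rfloor>) * Y (v - co i v *\<^sub>R \<alpha> i)"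
    by (simp add: prod.distrib Y_def)
  finally show "rat_subst (wall i c) (Y v) = rconst (c powi \<lfloor>co i v\<rfloor>) * Y (v - co i v *\<^sub>R \<alpha> i)" .
qed

lemma proj_lattice: "v \<in> lattice \<Longrightarrow> v - co i v *\<^sub>R \<alpha> i \<in> lattice"
  using lattice_add[OF _ lattice_minus[OF lattice_scale[OF root_lattice[OF simple_root], of "\<lfloor>co i v\<rfloor>"]], of v]
  by (simp add: lattice_floor)

lemma wall_Y_square:
  assumes "v \<in> lattice"
  shows "rat_subst (wall i c) ((Y v)\<^sup>2) = (Y (v - co i v *\<^sub>R \<alpha> i))\<^sup>2"
proof -
  have "c powi n * c powi n = 1" for n
    using c by (auto simp flip: power_int_mult_distrib)
  thus ?thesis
    by (simp add: power2_eq_square rat_subst_mult wall_Y_regular wall_Y assms mult_ac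
        flip: rconst_mult mult.assoc[of "rconst _" "rconst _"])
qed

text \<open>Only the two roots proportional to \<open>\<alpha>\<^sub>i\<close> have constant restriction. This is behind both the
  regularity of the denominators and the coprimality of the factors of \<open>\<Delta>\<close>.\<close>

lemma wall_Y_square_constant:
  assumes "\<beta> \<in> \<Phi>" "rat_subst (wall i c) ((Y \<beta>)\<^sup>2) = rconst d"
  shows "(\<beta> = \<alpha> i \<or> \<beta> = - \<alpha> i) \<and> d = 1"
proof -
  have z: "\<beta> - co i \<beta> *\<^sub>R \<alpha> i = 0"
    using assms proj_lattice[OF root_lattice[OF assms(1)]]
    by (intro Y_square_not_constant) (auto simp: wall_Y_square root_lattice)
  have "co j \<beta> = 0" if "j \<noteq> i" for j
    using arg_cong[OF z, of "co j"] that by (simp add: co_diff co_scale co_simple)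
  moreover have "rconst d = (rconst 1 :: 'r ratfun)"
    using assms z by (simp add: wall_Y_square root_lattice)
  ultimately show ?thesis
    using multiple_of_simple[OF assms(1), of i] unfolding rconst_eq_iff by blast
qed

lemma wall_q_minus_Y:
  assumes "\<beta> \<in> \<Phi>"
  shows "regular_at (wall i c) (of_nat q - (Y \<beta>)\<^sup>2)"
    and "rat_subst (wall i c) (of_nat q - (Y \<beta>)\<^sup>2) = of_nat q - (Y (\<beta> - co i \<beta> *\<^sub>R \<alpha> i))\<^sup>2"
    and "rat_subst (wall i c) (of_nat q - (Y \<beta>)\<^sup>2) \<noteq> 0"
proof -
  have rY: "regular_at (wall i c) ((Y \<beta>)\<^sup>2)" by (intro regular_at_power wall_Y_regular)
  show "regular_at (wall i c) (of_nat q - (Y \<beta>)\<^sup>2)"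
    unfolding rconst_of_nat[symmetric] using rY by (intro regular_at_diff) simp_all
  have v: "rat_subst (wall i c) (rconst (of_nat q) - (Y \<beta>)\<^sup>2)
      = rconst (of_nat q) - rat_subst (wall i c) ((Y \<beta>)\<^sup>2)"
    using rY by (subst rat_subst_diff) simp_all
  show "rat_subst (wall i c) (of_nat q - (Y \<beta>)\<^sup>2) = of_nat q - (Y (\<beta> - co i \<beta> *\<^sub>R \<alpha> i))\<^sup>2"
    using v by (simp add: rconst_of_nat wall_Y_square root_lattice assms)
  have "complex_of_nat q \<noteq> 1" using q by simp
  hence "rat_subst (wall i c) ((Y \<beta>)\<^sup>2) \<noteq> rconst (of_nat q)"
    using wall_Y_square_constant[OF assms] by blast
  thus "rat_subst (wall i c) (of_nat q - (Y \<beta>)\<^sup>2) \<noteq> 0"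
    using v by (simp add: rconst_of_nat)
qed

lemma wall_Loc: "f \<in> Loc \<Longrightarrow> regular_at (wall i c) f"
  unfolding Loc_def
proof (induction rule: alg.induct)
  case (gen f)
  thus ?case
    using wall_q_minus_Y rconst_c_nonzero
    by (auto intro!: regular_at_inverse wall_y_regular simp: wall_y split: if_splits)
qed (auto intro: regular_at_add regular_at_mult)

lemma wall_add: "f \<in> Loc \<Longrightarrow> g \<in> Loc \<Longrightarrow> rat_subst (wall i c) (f + g) = rat_subst (wall i c) f + rat_subst (wall i c) g"
  and wall_mult: "f \<in> Loc \<Longrightarrow> g \<in> Loc \<Longrightarrow> rat_subst (wall i c) (f * g) = rat_subst (wall i c) f * rat_subst (wall i c) g"
  and wall_diff: "f \<in> Loc \<Longrightarrow> g \<in> Loc \<Longrightarrow> rat_subst (wall i c) (f - g) = rat_subst (wall i c) f - rat_subst (wall i c) g"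
  and wall_power: "f \<in> Loc \<Longrightarrow> rat_subst (wall i c) (f ^ n) = rat_subst (wall i c) f ^ n"
  by (simp_all add: rat_subst_add rat_subst_mult rat_subst_diff rat_subst_power wall_Loc)

text \<open>The reflection \<open>\<sigma>\<^sub>i\<close> fixes the locus \<open>y\<^sub>i = 1\<close> pointwise and acts on \<open>y\<^sub>i = - 1\<close> as the sign change.\<close>

lemma wall_S:
  assumes "f \<in> Loc"
  shows "rat_subst (wall i c) (S i f) = rat_subst (wall i c) (if c = 1 then f else E i f)"
proof -
  define h where "h = (if c = 1 then (\<lambda>f. f) else E i)"
  have h: "field_endo h" using field_endo_id endo_E by (auto simp: h_def)
  have hL: "f \<in> Loc \<Longrightarrow> h f \<in> Loc" for f by (auto simp: h_def E_Loc)
  let ?A = "range y \<union> range (\<lambda>i. inverse (y i)) \<union> (\<lambda>\<beta>. inverse (of_nat q - (Y \<beta>)\<^sup>2)) ` \<Phi>"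
  have yj: "rat_subst (wall i c) (S i (y j)) = rat_subst (wall i c) (h (y j)) \<and>
      rat_subst (wall i c) (h (y j)) \<noteq> 0" for j
  proof -
    have "rat_subst (wall i c) (S i (y j)) = rat_subst (wall i c) (y j) * rconst (c powi (- cartan i j))"
      unfolding S_y using rconst_c_nonzero
      by (subst rat_subst_mult)
        (simp_all add: wall_y_regular regular_at_powi rat_subst_powi wall_y rconst_powi)
    moreover have "rat_subst (wall i c) (- y j) = - rat_subst (wall i c) (y j)"
      using rat_subst_diff[OF regular_at_rconst[of _ 0] wall_y_regular, of i c j]
        rat_subst_rconst[of "wall i c" 0] by simp
    ultimately show ?thesis
      using c rconst_c_nonzero
      by (auto simp: h_def E_y cartan_def wall_y rconst_minus)
  qed
  have "rat_subst (wall i c) (S i f) = rat_subst (wall i c) (h f) \<and> f \<in> Loc"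
    using assms unfolding Loc_def
  proof (induction rule: alg.induct)
    case (const d)
    show ?case by (simp add: S_simps endo_rconst[OF h] alg.const)
  next
    case (gen f)
    then consider j where "f = y j" | j where "f = inverse (y j)"
      | \<beta> where "\<beta> \<in> \<Phi>" "f = inverse (of_nat q - (Y \<beta>)\<^sup>2)"
      by auto
    hence "rat_subst (wall i c) (S i f) = rat_subst (wall i c) (h f)"
    proof cases
      case 1
      thus ?thesis using yj by simp
    next
      case 2
      have L: "S i (y j) \<in> Loc" "h (y j) \<in> Loc"
        using S_Loc hL Laurent_Loc[OF y_Laurent(1)] by auto
      show ?thesis
        using 2 yj[of j] L by (simp add: S_simps endo_inverse[OF h] rat_subst_inverse wall_Loc)
    next
      case 3
      have "h f = f"
        unfolding 3(2) h_def by (simp add: E_simps(8) E_q_minus_Y)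
      have L: "s i \<beta> \<in> \<Phi>" using root_refl_root[OF simple_root 3(1)] .
      have "co i (s i \<beta>) *\<^sub>R \<alpha> i = co i \<beta> *\<^sub>R \<alpha> i + (s i \<beta> - \<beta>)"
        by (simp add: root_refl_def co_diff co_scale co_simple scaleR_diff_left)
      hence proj: "s i \<beta> - co i (s i \<beta>) *\<^sub>R \<alpha> i = \<beta> - co i \<beta> *\<^sub>R \<alpha> i" by simp
      have "S i f = inverse (of_nat q - (Y (s i \<beta>))\<^sup>2)"
        using 3 by (simp add: S_simps S_Y root_lattice)
      hence "rat_subst (wall i c) (S i f) = inverse (rat_subst (wall i c) (of_nat q - (Y (s i \<beta>))\<^sup>2))"
        using rat_subst_inverse[OF wall_q_minus_Y(1)[OF L] wall_q_minus_Y(3)[OF L]] by (simp only:)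
      also have "\<dots> = inverse (rat_subst (wall i c) (of_nat q - (Y \<beta>)\<^sup>2))"
        unfolding wall_q_minus_Y(2)[OF L] wall_q_minus_Y(2)[OF 3(1)] proj ..
      also have "\<dots> = rat_subst (wall i c) f"
        unfolding 3(2)
        by (rule rat_subst_inverse[OF wall_q_minus_Y(1)[OF 3(1)] wall_q_minus_Y(3)[OF 3(1)], symmetric])
      finally show ?thesis unfolding \<open>h f = f\<close> .
    qed
    thus ?case using gen by (auto intro: alg.gen)
  next
    case (add f g)
    hence L: "f \<in> Loc" "g \<in> Loc" by (simp_all add: Loc_def)
    show ?case
      using add.IH by (simp add: S_simps(1) endo_add[OF h] wall_add S_Loc hL L alg.add)
  next
    case (mult f g)
    hence L: "f \<in> Loc" "g \<in> Loc" by (simp_all add: Loc_def)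
    show ?case
      using mult.IH by (simp add: S_simps(2) endo_mult[OF h] wall_mult S_Loc hL L alg.mult)
  qed
  thus ?thesis by (auto simp: h_def)
qed

text \<open>An invariant function equals its own negative on the fixed locus.\<close>

lemma wall_invariant:
  assumes "f \<in> Loc" "T i f = f"
  shows "rat_subst (wall i c) f = 0"
proof -
  have yL: "y i \<in> Loc" using Laurent_Loc[OF y_Laurent(1)] .
  have sqne: "sq \<noteq> rconst c"
  proof -
    have "0 \<le> sqrt (real q)" by simp
    hence "sqrt (real q) \<noteq> - 1" by linarith
    thus ?thesis
      using c q unfolding sqrtq_def rconst_eq_iff by (auto simp: complex_eq_iff)
  qed
  have yc: "rat_subst (wall i c) (y i) = rconst c" by (simp add: wall_y)
  have cL: "rat_subst (wall i c) (1 + y i) = 1 + rconst c" "rat_subst (wall i c) (1 - y i) = 1 - rconst c"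
    "rat_subst (wall i c) (sq - y i) = sq - rconst c" "rat_subst (wall i c) (1 - sq) = 1 - sq"
    "rat_subst (wall i c) (1 + sq) = 1 + sq" "rat_subst (wall i c) 2 = 2"
    "rat_subst (wall i c) (par i) = par i"
  proof -
    have k: "rat_subst (wall i c) 1 = 1" "rat_subst (wall i c) sq = sq"
      using rat_subst_rconst[of "wall i c" 1] by (simp_all add: sqrtq_def)
    show "rat_subst (wall i c) (1 + y i) = 1 + rconst c" "rat_subst (wall i c) (1 - y i) = 1 - rconst c"
      "rat_subst (wall i c) (sq - y i) = sq - rconst c" "rat_subst (wall i c) (1 - sq) = 1 - sq"
      "rat_subst (wall i c) (1 + sq) = 1 + sq"
      using yL by (simp_all add: wall_add wall_diff Loc_closed k yc)
    show "rat_subst (wall i c) 2 = 2"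
      using rat_subst_rconst[of "wall i c" 2] by (simp add: rconst_numeral)
    have "par i = rconst ((- 1) ^ l i)" by (simp add: par_def rconst_power rconst_minus)
    thus "rat_subst (wall i c) (par i) = par i" by simp
  qed
  have twoL: "2 \<in> Loc" using Loc_closed(5)[of 2] by (simp add: rconst_numeral)
  define p where "p = rat_subst (wall i c) (P (y i))"
  define m where "m = rat_subst (wall i c) (M (y i))"
  have "P (y i) * (2 * (sq - y i)) = (1 - sq) * (1 + y i)"
    "M (y i) * (2 * (sq - y i)) = (1 + sq) * (1 - y i)"
    using sq_minus_y(1)[of i] by (simp_all add: P_def M_def)
  hence "rat_subst (wall i c) (P (y i) * (2 * (sq - y i))) = rat_subst (wall i c) ((1 - sq) * (1 + y i))"
    "rat_subst (wall i c) (M (y i) * (2 * (sq - y i))) = rat_subst (wall i c) ((1 + sq) * (1 - y i))"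
    by simp_all
  hence pm: "p * (2 * (sq - rconst c)) = (1 - sq) * (1 + rconst c)"
    "m * (2 * (sq - rconst c)) = (1 + sq) * (1 - rconst c)"
    by (simp_all only: wall_mult Loc_closed yL twoL weight_P_M_Loc cL p_def m_def)
  have "rat_subst (wall i c) f = rat_subst (wall i c)
      (y i ^ (1 + l i) * (P (y i) * S i f + par i * M (y i) * S i (E i f)))"
    using assms(2) T_expand[of i f] by simp
  also have "\<dots> = rconst c ^ (1 + l i) *
      (p * rat_subst (wall i c) (S i f) + par i * m * rat_subst (wall i c) (S i (E i f)))"
    using yL weight_P_M_Loc[of i] S_Loc[OF assms(1), of i] S_Loc[OF E_Loc[OF assms(1), of i], of i]
    by (simp only: wall_mult wall_add wall_power Loc_closed p_def m_def cL yc)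
  finally have eq: "rat_subst (wall i c) f = \<dots>" .
  from c have "2 * rat_subst (wall i c) f = 0"
  proof
    assume c1: "c = 1"
    have "2 * (sq - 1) * (p + 1) = 0" "2 * (sq - 1) * m = 0"
      using pm c1 by (simp_all add: algebra_simps)
    hence pm': "p = - 1" "m = 0" using sqne c1 by (auto simp: eq_neg_iff_add_eq_0)
    have "rat_subst (wall i c) (S i f) = rat_subst (wall i c) f"
      using wall_S[OF assms(1)] c1 by simp
    with eq have "rat_subst (wall i c) f = - rat_subst (wall i c) f"
      by (simp add: pm' c1)
    thus ?thesis by (simp add: eq_neg_iff_add_eq_0 flip: mult_2)
  next
    assume c1: "c = - 1"
    have "2 * (sq + 1) * p = 0" "2 * (sq + 1) * (m - 1) = 0"
      using pm c1 by (simp_all add: rconst_minus algebra_simps)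
    moreover have "sq + 1 \<noteq> 0"
      using sqne c1 by (simp add: rconst_minus eq_neg_iff_add_eq_0)
    ultimately have pm': "p = 0" "m = 1"
      by (metis mult_eq_0_iff two_ne_0_ratfun, metis mult_eq_0_iff two_ne_0_ratfun eq_iff_diff_eq_0)
    have "rat_subst (wall i c) (S i (E i f)) = rat_subst (wall i c) f"
      using wall_S[OF E_Loc[OF assms(1)], of i] c1 by (simp add: E_involution)
    with eq have "rat_subst (wall i c) f = - (par i * (par i * rat_subst (wall i c) f))"
      by (simp add: pm' c1 rconst_minus par_def)
    thus ?thesis by (simp add: par_square eq_neg_iff_add_eq_0 flip: mult_2)
  qed
  thus ?thesis by simp
qed

end

lemma divide_Pol:
  assumes "f \<in> Pol" "\<And>c. c = 1 \<or> c = - 1 \<Longrightarrow> rat_subst (wall i c) f = 0"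
  shows "\<exists>g\<in>Pol. f = ((y i)\<^sup>2 - 1) * g"
proof -
  have lin: "Xvar i - rconst (c / rq) = rconst (inverse rq) * (y i - rconst c)" for c
  proof -
    have "rconst (c / rq) = (rconst (inverse rq) * rconst c :: 'r ratfun)"
      by (simp add: divide_inverse mult.commute flip: rconst_mult)
    thus ?thesis by (simp only: Xvar_y right_diff_distrib)
  qed
  obtain g where g: "g \<in> Pol" "f = (Xvar i - rconst (1 / rq)) * g"
    using factor_theorem[OF assms(1), of i "1 / rq"] assms(2)[of 1] unfolding wall_def by auto
  have g': "f = (y i - 1) * (rconst (inverse rq) * g)" using g(2) by (simp only: lin) simp
  define g1 where "g1 = rconst (inverse rq) * g"
  have g1: "g1 \<in> Pol" using g(1) by (auto simp: g1_def intro: Pol_mult)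
  have "rat_subst (wall i (- 1)) f = rat_subst (wall i (- 1)) (y i - 1) * rat_subst (wall i (- 1)) g1"
    unfolding g' g1_def[symmetric] using g1 y_in_Pol[of i] Pol_rconst[of 1]
    by (intro rat_subst_mult regular_at_Pol Pol_diff) simp_all
  also have "rat_subst (wall i (- 1)) (y i - 1) = - 2"
    using rat_subst_diff[OF wall_y_regular regular_at_rconst[of _ 1], of i "- 1" i]
      rat_subst_rconst[of "wall i (- 1)" 1]
    by (simp add: wall_y rconst_minus)
  finally have "rat_subst (wall i (- 1)) g1 = 0" using assms(2)[of "- 1"] by simp
  then obtain h where h: "h \<in> Pol" "g1 = (Xvar i - rconst (- 1 / rq)) * h"
    using factor_theorem[OF g1, of i "- 1 / rq"] unfolding wall_def by auto
  have "g1 = (y i + 1) * (rconst (inverse rq) * h)"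
    using h(2) lin[of "- 1"] by (simp add: rconst_minus)
  hence "f = ((y i)\<^sup>2 - 1) * (rconst (inverse rq) * h)"
    unfolding g' g1_def[symmetric] by (simp add: power2_eq_square algebra_simps)
  moreover have "rconst (inverse rq) * h \<in> Pol" using h(1) by (intro Pol_mult) simp_all
  ultimately show ?thesis by blast
qed

lemma clear_Laurent:
  assumes "f \<in> Laurent"
  shows "\<exists>ks. f * prod_list (map Xvar ks) \<in> Pol"
  using assms unfolding Laurent_def
proof (induction rule: alg.induct)
  case (const c)
  show ?case by (intro exI[of _ "[]"]) simp
next
  case (gen f)
  then consider j where "f = y j" | j where "f = inverse (y j)" by auto
  thus ?case
  proof cases
    case 1
    thus ?thesis by (intro exI[of _ "[]"]) (simp add: y_in_Pol)
  next
    case 2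
    have "inverse (y j) * Xvar j = rconst (inverse rq)"
      by (simp only: Xvar_y) simp
    thus ?thesis using 2 by (intro exI[of _ "[j]"]) simp
  qed
next
  case (add f g)
  then obtain ks ms where "f * prod_list (map Xvar ks) \<in> Pol" "g * prod_list (map Xvar ms) \<in> Pol"
    by blast
  moreover have "prod_list (map Xvar ns) \<in> Pol" for ns :: "'r list"
    using Pol_rconst[of 1] by (induction ns) (auto intro: Pol_mult)
  ultimately have "f * prod_list (map Xvar ks) * prod_list (map Xvar ms) \<in> Pol"
    "g * prod_list (map Xvar ms) * prod_list (map Xvar ks) \<in> Pol"
    by (blast intro: Pol_mult)+
  from Pol_add[OF this]
  have "f * prod_list (map Xvar ks) * prod_list (map Xvar ms) +
      g * prod_list (map Xvar ms) * prod_list (map Xvar ks) \<in> Pol" .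
  thus ?case by (intro exI[of _ "ks @ ms"]) (simp add: algebra_simps)
next
  case (mult f g)
  then obtain ks ms where "f * prod_list (map Xvar ks) \<in> Pol" "g * prod_list (map Xvar ms) \<in> Pol"
    by blast
  hence "(f * prod_list (map Xvar ks)) * (g * prod_list (map Xvar ms)) \<in> Pol"
    by (rule Pol_mult)
  thus ?case by (intro exI[of _ "ks @ ms"]) (simp add: mult_ac)
qed

text \<open>Monomials are units on the walls, so the polynomial case applies after clearing them.\<close>

lemma divide_Laurent:
  assumes "f \<in> Laurent" "\<And>c. c = 1 \<or> c = - 1 \<Longrightarrow> rat_subst (wall i c) f = 0"
  shows "\<exists>g\<in>Laurent. f = ((y i)\<^sup>2 - 1) * g"
proof -
  obtain ks where ks: "f * prod_list (map Xvar ks) \<in> Pol" using clear_Laurent[OF assms(1)] by blast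
  define m where "m = prod_list (map Xvar ks)"
  have X: "Xvar j \<in> Laurent" "inverse (Xvar j) \<in> Laurent" for j
  proof -
    show "Xvar j \<in> Laurent" by (rule Pol_Laurent) simp
    have "inverse (Xvar j) = sq * inverse (y j)" by (simp add: y_def)
    thus "inverse (Xvar j) \<in> Laurent"
      using y_Laurent(2)[of j] unfolding Laurent_def sqrtq_def by (auto intro: alg.intros)
  qed
  have m: "m \<in> Laurent" "inverse m \<in> Laurent" "m \<noteq> 0"
    unfolding m_def using X
    by (induction ks) (auto simp: Laurent_def intro: alg.mult)
  have "rat_subst (wall i c) (f * m) = 0" if "c = 1 \<or> c = - 1" for c
    using that assms m by (simp add: wall_mult Laurent_Loc)
  then obtain g where g: "g \<in> Pol" "f * m = ((y i)\<^sup>2 - 1) * g"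
    using divide_Pol[of "f * m" i] ks by (auto simp: m_def)
  have "f = ((y i)\<^sup>2 - 1) * (g * inverse m)"
    using g(2) m(3) by (simp add: field_simps)
  moreover have "g * inverse m \<in> Laurent"
    using Pol_Laurent[OF g(1)] m(2) unfolding Laurent_def by (rule alg.mult)
  ultimately show ?thesis by blast
qed

lemma inverse_Dn_Loc: "I \<subseteq> \<Phi> \<Longrightarrow> inverse (Dn I) \<in> Loc"
  unfolding Dn_def prod_inversef[symmetric] Loc_def o_def
  by (intro alg_prod alg.gen) auto

lemma pos_subset: "pos \<subseteq> \<Phi>"
  using pos_root by blast

lemma G_Loc: "G \<in> Loc"
proof -
  have eq: "(G * Dn pos) * inverse (Dn pos) = G"
    using Dn_nonzero[OF finite_pos pos_subset] by (simp add: mult.assoc)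
  show ?thesis
    using Loc_closed(2)[OF Laurent_Loc[OF Pol_Laurent[OF G_Dn_in_Pol]] inverse_Dn_Loc[OF pos_subset]]
    unfolding eq .
qed

lemma G_divisible_simple: "\<exists>g\<in>Loc. G = ((Y (\<alpha> i))\<^sup>2 - 1) * g"
proof -
  have D: "Dn pos \<in> Loc" using Laurent_Loc Pol_Laurent Dn_in_Pol by blast
  have "rat_subst (wall i c) (G * Dn pos) = 0" if "c = 1 \<or> c = - 1" for c
    using that wall_invariant[OF that G_Loc T_G] by (simp add: wall_mult G_Loc D)
  then obtain g where g: "g \<in> Pol" "G * Dn pos = ((y i)\<^sup>2 - 1) * g"
    using divide_Pol[OF G_Dn_in_Pol, of i] by blast
  hence "G = ((Y (\<alpha> i))\<^sup>2 - 1) * (g * inverse (Dn pos))"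
    using Dn_nonzero[OF finite_pos pos_subset] by (simp add: Y_simple field_simps)
  moreover have "g * inverse (Dn pos) \<in> Loc"
    using Loc_closed(2)[OF Laurent_Loc[OF Pol_Laurent[OF g(1)]] inverse_Dn_Loc[OF pos_subset]] .
  ultimately show ?thesis by blast
qed

text \<open>Divisibility spreads from the simple roots: \<open>T\<^sub>j\<close> fixes \<open>G\<close> and commutes with the even factor
  \<open>y\<^bsup>2\<beta>\<^esup> - 1\<close> up to replacing \<open>\<beta>\<close> by \<open>s\<^sub>j \<beta>\<close>.\<close>

lemma G_divisible:
  assumes "\<beta> \<in> pos"
  shows "\<exists>g\<in>Loc. G = ((Y \<beta>)\<^sup>2 - 1) * g"
proof -
  have "\<exists>g\<in>Loc. G = ((Y (wprod is (\<alpha> i)))\<^sup>2 - 1) * g" for "is" i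
  proof (induction "is")
    case Nil
    show ?case using G_divisible_simple by simp
  next
    case (Cons j "is")
    then obtain g where g: "g \<in> Loc" "G = ((Y (wprod is (\<alpha> i)))\<^sup>2 - 1) * g" by blast
    have E: "E j ((Y v)\<^sup>2 - 1) = (Y v)\<^sup>2 - 1" for v
      by (simp only: E_simps(5,7) E_Y_square)
    have "G = T j (((Y (wprod is (\<alpha> i)))\<^sup>2 - 1) * g)" using T_G g(2) by simp
    also have "\<dots> = ((Y (wprod (j # is) (\<alpha> i)))\<^sup>2 - 1) * T j g"
      unfolding T_mult_even[OF E] by (simp add: S_simps S_Y root_lattice wprod_root)
    finally show ?case using T_Loc[OF g(1)] by blast
  qed
  thus ?thesis using pos_conj_simple[OF assms] by blast
qed

lemma fold_S_Y: "v \<in> lattice \<Longrightarrow> fold S is (Y v) = Y (wprod (rev is) v)"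
proof (induction "is" arbitrary: v)
  case (Cons i "is")
  thus ?case by (simp add: S_Y lattice_refl wprod_append)
qed simp

lemma fold_S_closed: "f \<in> Laurent \<Longrightarrow> fold S is f \<in> Laurent" "f \<in> Loc \<Longrightarrow> fold S is f \<in> Loc"
  by (induction "is" arbitrary: f) (auto intro: S_Laurent S_Loc)

lemma fold_S_rev: "fold S (rev is) (fold S is f) = f"
  by (induction "is" arbitrary: f) (simp_all add: S_involution)

text \<open>The factors \<open>y\<^bsup>2\<beta>\<^esup> - 1\<close> are coprime: moving one root to a simple root \<open>\<alpha>\<^sub>i\<close>, the other factors
  do not vanish identically on the walls \<open>y\<^sub>i = \<plusminus>1\<close>.\<close>

lemma G_Dn_factor:
  assumes "finite A" "A \<subseteq> pos"
  shows "\<exists>h\<in>Laurent. G * Dn pos = (\<Prod>\<beta>\<in>A. (Y \<beta>)\<^sup>2 - 1) * h"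
  using assms
proof (induction A rule: finite_induct)
  case empty
  show ?case using Pol_Laurent[OF G_Dn_in_Pol] by simp
next
  case (insert \<gamma> A)
  then obtain h where h: "h \<in> Laurent" "G * Dn pos = (\<Prod>\<beta>\<in>A. (Y \<beta>)\<^sup>2 - 1) * h" by auto
  have \<gamma>: "\<gamma> \<in> pos" using insert.prems by blast
  obtain "is" i where \<gamma>i: "\<gamma> = wprod is (\<alpha> i)" using pos_conj_simple[OF \<gamma>] by blast
  \<comment> \<open>the automorphism \<open>V\<close> moves \<open>\<gamma>\<close> to the simple root \<open>\<alpha>\<^sub>i\<close>, where vanishing can be tested\<close>
  define V where "V = fold S is"
  have V: "field_endo V" unfolding V_def by (rule endo_fold_S)
  note V_simps = endo_simps[OF V]
  define w where "w = wprod (rev is)"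
  have VY: "V (Y \<beta>) = Y (w \<beta>)" if "\<beta> \<in> \<Phi>" for \<beta>
    using that by (simp add: V_def w_def fold_S_Y root_lattice)
  have w\<gamma>: "w \<gamma> = \<alpha> i" by (simp add: w_def \<gamma>i wprod_rev)
  have w_root: "w \<beta> \<in> \<Phi>" if "\<beta> \<in> \<Phi>" for \<beta> using that by (simp add: w_def wprod_root)
  obtain g where g: "g \<in> Loc" "G = ((Y \<gamma>)\<^sup>2 - 1) * g" using G_divisible[OF \<gamma>] by blast
  have D: "Dn pos \<in> Loc" using Laurent_Loc Pol_Laurent Dn_in_Pol by blast
  have V_closed: "V f \<in> Laurent" if "f \<in> Laurent" for f using that by (simp add: V_def fold_S_closed)
  have VLoc: "V (g * Dn pos) \<in> Loc" "V h \<in> Loc"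
    using Loc_closed(2)[OF g(1) D] Laurent_Loc[OF V_closed[OF h(1)]] by (simp_all add: V_def fold_S_closed)
  have Y2: "(Y v)\<^sup>2 - 1 \<in> Loc" for v using Laurent_Loc[OF Y_Laurent] by (intro Loc_closed)
  have eq1: "V (G * Dn pos) = ((Y (\<alpha> i))\<^sup>2 - 1) * V (g * Dn pos)"
    using g(2) by (simp add: V_simps VY pos_root[OF \<gamma>] w\<gamma>)
  have eq2: "V (G * Dn pos) = (\<Prod>\<beta>\<in>A. (Y (w \<beta>))\<^sup>2 - 1) * V h"
  proof -
    have "(\<Prod>\<beta>\<in>A. V ((Y \<beta>)\<^sup>2 - 1)) = (\<Prod>\<beta>\<in>A. (Y (w \<beta>))\<^sup>2 - 1)"
      using insert.prems by (intro prod.cong) (auto simp: V_simps VY pos_root)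
    thus ?thesis unfolding h(2) by (simp only: V_simps(2,15))
  qed
  have "rat_subst (wall i c) (V h) = 0" if c: "c = 1 \<or> c = - 1" for c
  proof -
    have one: "rat_subst (wall i c) 1 = 1" using rat_subst_rconst[of "wall i c" 1] by simp
    have reg: "regular_at (wall i c) ((Y v)\<^sup>2 - 1)" for v using wall_Loc[OF c Y2] .
    have val: "rat_subst (wall i c) ((Y v)\<^sup>2 - 1) = rat_subst (wall i c) ((Y v)\<^sup>2) - 1" for v
      using Laurent_Loc[OF Y_Laurent] by (simp add: wall_diff[OF c] Loc_closed one)
    have "rat_subst (wall i c) ((Y (w \<beta>))\<^sup>2 - 1) \<noteq> 0" if "\<beta> \<in> A" for \<beta>
    proof
      assume "rat_subst (wall i c) ((Y (w \<beta>))\<^sup>2 - 1) = 0"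
      hence 1: "rat_subst (wall i c) ((Y (w \<beta>))\<^sup>2) = rconst 1" by (simp add: val)
      have b: "\<beta> \<in> pos" using that insert.prems by blast
      have "w \<beta> = w \<gamma> \<or> w \<beta> = w (- \<gamma>)"
        using wall_Y_square_constant[OF c w_root[OF pos_root[OF b]] 1] w\<gamma>
        by (auto simp: w_def wprod_minus)
      hence "\<beta> = \<gamma> \<or> \<beta> = - \<gamma>"
        unfolding w_def by (metis wprod_rev')
      thus False
        using that insert.hyps(2) b pos_iff_uminus[OF pos_root[OF \<gamma>]] \<gamma> by auto
    qed
    hence nz: "rat_subst (wall i c) (\<Prod>\<beta>\<in>A. (Y (w \<beta>))\<^sup>2 - 1) \<noteq> 0"
      using insert.hyps(1) by (simp add: rat_subst_prod reg)
    have PL: "(\<Prod>\<beta>\<in>A. (Y (w \<beta>))\<^sup>2 - 1) \<in> Loc"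
      using Y2 unfolding Loc_def by (rule alg_prod)
    have "rat_subst (wall i c) ((Y (\<alpha> i))\<^sup>2 - 1) = 0"
      unfolding val unfolding Y_simple wall_power[OF c Laurent_Loc[OF y_Laurent(1)]] wall_y
      using c by (auto simp: rconst_minus)
    hence "rat_subst (wall i c) (V (G * Dn pos)) = 0"
      unfolding eq1 by (simp add: wall_mult[OF c Y2 VLoc(1)])
    thus ?thesis
      unfolding eq2 using nz by (simp add: wall_mult[OF c PL VLoc(2)])
  qed
  then obtain h' where h': "h' \<in> Laurent" "V h = ((y i)\<^sup>2 - 1) * h'"
    using divide_Laurent[OF V_closed[OF h(1)], of i] by blast
  define U where "U = fold S (rev is)"
  have U: "field_endo U" unfolding U_def by (rule endo_fold_S)
  have "h = U (V h)" by (simp add: U_def V_def fold_S_rev)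
  also have "\<dots> = ((Y \<gamma>)\<^sup>2 - 1) * U h'"
    unfolding h'(2) using \<gamma>i
    by (simp add: endo_simps[OF U] Y_simple[symmetric])
      (simp add: U_def fold_S_Y root_lattice)
  finally have "G * Dn pos = (\<Prod>\<beta>\<in>insert \<gamma> A. (Y \<beta>)\<^sup>2 - 1) * U h'"
    using h(2) insert.hyps by (simp add: mult_ac)
  moreover have "U h' \<in> Laurent" using h'(1) by (simp add: U_def fold_S_closed)
  ultimately show ?case by blast
qed

text \<open>Setting \<open>x\<^sub>i = 0\<close> either kills the monomial \<open>y\<^sup>\<beta>\<close> or leaves it unchanged, and \<open>1 - y\<^bsup>2\<beta>\<^esup>\<close> becomes zero in neither
  case.\<close>

lemma Del_not_zero_at_0: "rat_subst (spec i 0) Del \<noteq> 0"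
proof -
  have reg: "regular_at (spec i 0) (1 - (Y \<beta>)\<^sup>2)" if "\<beta> \<in> pos" for \<beta>
    using Pol_diff[OF Pol_rconst[of 1] Y_square_in_Pol[OF that]] by (simp add: regular_at_Pol)
  have "rat_subst (spec i 0) (1 - (Y \<beta>)\<^sup>2) \<noteq> 0" if b: "\<beta> \<in> pos" for \<beta>
  proof -
    have yj: "rat_subst (spec i 0) (y j) = (if j = i then 0 else y j)" for j
      unfolding y_def sqrtq_def by (subst rat_subst_mult) simp_all
    have ry: "regular_at (spec i 0) (y j)" for j by (intro regular_at_Pol y_in_Pol)
    have "rat_subst (spec i 0) (Y \<beta>) = (\<Prod>j\<in>UNIV. (if j = i then 0 else y j) ^ nat \<lfloor>co j \<beta>\<rfloor>)"
      unfolding Y_pos_nat[OF b]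
      by (simp add: rat_subst_prod regular_at_power rat_subst_power ry yj)
    also have "\<dots> = 0 \<or> \<dots> = Y \<beta>"
    proof (cases "nat \<lfloor>co i \<beta>\<rfloor> = 0")
      case True
      hence "(\<Prod>j\<in>UNIV. (if j = i then 0 else y j) ^ nat \<lfloor>co j \<beta>\<rfloor>) = (\<Prod>j\<in>UNIV. y j ^ nat \<lfloor>co j \<beta>\<rfloor>)"
        by (intro prod.cong) auto
      thus ?thesis unfolding Y_pos_nat[OF b] by blast
    next
      case False
      thus ?thesis by (intro disjI1 prod_zero) (auto intro!: bexI[of _ i])
    qed
    finally have "rat_subst (spec i 0) (Y \<beta>) = 0 \<or> rat_subst (spec i 0) (Y \<beta>) = Y \<beta>" by auto
    moreover have rY: "regular_at (spec i 0) (Y \<beta>)" by (intro regular_at_Pol Y_pos_in_Pol b)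
    moreover have "rat_subst (spec i 0) (1 - (Y \<beta>)\<^sup>2) = 1 - (rat_subst (spec i 0) (Y \<beta>))\<^sup>2"
      using rat_subst_diff[OF regular_at_rconst[of _ 1] regular_at_power[OF rY, of 2]]
        rat_subst_rconst[of "spec i 0" 1]
      by (simp add: rat_subst_power[OF rY])
    ultimately show ?thesis using Y_square_neq_1[OF pos_root[OF b]] by auto
  qed
  thus ?thesis
    unfolding Del_def using finite_pos by (subst rat_subst_prod) (auto simp: reg)
qed

lemma Del_in_Pol: "Del \<in> Pol"
  unfolding Del_def using Pol_rconst[of 1] Y_square_in_Pol by (auto intro!: Pol_prod Pol_diff)

text \<open>Since \<open>\<Delta>\<close> is not divisible by any variable, a monomial that clears the denominators can be divided
  off one variable at a time.\<close>

lemma Laurent_polynomial_times_Del: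
  assumes "f \<in> Laurent" "Del * f \<in> Pol"
  shows "f \<in> Pol"
proof -
  obtain ks where "f * prod_list (map Xvar ks) \<in> Pol" using clear_Laurent[OF assms(1)] by blast
  thus ?thesis
  proof (induction ks)
    case (Cons i ks)
    define m where "m = prod_list (map Xvar ks)"
    have m: "m \<in> Pol"
      using Pol_rconst[of 1] unfolding m_def by (induction ks) (auto intro: Pol_mult)
    define p where "p = f * prod_list (map Xvar (i # ks))"
    have p: "p \<in> Pol" "p = Xvar i * (f * m)"
      using Cons.prems by (simp_all add: p_def m_def)
    have X0: "rat_subst (spec i 0) (Xvar i) = 0" by simp
    have "rat_subst (spec i 0) Del * rat_subst (spec i 0) p = rat_subst (spec i 0) (Del * p)"
      using p(1) Del_in_Pol by (simp add: rat_subst_mult regular_at_Pol)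
    also have "Del * p = Xvar i * ((Del * f) * m)" by (simp add: p(2))
    also have "rat_subst (spec i 0) \<dots> = 0"
      using rat_subst_mult[OF regular_at_Xvar regular_at_Pol[OF Pol_mult[OF assms(2) m]], of "spec i 0" i]
      by (simp only: X0 mult_zero_left)
    finally have "rat_subst (spec i 0) p = 0" using Del_not_zero_at_0 by simp
    then obtain g where "g \<in> Pol" "p = Xvar i * g"
      using factor_theorem[OF p(1), of i 0] by auto
    hence "f * m \<in> Pol" using p(2) by simp
    thus ?case using Cons.IH by (simp add: m_def)
  qed simp
qed

lemma D_poly_Dn: "D_poly \<Phi> \<alpha> q = rconst (inverse (of_nat q) ^ card pos) * Dn pos"
proof -
  have "1 - of_nat q powi (ht \<alpha> \<beta> - 1) * xpow \<alpha> Xvar (2 *\<^sub>R \<beta>) =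
      rconst (inverse (of_nat q)) * (of_nat q - (Y \<beta>)\<^sup>2)" if "\<beta> \<in> pos" for \<beta>
  proof -
    have "(rconst (inverse (of_nat q)) :: 'r ratfun) = inverse (of_nat q)"
      by (simp only: rconst_inverse rconst_of_nat)
    thus ?thesis
      unfolding Y_square_Xvar[OF pos_root[OF that]]
      by (simp add: power_int_diff right_diff_distrib divide_inverse mult_ac)
  qed
  thus ?thesis
    by (simp add: D_poly_def Dn_def prod.distrib rconst_power)
qed

lemma N_fun_in_Pol: "N_fun \<Phi> \<alpha> q l \<in> Pol"
proof -
  obtain h where h: "h \<in> Laurent" "G * Dn pos = (\<Prod>\<beta>\<in>pos. (Y \<beta>)\<^sup>2 - 1) * h"
    using G_Dn_factor[OF finite_pos] by blast
  define h' where "h' = rconst ((- 1) ^ card pos) * h"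
  have "(\<Prod>\<beta>\<in>pos. (Y \<beta>)\<^sup>2 - 1) = (\<Prod>\<beta>\<in>pos. rconst (- 1) * (1 - (Y \<beta>)\<^sup>2))"
    by (simp add: rconst_minus)
  hence eq: "G * Dn pos = Del * h'"
    unfolding h(2) h'_def Del_def by (simp only: prod.distrib prod_constant rconst_power) simp
  have "h' \<in> Laurent" using h(1) unfolding h'_def Laurent_def by (intro alg.mult alg.const)
  hence "h' \<in> Pol" using Laurent_polynomial_times_Del G_Dn_in_Pol eq by simp
  moreover have "N_fun \<Phi> \<alpha> q l = rconst (inverse (of_nat q) ^ card pos) * h'"
    unfolding N_fun_G D_poly_Dn using eq Del_nonzero by (simp add: field_simps)
  ultimately show ?thesis by (auto intro: Pol_mult)
qed

end

theorem theorem2p4: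
  fixes \<Phi> :: "'a::euclidean_space set"
    and \<alpha> :: "'r::{finite,linorder} \<Rightarrow> 'a"
    and q :: nat
    and l :: "'r \<Rightarrow> nat"
  assumes "reduced_root_system \<Phi>"
    and "simple_roots \<Phi> \<alpha>"
    and "simply_laced \<alpha>"
    and "primepow q"
  shows "is_polynomial (N_fun \<Phi> \<alpha> q l)"
proof -
  interpret root_series \<Phi> \<alpha> q l
    using assms primepow_gt_Suc_0[of q] by unfold_locales auto
  show ?thesis
    using N_fun_in_Pol unfolding is_polynomial_def Pol_def .
qed

end
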